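(* Let $\mathcal{W}=\mathcal{W}(\ell_1,\ell_2,\Gamma)=A[D]$ and $\mathcal{W}'=\mathcal{W}(\ell_1',\ell_2',\Gamma')=A'[D']$ be two algebras of Weyl type over $\mathbb{F}$, both regarded as associative algebras, or both regarded as Lie algebras. Then (in either of the two cases) there exists an isomorphism $\sigma:\mathcal{W}\cong\mathcal{W}'$ of associative algebras (respectively, of Lie algebras) if and only if there exist a group isomorphism $\tau:\Gamma\to\Gamma'$ and an $\mathbb{F}$-linear isomorphism $\phi:D\to D'$ such that $\phi(D_2)=D_2'$ and $$(\ell_1,\ell_2)=(\ell_1',\ell_2'),\qquad \langle\alpha,\partial\rangle=\langle\tau(\alpha),\phi(\partial)\rangle\quad\text{for all }\alpha\in\Gamma,\ \partial\in D.$$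
   Context: $\mathbb{F}$ is a field of characteristic $0$; $\mathbb{Z}_+$ is the set of nonnegative integers. Let $\ell_1,\ell_2\ge 0$ be integers with $\ell=\ell_1+\ell_2>0$. Let $\Gamma$ be a nondegenerate additive subgroup of $\mathbb{F}^\ell$, i.e. a subgroup containing an $\mathbb{F}$-basis of $\mathbb{F}^\ell$; its elements are written $\alpha=(\alpha_1,\dots,\alpha_\ell)$. Put $J_1=\mathbb{Z}_+^{\ell_1}\times\{0\}^{\ell_2}$ and $J=\mathbb{Z}_+^{\ell}$, and let $1_{[p]}$ be the $p$-th standard unit vector. $A$ is the semigroup algebra $\mathbb{F}[\Gamma\times J_1]$, with basis $\{x^{\alpha,\vec i}: \alpha\in\Gamma,\ \vec i\in J_1\}$ and product $x^{\alpha,\vec i}x^{\beta,\vec j}=x^{\alpha+\beta,\vec i+\vec j}$; its identity is $1=x^{0,0}$. Define commuting derivations $\partial_1,\dots,\partial_\ell$ of $A$ by $\partial_p(x^{\alpha,\vec i})=\alpha_p x^{\alpha,\vec i}+i_p x^{\alpha,\vec i-1_{[p]}}$ (the last term being $0$ if $i_p=0$; in particular $\partial_p(x^{\alpha,\vec i})=\alpha_p x^{\alpha,\vec i}$ for $p>\ell_1$). Let $D=\mathrm{span}_{\mathbb{F}}\{\partial_1,\dots,\partial_\ell\}$ and $D_2=\mathrm{span}_{\mathbb{F}}\{\partial_q:\ell_1+1\le q\le\ell\}$. The pairing between $\Gamma$ and $D$ is $\langle\alpha,\sum_p a_p\partial_p\rangle=\sum_{p=1}^{\ell} a_p\alpha_p$.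 $\mathbb{F}[D]$ is the polynomial algebra in $\partial_1,\dots,\partial_\ell$, with basis $\partial^\mu=\prod_p\partial_p^{\mu_p}$, $\mu\in J$. The associative algebra of Weyl type is the vector space $\mathcal{W}=\mathcal{W}(\ell_1,\ell_2,\Gamma)=A[D]=A\otimes\mathbb{F}[D]$, with basis $\{x^{\alpha,\vec i}\partial^\mu\}$ and product $$u\partial^\mu\cdot v\partial^\nu=\sum_{\lambda\in J}\binom{\mu}{\lambda}u\,\partial^\lambda(v)\,\partial^{\mu+\nu-\lambda}\qquad(u,v\in A,\ \mu,\nu\in J),$$ where $\binom{\mu}{\lambda}=\prod_p\binom{\mu_p}{\lambda_p}$ (with $\binom{i}{j}=0$ if $i<j$) and $\partial^\lambda(v)$ is the result of applying the operator $\partial^\lambda$ to $v$. The Lie algebra of Weyl type is the same space with bracket $[a,b]=a\cdot b-b\cdot a$. Primed symbols ($\ell_1',\ell_2',\ell',\Gamma',A',D',D_2'$ and the corresponding pairing) denote the corresponding objects for $\mathcal{W}'$. *)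

theory Defs
  imports Complex_Main "HOL-Library.Poly_Mapping" "HOL-Library.Product_Plus"
begin

text \<open>
  Vectors in \<open>F\<^sup>\<ell>\<close> and multi-indices are finitely supported functions on \<open>nat\<close> whose support lies
  in \<open>{1..\<ell>}\<close>, so that \<open>\<ell>\<close> can vary. All operations below are defined on the ambient types of
  finitely supported functions; the parameters \<open>\<ell>\<^sub>1, \<ell>\<^sub>2, \<Gamma>\<close> enter only through the carrier sets.
\<close>

type_synonym 'f vec = "nat \<Rightarrow>\<^sub>0 'f"
type_synonym midx = "nat \<Rightarrow>\<^sub>0 nat"

text \<open>
  The multiplication of \<open>'f alg\<close> provided by the library (convolution) is that of the semigroup
  algebra. In contrast, the library multiplication of \<open>'f weyl\<close> is the commutative polynomial
  product and is not used; see \<open>weyl_mult\<close>.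
\<close>

type_synonym 'f alg = "('f vec \<times> midx) \<Rightarrow>\<^sub>0 'f"
type_synonym 'f weyl = "midx \<Rightarrow>\<^sub>0 'f alg"

definition pm_scale :: "'f::field \<Rightarrow> ('k \<Rightarrow>\<^sub>0 'f) \<Rightarrow> ('k \<Rightarrow>\<^sub>0 'f)" where
  "pm_scale c v = Poly_Mapping.map ((*) c) v"

definition weyl_scale :: "'f::field \<Rightarrow> 'f weyl \<Rightarrow> 'f weyl" where
  "weyl_scale c w = Poly_Mapping.map (pm_scale c) w"

lemma lookup_pm_scale [simp]:
  "Poly_Mapping.lookup (pm_scale c v) k = c * Poly_Mapping.lookup v k"
  by (simp add: pm_scale_def Poly_Mapping.map.rep_eq when_def)

lemma pm_scale_zero [simp]: "pm_scale c 0 = 0"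
  by (rule poly_mapping_eqI) simp

lemma lookup_weyl_scale [simp]:
  "Poly_Mapping.lookup (weyl_scale c w) m = pm_scale c (Poly_Mapping.lookup w m)"
  by (simp add: weyl_scale_def Poly_Mapping.map.rep_eq when_def)

interpretation pm: vector_space pm_scale
  by unfold_locales
    (auto intro!: poly_mapping_eqI simp: lookup_add algebra_simps)

interpretation weyl: vector_space weyl_scale
  by unfold_locales
    (auto intro!: poly_mapping_eqI simp: lookup_add algebra_simps)

definition coord_space :: "nat \<Rightarrow> ('f::field) vec set" where
  "coord_space l = {v. Poly_Mapping.keys v \<subseteq> {1..l}}"

definition multi_indices :: "nat \<Rightarrow> midx set" where
  "multi_indices l = {i. Poly_Mapping.keys i \<subseteq> {1..l}}"

definition nondegenerate_subgroup :: "nat \<Rightarrow> ('f::field) vec set \<Rightarrow> bool" where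
  "nondegenerate_subgroup l \<Gamma> \<longleftrightarrow>
     \<Gamma> \<subseteq> coord_space l \<and> 0 \<in> \<Gamma> \<and>
     (\<forall>\<alpha>\<in>\<Gamma>. \<forall>\<beta>\<in>\<Gamma>. \<alpha> + \<beta> \<in> \<Gamma>) \<and> (\<forall>\<alpha>\<in>\<Gamma>. - \<alpha> \<in> \<Gamma>) \<and>
     (\<exists>B\<subseteq>\<Gamma>. pm.independent B \<and> pm.span B = coord_space l)"

text \<open>
  \<open>J\<^sub>1 = \<int>\<^sub>+\<^bsup>\<ell>\<^sub>1\<^esup> \<times> {0}\<^bsup>\<ell>\<^sub>2\<^esup>\<close> is the set of multi-indices supported in \<open>{1..\<ell>\<^sub>1}\<close>.
\<close>

definition alg_carrier :: "nat \<Rightarrow> ('f::field) vec set \<Rightarrow> 'f alg set" where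
  "alg_carrier l1 \<Gamma> = {u. Poly_Mapping.keys u \<subseteq> \<Gamma> \<times> multi_indices l1}"

definition weyl_carrier :: "nat \<Rightarrow> nat \<Rightarrow> ('f::field) vec set \<Rightarrow> 'f weyl set" where
  "weyl_carrier l1 l2 \<Gamma> =
     {w. Poly_Mapping.keys w \<subseteq> multi_indices (l1 + l2) \<and>
         (\<forall>\<mu>. Poly_Mapping.lookup w \<mu> \<in> alg_carrier l1 \<Gamma>)}"

definition x_monom :: "'f vec \<Rightarrow> midx \<Rightarrow> ('f::field) alg" where
  "x_monom \<alpha> i = Poly_Mapping.single (\<alpha>, i) 1"

definition unit_midx :: "nat \<Rightarrow> midx" where
  "unit_midx p = Poly_Mapping.single p 1"

text \<open>
  If \<open>i\<^sub>p = 0\<close>, the (truncated) difference \<open>i - 1\<^bsub>[p]\<^esub>\<close> is \<open>i\<close>, but the term has coefficient 0.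
\<close>

definition alg_deriv_monom :: "nat \<Rightarrow> 'f vec \<Rightarrow> midx \<Rightarrow> ('f::field) alg" where
  "alg_deriv_monom p \<alpha> i =
     pm_scale (Poly_Mapping.lookup \<alpha> p) (x_monom \<alpha> i) +
     pm_scale (of_nat (Poly_Mapping.lookup i p)) (x_monom \<alpha> (i - unit_midx p))"

definition alg_deriv :: "nat \<Rightarrow> 'f alg \<Rightarrow> ('f::field) alg" where
  "alg_deriv p u =
     (\<Sum>(\<alpha>, i)\<in>Poly_Mapping.keys u.
        pm_scale (Poly_Mapping.lookup u (\<alpha>, i)) (alg_deriv_monom p \<alpha> i))"

text \<open>
  The operator \<open>\<partial>\<^sup>\<rho>\<close>. The derivations commute, so the order of composition is immaterial.
\<close>

definition alg_deriv_pow :: "midx \<Rightarrow> 'f alg \<Rightarrow> ('f::field) alg" where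
  "alg_deriv_pow \<rho> =
     foldr (\<lambda>p g. (alg_deriv p ^^ Poly_Mapping.lookup \<rho> p) \<circ> g)
       (sorted_list_of_set (Poly_Mapping.keys \<rho>)) id"

definition multi_binomial :: "midx \<Rightarrow> midx \<Rightarrow> nat" where
  "multi_binomial \<mu> \<rho> =
     (\<Prod>p\<in>Poly_Mapping.keys \<mu> \<union> Poly_Mapping.keys \<rho>.
        Poly_Mapping.lookup \<mu> p choose Poly_Mapping.lookup \<rho> p)"

definition lower_midx :: "midx \<Rightarrow> midx set" where
  "lower_midx \<mu> = {\<rho>. \<forall>p. Poly_Mapping.lookup \<rho> p \<le> Poly_Mapping.lookup \<mu> p}"

text \<open>
  The set \<open>lower_midx \<mu>\<close> is finite and contains all \<open>\<rho>\<close> with non-zero binomial coefficient, so the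
  sum over \<open>\<rho> \<in> J\<close> in the product formula reduces to a finite sum over \<open>lower_midx \<mu>\<close>.
\<close>

lemma finite_lower_midx: "finite (lower_midx \<mu>)"
proof -
  let ?S = "Poly_Mapping.keys \<mu>"
  let ?N = "\<Sum>p\<in>?S. Poly_Mapping.lookup \<mu> p"
  have bound: "Poly_Mapping.lookup \<mu> p \<le> ?N" for p
  proof (cases "p \<in> ?S")
    case True
    then show ?thesis by (intro member_le_sum) auto
  next
    case False
    then show ?thesis by (simp add: in_keys_iff)
  qed
  have "Poly_Mapping.lookup ` lower_midx \<mu> \<subseteq> {f. \<forall>p. (p \<in> ?S \<longrightarrow> f p \<in> {..?N}) \<and> (p \<notin> ?S \<longrightarrow> f p = 0)}"
    using bound by (auto simp: lower_midx_def in_keys_iff intro: le_trans)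
      (metis le_zero_eq)
  moreover have "finite {f. \<forall>p. (p \<in> ?S \<longrightarrow> f p \<in> {..?N}) \<and> (p \<notin> ?S \<longrightarrow> f p = 0)}"
    by (rule finite_set_of_finite_funs) auto
  ultimately have "finite (Poly_Mapping.lookup ` lower_midx \<mu>)"
    by (rule finite_subset)
  moreover have "inj_on Poly_Mapping.lookup (lower_midx \<mu>)"
    by (auto intro: inj_onI poly_mapping_eqI)
  ultimately show ?thesis
    by (rule finite_imageD)
qed

lemma multi_binomial_eq_0:
  assumes "\<rho> \<notin> lower_midx \<mu>"
  shows "multi_binomial \<mu> \<rho> = 0"
proof -
  from assms obtain p where p: "Poly_Mapping.lookup \<mu> p < Poly_Mapping.lookup \<rho> p"
    by (auto simp: lower_midx_def not_le)
  then have "p \<in> Poly_Mapping.keys \<rho>" by (auto simp: in_keys_iff)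
  with p show ?thesis by (auto simp: multi_binomial_def intro!: bexI[of _ p])
qed

definition weyl_mult_monom :: "('f::field) alg \<Rightarrow> midx \<Rightarrow> 'f alg \<Rightarrow> midx \<Rightarrow> 'f weyl" where
  "weyl_mult_monom u \<mu> v \<nu> =
     (\<Sum>\<rho>\<in>lower_midx \<mu>.
        Poly_Mapping.single (\<mu> + \<nu> - \<rho>)
          (pm_scale (of_nat (multi_binomial \<mu> \<rho>)) (u * alg_deriv_pow \<rho> v)))"

definition weyl_mult :: "('f::field) weyl \<Rightarrow> 'f weyl \<Rightarrow> 'f weyl" where
  "weyl_mult a b =
     (\<Sum>\<mu>\<in>Poly_Mapping.keys a. \<Sum>\<nu>\<in>Poly_Mapping.keys b.
        weyl_mult_monom (Poly_Mapping.lookup a \<mu>) \<mu> (Poly_Mapping.lookup b \<nu>) \<nu>)"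

definition weyl_bracket :: "('f::field) weyl \<Rightarrow> 'f weyl \<Rightarrow> 'f weyl" where
  "weyl_bracket a b = weyl_mult a b - weyl_mult b a"

text \<open>
  The space \<open>D\<close> and its subspace \<open>D\<^sub>2\<close> are regarded as subspaces of \<open>A[D]\<close>, where \<open>\<partial>\<^sub>p\<close> is the
  element \<open>1 \<partial>\<^sup>\<mu>\<close> with \<open>\<mu> = 1\<^bsub>[p]\<^esub>\<close>.
\<close>

definition partial_elem :: "nat \<Rightarrow> ('f::field) weyl" where
  "partial_elem p = Poly_Mapping.single (unit_midx p) (x_monom 0 0)"

definition D_space :: "nat \<Rightarrow> nat \<Rightarrow> ('f::field) weyl set" where
  "D_space l1 l2 = weyl.span (partial_elem ` {1..l1 + l2})"

definition D2_space :: "nat \<Rightarrow> nat \<Rightarrow> ('f::field) weyl set" where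
  "D2_space l1 l2 = weyl.span (partial_elem ` {l1 + 1..l1 + l2})"

definition D_coeff :: "('f::field) weyl \<Rightarrow> nat \<Rightarrow> 'f" where
  "D_coeff d p = Poly_Mapping.lookup (Poly_Mapping.lookup d (unit_midx p)) (0, 0)"

definition pairing :: "nat \<Rightarrow> ('f::field) vec \<Rightarrow> 'f weyl \<Rightarrow> 'f" where
  "pairing l \<alpha> d = (\<Sum>p = 1..l. D_coeff d p * Poly_Mapping.lookup \<alpha> p)"

lemma D_coeff_sum:
  fixes a :: "nat \<Rightarrow> 'f::field"
  assumes "p \<in> {1..l}"
  shows "D_coeff (\<Sum>q = 1..l. weyl_scale (a q) (partial_elem q)) p = a p"
proof -
  have [simp]: "unit_midx q = unit_midx p \<longleftrightarrow> q = p" for q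
  proof
    assume eq: "unit_midx q = unit_midx p"
    have "Poly_Mapping.lookup (unit_midx q) q = Poly_Mapping.lookup (unit_midx p) q"
      by (simp only: eq)
    then show "q = p"
      by (simp add: unit_midx_def lookup_single when_def split: if_splits)
  qed simp
  have "D_coeff (\<Sum>q = 1..l. weyl_scale (a q) (partial_elem q)) p =
      (\<Sum>q = 1..l. if q = p then a q else 0)"
    unfolding D_coeff_def lookup_sum
    by (intro sum.cong refl)
      (simp add: partial_elem_def x_monom_def lookup_single when_def zero_prod_def)
  also have "\<dots> = a p"
    using assms by simp
  finally show ?thesis .
qed

definition linear_iso ::
  "('f::field) weyl set \<Rightarrow> 'f weyl set \<Rightarrow> ('f weyl \<Rightarrow> 'f weyl) \<Rightarrow> bool" where
  "linear_iso V V' f \<longleftrightarrow>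
     bij_betw f V V' \<and>
     (\<forall>a\<in>V. \<forall>b\<in>V. f (a + b) = f a + f b) \<and>
     (\<forall>c. \<forall>a\<in>V. f (weyl_scale c a) = weyl_scale c (f a))"

text \<open>
  For the associative product, preservation of the identity need not be required: it holds for every
  surjective multiplicative map.
\<close>

definition assoc_iso ::
  "('f::field) weyl set \<Rightarrow> 'f weyl set \<Rightarrow> ('f weyl \<Rightarrow> 'f weyl) \<Rightarrow> bool" where
  "assoc_iso V V' \<sigma> \<longleftrightarrow>
     linear_iso V V' \<sigma> \<and> (\<forall>a\<in>V. \<forall>b\<in>V. \<sigma> (weyl_mult a b) = weyl_mult (\<sigma> a) (\<sigma> b))"

definition lie_iso ::
  "('f::field) weyl set \<Rightarrow> 'f weyl set \<Rightarrow> ('f weyl \<Rightarrow> 'f weyl) \<Rightarrow> bool" where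
  "lie_iso V V' \<sigma> \<longleftrightarrow>
     linear_iso V V' \<sigma> \<and> (\<forall>a\<in>V. \<forall>b\<in>V. \<sigma> (weyl_bracket a b) = weyl_bracket (\<sigma> a) (\<sigma> b))"

definition group_iso :: "('f::field) vec set \<Rightarrow> 'f vec set \<Rightarrow> ('f vec \<Rightarrow> 'f vec) \<Rightarrow> bool" where
  "group_iso \<Gamma> \<Gamma>' \<tau> \<longleftrightarrow>
     bij_betw \<tau> \<Gamma> \<Gamma>' \<and> (\<forall>\<alpha>\<in>\<Gamma>. \<forall>\<beta>\<in>\<Gamma>. \<tau> (\<alpha> + \<beta>) = \<tau> \<alpha> + \<tau> \<beta>)"

end

(*
  If sigma is a Lie isomorphism, W = A[D] is analysed through its locally split elements: those w for
  which every v in W is annihilated by some product of operators ad w - c.  They form exactly A + D.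
  That A + D is locally split follows by induction on order and t-degree.  Conversely, if w has order
  at least 2 or a nonconstant first-order coefficient, take its leading part x^alpha t^i h(d) with
  respect to a total order on (order, Gamma, t-exponents) chosen so that bracketing with w raises
  leading keys; the leading parts of successive brackets applied to x^beta then follow the Poisson
  recursion q' = (D_beta h) q - h (D_alpha q), and restricting to a line in direction alpha shows
  that for a suitable beta in Gamma they never vanish.
  Inside A + D, the algebra A consists of the w with (ad w)^2 = 0 on A + D, so sigma induces linear
  isomorphisms A -> A' and D = (A + D)/A -> D' compatible with the action of D on A.  The weights of
  this action are the elements of Gamma, and D_2 consists of the d with ker d^2 = ker d on A.
  Conversely, tau and phi define an algebra isomorphism A -> A' intertwining the derivations, and
  conjugating differential operators by it carries W onto W', since W acts faithfully on A.
*)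

theory Submission
  imports Defs "HOL-Computational_Algebra.Polynomial"
begin

text \<open>A Lie isomorphism is not assumed to respect products, the order filtration or A, so all
  data must be recovered from brackets and scalars. The scalars c in ad w - c do no harm in the
  negative half: bracketing with w strictly raises the leading key, so c v stays below the leading
  part of [w, v], and for given w and beta the leading part after n steps depends on n alone. F need
  not be ordered, so the order on keys comes from Zorn's lemma. It must depend on w: if w has order
  1 and a term at x^alpha1, bracketing raises keys only when alpha1 counts as positive. Along xi + y
  alpha the operator D_alpha is d/dy, so the recursion becomes one for univariate polynomials, where
  degrees can be compared. sigma sends D only into A' + D', so phi is sigma followed by the
  projection to D'. The map A -> A' is used as a linear map; tau is read off from joint eigenvectors
  and is additive because the pairing is. In the converse, the images of the variables t_p are
  dictated by the inverse matrix of phi modulo D_2; this is where phi(D_2) = D_2' enters.\<close>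

abbreviation (input) lookup :: "('a \<Rightarrow>\<^sub>0 'b::zero) \<Rightarrow> 'a \<Rightarrow> 'b" where
  "lookup \<equiv> Poly_Mapping.lookup"

abbreviation (input) keys :: "('a \<Rightarrow>\<^sub>0 'b::zero) \<Rightarrow> 'a set" where
  "keys \<equiv> Poly_Mapping.keys"

abbreviation (input) single :: "'a \<Rightarrow> 'b \<Rightarrow> ('a \<Rightarrow>\<^sub>0 'b::zero)" where
  "single \<equiv> Poly_Mapping.single"

section \<open>Finitely supported functions and multi-indices\<close>

lemma sum_keys_superset:
  assumes "finite K" "keys a \<subseteq> K" "\<And>k. f k 0 = 0"
  shows "(\<Sum>k\<in>keys a. f k (lookup a k)) = (\<Sum>k\<in>K. f k (lookup a k))"
  using assms by (intro sum.mono_neutral_left) (auto simp: in_keys_iff)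

text \<open>The support of \<open>a + b\<close> may be smaller than the union of the two supports;
  summing over the union, where \<open>f k 0 = 0\<close> kills the extra terms, avoids the problem.
  Operations defined as sums over \<open>keys\<close> get their additivity from here.\<close>

lemma sum_keys_add:
  fixes a b :: "'k \<Rightarrow>\<^sub>0 'b::comm_monoid_add" and f :: "'k \<Rightarrow> 'b \<Rightarrow> 'c::comm_monoid_add"
  assumes "\<And>k. f k 0 = 0" "\<And>k x y. f k (x + y) = f k x + f k y"
  shows "(\<Sum>k\<in>keys (a + b). f k (lookup (a + b) k)) =
    (\<Sum>k\<in>keys a. f k (lookup a k)) + (\<Sum>k\<in>keys b. f k (lookup b k))"
proof -
  have fin: "finite (keys a \<union> keys b)" by simp
  show ?thesis
    using sum_keys_superset[OF fin Poly_Mapping.keys_add, of f]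
      sum_keys_superset[OF fin, of a f] sum_keys_superset[OF fin, of b f]
    by (simp add: assms lookup_add sum.distrib)
qed

lemma poly_mapping_eq_sum_single: "a = (\<Sum>k\<in>keys a. single k (lookup a k))"
  by (rule poly_mapping_eqI)
    (auto simp: lookup_sum lookup_single when_def in_keys_iff)

lemma poly_mapping_add_induct [case_names zero add single]:
  assumes "P 0" "\<And>a b. P a \<Longrightarrow> P b \<Longrightarrow> P (a + b)"
    and "\<And>k. k \<in> keys a \<Longrightarrow> P (single k (lookup a k))"
  shows "P (a :: 'k \<Rightarrow>\<^sub>0 'b::comm_monoid_add)"
proof -
  have "P (\<Sum>k\<in>K. single k (lookup a k))" if "finite K" "K \<subseteq> keys a" for K
    using that by (induction K rule: finite_induct) (auto simp: assms)
  from this[of "keys a"] show ?thesis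
    using poly_mapping_eq_sum_single[of a] by simp
qed

text \<open>Agreement on monomials is required only at keys of \<open>a\<close>, so facts about the
  support of \<open>a\<close>, such as membership in a carrier, can be used for each
  monomial.\<close>

lemma additive_eqI:
  fixes f g :: "('k \<Rightarrow>\<^sub>0 'b::comm_monoid_add) \<Rightarrow> 'c::ab_group_add"
  assumes f: "\<And>a b. f (a + b) = f a + f b" and g: "\<And>a b. g (a + b) = g a + g b"
    and fg: "\<And>k c. k \<in> keys a \<Longrightarrow> f (single k c) = g (single k c)"
  shows "f a = g a"
proof -
  have "f 0 = 0" "g 0 = 0" using f[of 0 0] g[of 0 0] by simp_all
  then show ?thesis
    using fg by (intro poly_mapping_add_induct[of "\<lambda>a. f a = g a" a]) (simp_all add: f g)
qed

lemma single_inject [simp]: "single k a = single k b \<longleftrightarrow> a = b"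
  by (metis lookup_single_eq)

lemma single_eq_0_iff [simp]: "single k v = 0 \<longleftrightarrow> v = 0"
  by (metis lookup_single_eq lookup_zero single_zero)

lemma single_sum: "single k (sum f S) = (\<Sum>s\<in>S. single k (f s))"
  by (induction S rule: infinite_finite_induct) (simp_all add: single_add)

lemma pm_scale_single [simp]: "pm_scale c (single k d) = single k (c * d)"
  by (rule poly_mapping_eqI) (simp add: lookup_single when_def)

lemma weyl_scale_single [simp]: "weyl_scale c (single k d) = single k (pm_scale c d)"
  by (rule poly_mapping_eqI) (simp add: lookup_single when_def)

lemma pm_scale_mult_left: "pm_scale c (u * v) = pm_scale c u * (v :: ('k::comm_monoid_add \<Rightarrow>\<^sub>0 'f::field))"
  by (simp add: pm_scale_def mult_map_scale_conv_mult algebra_simps)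

lemma pm_scale_mult_right: "pm_scale c (u * v) = u * pm_scale c (v :: ('k::comm_monoid_add \<Rightarrow>\<^sub>0 'f::field))"
  by (simp add: pm_scale_def mult_map_scale_conv_mult algebra_simps)

section \<open>Total degree of multi-indices and removal of a unit\<close>

definition mdeg :: "midx \<Rightarrow> nat" where
  "mdeg \<mu> = (\<Sum>p\<in>keys \<mu>. lookup \<mu> p)"

lemma mdeg_zero [simp]: "mdeg 0 = 0"
  by (simp add: mdeg_def)

lemma mdeg_add [simp]: "mdeg (\<mu> + \<nu>) = mdeg \<mu> + mdeg \<nu>"
  unfolding mdeg_def by (rule sum_keys_add) auto

lemma mdeg_unit [simp]: "mdeg (unit_midx p) = 1"
  by (simp add: mdeg_def unit_midx_def)

lemma mdeg_eq_0_iff [simp]: "mdeg \<mu> = 0 \<longleftrightarrow> \<mu> = 0"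
proof
  assume "mdeg \<mu> = 0"
  then show "\<mu> = 0" by (intro poly_mapping_eqI) (auto simp: mdeg_def in_keys_iff)
qed simp

lemma lookup_unit: "lookup (unit_midx p) q = (if q = p then 1 else 0)"
  by (simp add: unit_midx_def lookup_single when_def)

lemma keys_unit [simp]: "keys (unit_midx p) = {p}"
  by (simp add: unit_midx_def)

lemma unit_midx_inj [simp]: "unit_midx p = unit_midx q \<longleftrightarrow> p = q"
  by (metis keys_unit singleton_inject)

lemma unit_midx_neq_0 [simp]: "unit_midx p \<noteq> 0" "0 \<noteq> unit_midx p"
  by (metis keys_unit insert_not_empty keys_zero)+

lemma midx_minus_unit_add:
  assumes "lookup \<mu> p \<noteq> 0"
  shows "\<mu> - unit_midx p + unit_midx p = \<mu>"
  by (rule poly_mapping_eqI) (use assms in \<open>auto simp: lookup_add lookup_minus lookup_unit\<close>)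

lemma keys_add_midx: "keys (\<mu> + \<nu> :: midx) = keys \<mu> \<union> keys \<nu>"
  by (auto simp: in_keys_iff lookup_add)

lemma keys_minus_midx: "keys (\<mu> - \<nu> :: midx) \<subseteq> keys \<mu>"
  by (auto simp: in_keys_iff lookup_minus)

lemma mdeg_minus_unit: "lookup \<mu> p \<noteq> 0 \<Longrightarrow> Suc (mdeg (\<mu> - unit_midx p)) = mdeg \<mu>"
  by (metis mdeg_add mdeg_unit midx_minus_unit_add Suc_eq_plus1)

text \<open>Induction on \<open>mdeg\<close>, removing one unit at a time. The set \<open>K\<close>
  keeps the support inside a fixed range of indices.\<close>

lemma midx_induct [consumes 1, case_names zero add_unit]:
  assumes "keys m \<subseteq> K" "P 0"
    and "\<And>\<mu> p. keys \<mu> \<subseteq> K \<Longrightarrow> p \<in> K \<Longrightarrow> P \<mu> \<Longrightarrow> P (\<mu> + unit_midx p)"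
  shows "P m"
  using assms(1)
proof (induction "mdeg m" arbitrary: m)
  case 0
  then show ?case using assms(2) by simp
next
  case (Suc n)
  then have "m \<noteq> 0" by auto
  then obtain p where p: "p \<in> keys m" by (metis keys_eq_empty ex_in_conv)
  then have p': "lookup m p \<noteq> 0" by (simp add: in_keys_iff)
  have k: "keys (m - unit_midx p) \<subseteq> K"
    using keys_minus_midx Suc.prems by blast
  have "P (m - unit_midx p)"
    using Suc.hyps(1)[of "m - unit_midx p"] Suc.hyps(2) k mdeg_minus_unit[OF p'] by simp
  from assms(3)[OF k _ this, of p] show ?case
    using p Suc.prems midx_minus_unit_add[OF p'] by auto
qed

section \<open>The derivations and their powers\<close>

lemma alg_deriv_monom_eq:
  "alg_deriv_monom p \<alpha> i = single (\<alpha>, i) (lookup \<alpha> p) +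
    single (\<alpha>, i - unit_midx p) (of_nat (lookup i p))"
  by (simp add: alg_deriv_monom_def x_monom_def)

lemma alg_deriv_add: "alg_deriv p (u + v) = alg_deriv p u + alg_deriv p v"
  unfolding alg_deriv_def case_prod_beta prod.collapse
  by (rule sum_keys_add[where f = "\<lambda>k c. pm_scale c (alg_deriv_monom p (fst k) (snd k))"])
    (simp_all add: pm.scale_left_distrib)

lemma alg_deriv_zero [simp]: "alg_deriv p 0 = 0"
  by (simp add: alg_deriv_def)

lemma alg_deriv_single:
  "alg_deriv p (single (\<alpha>, i) c) = single (\<alpha>, i) (c * lookup \<alpha> p) +
    single (\<alpha>, i - unit_midx p) (c * of_nat (lookup i p))"
  by (cases "c = 0") (simp_all add: alg_deriv_def alg_deriv_monom_eq pm.scale_right_distrib)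

lemma alg_deriv_sum: "alg_deriv p (sum f S) = (\<Sum>s\<in>S. alg_deriv p (f s))"
  by (induction S rule: infinite_finite_induct) (simp_all add: alg_deriv_add)

lemma alg_deriv_scale: "alg_deriv p (pm_scale c u) = pm_scale c (alg_deriv p u)"
proof (rule additive_eqI[where f = "\<lambda>u. alg_deriv p (pm_scale c u)" and g = "\<lambda>u. pm_scale c (alg_deriv p u)"])
  fix k d show "alg_deriv p (pm_scale c (single k d)) = pm_scale c (alg_deriv p (single k d))"
    by (cases k) (simp add: alg_deriv_single pm.scale_right_distrib algebra_simps)
qed (simp_all add: alg_deriv_add pm.scale_right_distrib)

lemma alg_deriv_mult:
  fixes u v :: "'f::field alg"
  shows "alg_deriv p (u * v) = alg_deriv p u * v + u * alg_deriv p v"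
proof (rule additive_eqI[where f = "\<lambda>u. alg_deriv p (u * v)" and g = "\<lambda>u. alg_deriv p u * v + u * alg_deriv p v"])
  fix k :: "'f vec \<times> midx" and c
  show "alg_deriv p (single k c * v) = alg_deriv p (single k c) * v + single k c * alg_deriv p v"
  proof (rule additive_eqI[where f = "\<lambda>v. alg_deriv p (single k c * v)" and g = "\<lambda>v. alg_deriv p (single k c) * v + single k c * alg_deriv p v"])
    fix l :: "'f vec \<times> midx" and d
    obtain \<alpha> \<beta> :: "'f vec" and i j where kl: "k = (\<alpha>, i)" "l = (\<beta>, j)" by fastforce
    \<comment> \<open>If \<open>lookup i p = 0\<close>, truncated subtraction can make the two
      exponents differ, but then both coefficients vanish.\<close>
    have 1: "single (\<alpha> + \<beta>, i + j - unit_midx p) (c * d * of_nat (lookup i p)) =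
        single (\<alpha> + \<beta>, i - unit_midx p + j) (c * d * of_nat (lookup i p))"
    proof (cases "lookup i p = 0")
      case False
      then have "i + j - unit_midx p = i - unit_midx p + j"
        by (intro poly_mapping_eqI) (auto simp: lookup_add lookup_minus lookup_unit)
      then show ?thesis by simp
    qed simp
    have 2: "single (\<alpha> + \<beta>, i + j - unit_midx p) (c * d * of_nat (lookup j p)) =
        single (\<alpha> + \<beta>, i + (j - unit_midx p)) (c * d * of_nat (lookup j p))"
    proof (cases "lookup j p = 0")
      case False
      then have "i + j - unit_midx p = i + (j - unit_midx p)"
        by (intro poly_mapping_eqI) (auto simp: lookup_add lookup_minus lookup_unit)
      then show ?thesis by simp
    qed simp
    show "alg_deriv p (single k c * single l d) =
      alg_deriv p (single k c) * single l d + single k c * alg_deriv p (single l d)"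
      using 1 2 by (simp add: kl mult_single alg_deriv_single ring_distribs single_add lookup_add mult_ac add_ac)
  qed (simp_all add: alg_deriv_add algebra_simps)
qed (simp_all add: alg_deriv_add algebra_simps)

lemma alg_deriv_one [simp]: "alg_deriv p 1 = 0"
  using alg_deriv_mult[of p 1 1] by simp

lemma alg_deriv_commute: "alg_deriv p (alg_deriv q u) = alg_deriv q (alg_deriv p u)"
proof (rule additive_eqI[where f = "\<lambda>u. alg_deriv p (alg_deriv q u)" and g = "\<lambda>u. alg_deriv q (alg_deriv p u)"])
  fix k :: "'a vec \<times> midx" and c
  obtain \<alpha> i where k: "k = (\<alpha>, i)" by fastforce
  have "i - unit_midx q - unit_midx p = i - unit_midx p - unit_midx q"
    by (rule poly_mapping_eqI) (simp add: lookup_minus)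
  then show "alg_deriv p (alg_deriv q (single k c)) = alg_deriv q (alg_deriv p (single k c))"
    by (cases "p = q") (simp_all add: k alg_deriv_single alg_deriv_add lookup_minus lookup_unit mult_ac add_ac)
qed (simp_all add: alg_deriv_add)

lemma foldr_funpow_filter:
  "foldr (\<lambda>p g. (f p ^^ r p) \<circ> g) (filter (\<lambda>p. r p \<noteq> 0) xs) id =
    foldr (\<lambda>p g. (f p ^^ r p) \<circ> g) xs id"
  by (induction xs) auto

text \<open>Since the operators commute, the additional factor \<open>f q\<close> can be moved to
  the front from wherever \<open>q\<close> stands in the list.\<close>

lemma foldr_funpow_Suc:
  assumes "\<And>p q x. f p (f q x) = f q (f p x)" "distinct xs" "q \<in> set xs"
    and "r' q = Suc (r q)" "\<And>p. p \<noteq> q \<Longrightarrow> r' p = r p"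
  shows "foldr (\<lambda>p g. (f p ^^ r' p) \<circ> g) xs id = f q \<circ> foldr (\<lambda>p g. (f p ^^ r p) \<circ> g) xs id"
  using assms(2,3)
proof (induction xs)
  case (Cons y xs)
  have pow: "f q ((f p ^^ n) x) = (f p ^^ n) (f q x)" for p n x
    by (induction n) (simp_all add: assms(1))
  show ?case
  proof (cases "y = q")
    case True
    have "r' x = r x" if "x \<in> set xs" for x
      using that True Cons.prems assms(5) by (metis distinct.simps(2))
    then have eq: "foldr (\<lambda>p g. (f p ^^ r' p) \<circ> g) xs id = foldr (\<lambda>p g. (f p ^^ r p) \<circ> g) xs id"
      by (intro foldr_cong) (auto simp: fun_eq_iff)
    have "foldr (\<lambda>p g. (f p ^^ r' p) \<circ> g) (y # xs) id =
        (f y ^^ r' y) \<circ> foldr (\<lambda>p g. (f p ^^ r' p) \<circ> g) xs id"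
      by simp
    also have "\<dots> = f q \<circ> ((f q ^^ r q) \<circ> foldr (\<lambda>p g. (f p ^^ r p) \<circ> g) xs id)"
      unfolding eq True assms(4) by (simp add: comp_assoc)
    also have "\<dots> = f q \<circ> foldr (\<lambda>p g. (f p ^^ r p) \<circ> g) (y # xs) id"
      using True by simp
    finally show ?thesis .
  next
    case False
    then show ?thesis using Cons assms(5) by (simp add: fun_eq_iff pow)
  qed
qed simp

text \<open>Different exponents have different supports, hence different lists; a common superset
  \<open>K\<close> allows their powers to be compared factor by factor.\<close>

lemma alg_deriv_pow_superset:
  assumes "finite K" "keys \<rho> \<subseteq> K"
  shows "alg_deriv_pow \<rho> =
    foldr (\<lambda>p g. (alg_deriv p ^^ lookup \<rho> p) \<circ> g) (sorted_list_of_set K) id"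
proof -
  have "sorted_list_of_set (keys \<rho>) = filter (\<lambda>p. lookup \<rho> p \<noteq> 0) (sorted_list_of_set K)"
    using assms by (intro sorted_distinct_set_unique)
      (auto simp: in_keys_iff intro: sorted_wrt_filter)
  then show ?thesis unfolding alg_deriv_pow_def
    by (simp only: foldr_funpow_filter)
qed

lemma alg_deriv_pow_zero [simp]: "alg_deriv_pow 0 u = u"
  by (simp add: alg_deriv_pow_def)

lemma alg_deriv_pow_add_unit:
  fixes u :: "'f::field alg"
  shows "alg_deriv_pow (\<rho> + unit_midx p) u = alg_deriv p (alg_deriv_pow \<rho> u)"
proof -
  have "alg_deriv_pow (\<rho> + unit_midx p) = alg_deriv p \<circ> (alg_deriv_pow \<rho> :: 'f alg \<Rightarrow> _)"
  proof -
    have K: "finite (insert p (keys \<rho>))" "keys (\<rho> + unit_midx p) \<subseteq> insert p (keys \<rho>)"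
      "keys \<rho> \<subseteq> insert p (keys \<rho>)"
      by (auto simp: keys_add_midx)
    show ?thesis
      unfolding alg_deriv_pow_superset[OF K(1,2)] alg_deriv_pow_superset[OF K(1,3)]
      by (rule foldr_funpow_Suc)
        (simp_all add: alg_deriv_commute lookup_add lookup_unit del: sorted_list_of_set_insert_remove)
  qed
  then show ?thesis by simp
qed

lemma alg_deriv_pow_unit [simp]: "alg_deriv_pow (unit_midx p) = alg_deriv p"
  using alg_deriv_pow_add_unit[of 0 p] by auto

lemma alg_deriv_pow_induct:
  assumes "Q u" "\<And>p v. p \<in> keys \<rho> \<Longrightarrow> Q v \<Longrightarrow> Q (alg_deriv p v)"
  shows "Q (alg_deriv_pow \<rho> u)"
  using order_refl[of "keys \<rho>"]
proof (induction \<rho> rule: midx_induct)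
  case zero
  then show ?case using assms(1) by simp
next
  case (add_unit \<mu> p)
  then show ?case using assms(2) by (simp add: alg_deriv_pow_add_unit)
qed

lemma alg_deriv_pow_zero_right [simp]: "alg_deriv_pow \<rho> 0 = 0"
  by (rule alg_deriv_pow_induct) simp_all

lemma alg_deriv_pow_add: "alg_deriv_pow \<rho> (u + v) = alg_deriv_pow \<rho> u + alg_deriv_pow \<rho> v"
  using subset_UNIV[of "keys \<rho>"]
  by (induction \<rho> rule: midx_induct) (simp_all add: alg_deriv_pow_add_unit alg_deriv_add)

lemma alg_deriv_pow_scale: "alg_deriv_pow \<rho> (pm_scale c u) = pm_scale c (alg_deriv_pow \<rho> u)"
  using subset_UNIV[of "keys \<rho>"]
  by (induction \<rho> rule: midx_induct) (simp_all add: alg_deriv_pow_add_unit alg_deriv_scale)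

lemma alg_deriv_pow_comp: "alg_deriv_pow (\<rho> + \<nu>) u = alg_deriv_pow \<rho> (alg_deriv_pow \<nu> u)"
  using subset_UNIV[of "keys \<rho>"]
proof (induction \<rho> rule: midx_induct)
  case (add_unit \<mu> p)
  have "alg_deriv_pow (\<mu> + unit_midx p + \<nu>) u = alg_deriv_pow (\<mu> + \<nu> + unit_midx p) u"
    by (simp add: ac_simps)
  then show ?case using add_unit by (simp add: alg_deriv_pow_add_unit)
qed simp

lemma alg_deriv_pow_one: "alg_deriv_pow \<rho> 1 = (if \<rho> = 0 then 1 else 0)"
proof (cases "\<rho> = 0")
  case False
  then obtain p where p: "lookup \<rho> p \<noteq> 0" by (metis poly_mapping_eqI lookup_zero)
  have "alg_deriv_pow \<rho> 1 = alg_deriv_pow (\<rho> - unit_midx p) (alg_deriv_pow (unit_midx p) 1)"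
    by (simp only: alg_deriv_pow_comp[symmetric] midx_minus_unit_add[OF p])
  then show ?thesis using False by simp
qed simp

section \<open>Differential operators\<close>

lemma lower_midx_superset: "lower_midx \<mu> \<subseteq> lower_midx (\<mu> + \<nu>)"
  by (auto simp: lower_midx_def lookup_add intro: trans_le_add1)

lemma multi_binomial_superset:
  assumes "finite K" "keys \<mu> \<union> keys \<rho> \<subseteq> K"
  shows "multi_binomial \<mu> \<rho> = (\<Prod>p\<in>K. lookup \<mu> p choose lookup \<rho> p)"
  unfolding multi_binomial_def using assms
  by (intro prod.mono_neutral_left) (auto simp: in_keys_iff)

lemma multi_binomial_zero [simp]: "multi_binomial \<mu> 0 = 1"
  by (simp add: multi_binomial_def)

lemma multi_binomial_unit [simp]: "multi_binomial \<mu> (unit_midx p) = lookup \<mu> p"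
proof -
  have "multi_binomial \<mu> (unit_midx p) =
      (\<Prod>q\<in>insert p (keys \<mu>). lookup \<mu> q choose lookup (unit_midx p) q)"
    by (rule multi_binomial_superset) auto
  then show ?thesis by (simp add: prod.insert_remove lookup_unit)
qed

text \<open>Pascal's rule in the component \<open>p\<close>, with the other components as a common
  factor. The conditional supplies the convention that a binomial with lower entry -1 is 0, which
  truncated subtraction would miss.\<close>

lemma multi_binomial_Suc:
  "multi_binomial (\<mu> + unit_midx p) \<rho> = multi_binomial \<mu> \<rho> +
    (if lookup \<rho> p = 0 then 0 else multi_binomial \<mu> (\<rho> - unit_midx p))"
proof -
  define K where "K = insert p (keys \<mu> \<union> keys \<rho>)"
  have K: "finite K" "p \<in> K" "keys (\<mu> + unit_midx p) \<union> keys \<rho> \<subseteq> K" "keys \<mu> \<union> keys \<rho> \<subseteq> K"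
    "keys \<mu> \<union> keys (\<rho> - unit_midx p) \<subseteq> K"
    using keys_minus_midx[of \<rho> "unit_midx p"] by (auto simp: K_def keys_add_midx)
  let ?R = "\<Prod>q\<in>K - {p}. lookup \<mu> q choose lookup \<rho> q"
  have "multi_binomial (\<mu> + unit_midx p) \<rho> = (Suc (lookup \<mu> p) choose lookup \<rho> p) * ?R"
    by (simp add: multi_binomial_superset[OF K(1,3)] prod.remove[OF K(1,2)] lookup_add lookup_unit)
  moreover have "multi_binomial \<mu> \<rho> = (lookup \<mu> p choose lookup \<rho> p) * ?R"
    by (simp add: multi_binomial_superset[OF K(1,4)] prod.remove[OF K(1,2)])
  moreover have "multi_binomial \<mu> (\<rho> - unit_midx p) = (lookup \<mu> p choose (lookup \<rho> p - 1)) * ?R"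
    by (simp add: multi_binomial_superset[OF K(1,5)] prod.remove[OF K(1,2)] lookup_minus lookup_unit)
  ultimately show ?thesis
    by (cases "lookup \<rho> p") (simp_all add: algebra_simps)
qed

lemma alg_deriv_pow_mult:
  "alg_deriv_pow \<mu> (u * v) = (\<Sum>\<rho>\<in>lower_midx \<mu>.
    of_nat (multi_binomial \<mu> \<rho>) * (alg_deriv_pow \<rho> u * alg_deriv_pow (\<mu> - \<rho>) v))"
  using subset_UNIV[of "keys \<mu>"]
proof (induction \<mu> rule: midx_induct)
  case zero
  have "lower_midx 0 = {0}" by (auto simp: lower_midx_def intro: poly_mapping_eqI)
  then show ?case by simp
next
  case (add_unit \<mu> p)
  let ?\<mu>' = "\<mu> + unit_midx p" and ?e = "unit_midx p"
  let ?g = "\<lambda>\<rho> \<nu>. alg_deriv_pow \<rho> u * alg_deriv_pow \<nu> v"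
  have of_nat_deriv: "alg_deriv p (of_nat n * w) = of_nat n * alg_deriv p w" for n and w :: "'a alg"
  proof -
    have "alg_deriv p (of_nat n :: 'a alg) = 0" by (induction n) (simp_all add: alg_deriv_add)
    then show ?thesis by (simp add: alg_deriv_mult)
  qed
  have "alg_deriv_pow ?\<mu>' (u * v) = (\<Sum>\<rho>\<in>lower_midx \<mu>. of_nat (multi_binomial \<mu> \<rho>) *
      (?g (\<rho> + ?e) (\<mu> - \<rho>) + ?g \<rho> (\<mu> - \<rho> + ?e)))"
    by (simp only: alg_deriv_pow_add_unit add_unit.IH alg_deriv_sum of_nat_deriv)
      (simp only: alg_deriv_mult)
  also have "\<dots> = (\<Sum>\<rho>\<in>lower_midx \<mu>. of_nat (multi_binomial \<mu> \<rho>) * ?g (\<rho> + ?e) (\<mu> - \<rho>)) +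
      (\<Sum>\<rho>\<in>lower_midx \<mu>. of_nat (multi_binomial \<mu> \<rho>) * ?g \<rho> (\<mu> - \<rho> + ?e))"
    by (simp add: algebra_simps sum.distrib)
  \<comment> \<open>When the new derivative falls on \<open>u\<close>, the index is shifted by
    \<open>?e\<close>; the shifted indices are exactly those with nonzero entry at
    \<open>p\<close>.\<close>
  also have "(\<Sum>\<rho>\<in>lower_midx \<mu>. of_nat (multi_binomial \<mu> \<rho>) * ?g (\<rho> + ?e) (\<mu> - \<rho>)) =
      (\<Sum>\<rho>\<in>{\<rho>\<in>lower_midx ?\<mu>'. lookup \<rho> p \<noteq> 0}. of_nat (multi_binomial \<mu> (\<rho> - ?e)) * ?g \<rho> (?\<mu>' - \<rho>))"
  proof (rule sum.reindex_bij_witness[of _ "\<lambda>\<rho>. \<rho> - ?e" "\<lambda>\<rho>. \<rho> + ?e"])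
    fix \<rho> assume "\<rho> \<in> {\<rho>\<in>lower_midx ?\<mu>'. lookup \<rho> p \<noteq> 0}"
    then show "\<rho> - ?e + ?e = \<rho>" by (simp add: midx_minus_unit_add)
  qed (auto simp: lower_midx_def lookup_add lookup_minus lookup_unit le_diff_conv split: if_splits)
  also have "\<dots> = (\<Sum>\<rho>\<in>lower_midx ?\<mu>'. of_nat (if lookup \<rho> p = 0 then 0 else multi_binomial \<mu> (\<rho> - ?e)) * ?g \<rho> (?\<mu>' - \<rho>))"
    by (rule sum.mono_neutral_cong_left) (auto simp: finite_lower_midx)
  \<comment> \<open>When it falls on \<open>v\<close>, the range is merely enlarged, since the
    binomials vanish outside \<open>lower_midx \<mu>\<close>. Pascal's rule then joins the two
    sums.\<close>
  also have "(\<Sum>\<rho>\<in>lower_midx \<mu>. of_nat (multi_binomial \<mu> \<rho>) * ?g \<rho> (\<mu> - \<rho> + ?e)) =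
      (\<Sum>\<rho>\<in>lower_midx ?\<mu>'. of_nat (multi_binomial \<mu> \<rho>) * ?g \<rho> (?\<mu>' - \<rho>))"
  proof (rule sum.mono_neutral_cong_left)
    show "lower_midx \<mu> \<subseteq> lower_midx ?\<mu>'" by (rule lower_midx_superset)
    fix \<rho> assume "\<rho> \<in> lower_midx \<mu>"
    then have "\<mu> - \<rho> + ?e = ?\<mu>' - \<rho>"
      by (intro poly_mapping_eqI) (simp add: lower_midx_def lookup_add lookup_minus)
    then show "of_nat (multi_binomial \<mu> \<rho>) * ?g \<rho> (\<mu> - \<rho> + ?e) = of_nat (multi_binomial \<mu> \<rho>) * ?g \<rho> (?\<mu>' - \<rho>)"
      by simp
  qed (auto simp: finite_lower_midx multi_binomial_eq_0)
  finally show ?case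
    by (simp only: multi_binomial_Suc of_nat_add ring_distribs sum.distrib add.commute)
qed

lemma pm_scale_of_nat: "pm_scale (of_nat n) u = of_nat n * (u :: ('k::comm_monoid_add \<Rightarrow>\<^sub>0 'f::field))"
  by (simp add: pm_scale_def mult_map_scale_conv_mult)

text \<open>The differential operator on A that \<open>w\<close> represents. Identities between
  products in W can be checked on these operators.\<close>

definition wop :: "('f::field) weyl \<Rightarrow> 'f alg \<Rightarrow> 'f alg" where
  "wop w v = (\<Sum>\<mu>\<in>keys w. lookup w \<mu> * alg_deriv_pow \<mu> v)"

lemma wop_zero [simp]: "wop 0 v = 0"
  by (simp add: wop_def)

lemma wop_add_left: "wop (a + b) v = wop a v + wop b v"
  unfolding wop_def
  by (rule sum_keys_add[where f = "\<lambda>\<mu> c. c * alg_deriv_pow \<mu> v"]) (simp_all add: algebra_simps)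

lemma wop_add_right: "wop a (u + v) = wop a u + wop a v"
  by (simp add: wop_def alg_deriv_pow_add algebra_simps sum.distrib)

lemma wop_sum_left: "wop (sum f S) v = (\<Sum>s\<in>S. wop (f s) v)"
  by (induction S rule: infinite_finite_induct) (simp_all add: wop_add_left)

lemma wop_single [simp]: "wop (single \<mu> u) v = u * alg_deriv_pow \<mu> v"
  by (simp add: wop_def)

lemma wop_scale_left: "wop (weyl_scale c a) v = pm_scale c (wop a v)"
  by (rule additive_eqI[where f = "\<lambda>a. wop (weyl_scale c a) v" and g = "\<lambda>a. pm_scale c (wop a v)"])
    (simp_all add: wop_add_left weyl.scale_right_distrib pm.scale_right_distrib pm_scale_mult_left)

section \<open>The Weyl product\<close>

lemma weyl_mult_monom_zero [simp]:
  "weyl_mult_monom 0 \<mu> v \<nu> = 0" "weyl_mult_monom u \<mu> 0 \<nu> = 0"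
  by (simp_all add: weyl_mult_monom_def)

lemma weyl_mult_monom_add_left:
  "weyl_mult_monom (u + u') \<mu> v \<nu> = weyl_mult_monom u \<mu> v \<nu> + weyl_mult_monom u' \<mu> v \<nu>"
  by (simp add: weyl_mult_monom_def ring_distribs pm.scale_right_distrib single_add sum.distrib)

lemma weyl_mult_monom_add_right:
  "weyl_mult_monom u \<mu> (v + v') \<nu> = weyl_mult_monom u \<mu> v \<nu> + weyl_mult_monom u \<mu> v' \<nu>"
  by (simp add: weyl_mult_monom_def alg_deriv_pow_add ring_distribs pm.scale_right_distrib single_add sum.distrib)

lemma weyl_mult_add_left: "weyl_mult (a + a') b = weyl_mult a b + weyl_mult a' b"
  unfolding weyl_mult_def
  by (rule sum_keys_add[where f = "\<lambda>\<mu> u. \<Sum>\<nu>\<in>keys b. weyl_mult_monom u \<mu> (lookup b \<nu>) \<nu>"])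
    (simp_all add: weyl_mult_monom_add_left sum.distrib)

lemma weyl_mult_add_right: "weyl_mult a (b + b') = weyl_mult a b + weyl_mult a b'"
proof -
  have "(\<Sum>\<nu>\<in>keys (b + b'). weyl_mult_monom u \<mu> (lookup (b + b') \<nu>) \<nu>) =
    (\<Sum>\<nu>\<in>keys b. weyl_mult_monom u \<mu> (lookup b \<nu>) \<nu>) + (\<Sum>\<nu>\<in>keys b'. weyl_mult_monom u \<mu> (lookup b' \<nu>) \<nu>)"
    for u \<mu>
    by (rule sum_keys_add[where f = "\<lambda>\<nu> v. weyl_mult_monom u \<mu> v \<nu>"])
      (simp_all add: weyl_mult_monom_add_right)
  then show ?thesis by (simp add: weyl_mult_def sum.distrib)
qed

lemma weyl_mult_zero [simp]: "weyl_mult 0 b = 0" "weyl_mult a 0 = 0"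
  by (simp_all add: weyl_mult_def)

lemma weyl_mult_single: "weyl_mult (single \<mu> u) (single \<nu> v) = weyl_mult_monom u \<mu> v \<nu>"
  by (simp add: weyl_mult_def)

lemma weyl_mult_monom_scale_left:
  "weyl_mult_monom (pm_scale c u) \<mu> v \<nu> = weyl_scale c (weyl_mult_monom u \<mu> v \<nu>)"
  unfolding weyl_mult_monom_def weyl.scale_sum_right pm_scale_mult_left[symmetric]
  by (simp add: mult.commute)

lemma weyl_mult_monom_scale_right:
  "weyl_mult_monom u \<mu> (pm_scale c v) \<nu> = weyl_scale c (weyl_mult_monom u \<mu> v \<nu>)"
  unfolding weyl_mult_monom_def weyl.scale_sum_right alg_deriv_pow_scale
    pm_scale_mult_right[symmetric] by (simp add: mult.commute)

lemma biadditive_eqI: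
  fixes f g :: "('k \<Rightarrow>\<^sub>0 'b::comm_monoid_add) \<Rightarrow> ('l \<Rightarrow>\<^sub>0 'b) \<Rightarrow> 'c::ab_group_add"
  assumes "\<And>a a' b. f (a + a') b = f a b + f a' b" "\<And>a b b'. f a (b + b') = f a b + f a b'"
    and "\<And>a a' b. g (a + a') b = g a b + g a' b" "\<And>a b b'. g a (b + b') = g a b + g a b'"
    and "\<And>k l c d. k \<in> keys a \<Longrightarrow> l \<in> keys b \<Longrightarrow> f (single k c) (single l d) = g (single k c) (single l d)"
  shows "f a b = g a b"
proof (rule additive_eqI[where f = "\<lambda>a. f a b" and g = "\<lambda>a. g a b"])
  fix k c assume k: "k \<in> keys a"
  show "f (single k c) b = g (single k c) b"
    by (rule additive_eqI[where f = "f (single k c)" and g = "g (single k c)"]) (simp_all add: assms k)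
qed (simp_all add: assms)

lemma weyl_mult_scale_left: "weyl_mult (weyl_scale c a) b = weyl_scale c (weyl_mult a b)"
  by (rule biadditive_eqI[where f = "\<lambda>a b. weyl_mult (weyl_scale c a) b"
        and g = "\<lambda>a b. weyl_scale c (weyl_mult a b)"])
    (simp_all add: weyl_mult_add_left weyl_mult_add_right weyl.scale_right_distrib
      weyl_mult_single weyl_mult_monom_scale_left)

lemma weyl_mult_scale_right: "weyl_mult a (weyl_scale c b) = weyl_scale c (weyl_mult a b)"
  by (rule biadditive_eqI[where f = "\<lambda>a b. weyl_mult a (weyl_scale c b)"
        and g = "\<lambda>a b. weyl_scale c (weyl_mult a b)"])
    (simp_all add: weyl_mult_add_left weyl_mult_add_right weyl.scale_right_distrib
      weyl_mult_single weyl_mult_monom_scale_right)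

text \<open>On monomials, \<open>weyl_mult_monom\<close> is precisely the Leibniz expansion
  \<open>alg_deriv_pow_mult\<close> of one operator applied after the other; biadditivity does the
  rest.\<close>

lemma wop_mult: "wop (weyl_mult a b) f = wop a (wop b f)"
proof (rule biadditive_eqI[where f = "\<lambda>a b. wop (weyl_mult a b) f" and g = "\<lambda>a b. wop a (wop b f)"])
  fix \<mu> \<nu> and u v :: "'a alg"
  have "alg_deriv_pow (\<mu> + \<nu> - \<rho>) f = alg_deriv_pow (\<mu> - \<rho>) (alg_deriv_pow \<nu> f)"
    if "\<rho> \<in> lower_midx \<mu>" for \<rho>
  proof -
    have "\<mu> + \<nu> - \<rho> = \<mu> - \<rho> + \<nu>"
      using that by (intro poly_mapping_eqI) (simp add: lower_midx_def lookup_add lookup_minus)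
    then show ?thesis by (simp add: alg_deriv_pow_comp)
  qed
  then show "wop (weyl_mult (single \<mu> u) (single \<nu> v)) f = wop (single \<mu> u) (wop (single \<nu> v) f)"
    by (simp add: weyl_mult_single weyl_mult_monom_def wop_sum_left alg_deriv_pow_mult
        sum_distrib_left pm_scale_of_nat mult_ac)
qed (simp_all add: wop_add_left wop_add_right weyl_mult_add_left weyl_mult_add_right)

section \<open>Elementary rules for the bracket\<close>

lemma weyl_bracket_add_left: "weyl_bracket (a + a') b = weyl_bracket a b + weyl_bracket a' b"
  and weyl_bracket_add_right: "weyl_bracket a (b + b') = weyl_bracket a b + weyl_bracket a b'"
  by (simp_all add: weyl_bracket_def weyl_mult_add_left weyl_mult_add_right)

lemma weyl_bracket_zero [simp]: "weyl_bracket 0 b = 0" "weyl_bracket a 0 = 0"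
  by (simp_all add: weyl_bracket_def)

lemma weyl_bracket_scale_left: "weyl_bracket (weyl_scale c a) b = weyl_scale c (weyl_bracket a b)"
  and weyl_bracket_scale_right: "weyl_bracket a (weyl_scale c b) = weyl_scale c (weyl_bracket a b)"
  by (simp_all add: weyl_bracket_def weyl_mult_scale_left weyl_mult_scale_right weyl.scale_right_diff_distrib)

lemma weyl_bracket_minus_right: "weyl_bracket a (- b) = - weyl_bracket a b"
  using weyl_bracket_scale_right[of a "- 1" b] by simp

lemma weyl_bracket_diff_right: "weyl_bracket a (b - b') = weyl_bracket a b - weyl_bracket a b'"
  using weyl_bracket_add_right[of a b "- b'"] by (simp add: weyl_bracket_minus_right)

lemma weyl_bracket_sum_left: "weyl_bracket (sum f S) b = (\<Sum>s\<in>S. weyl_bracket (f s) b)"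
  by (induction S rule: infinite_finite_induct) (simp_all add: weyl_bracket_add_left)

abbreviation shifted_ad :: "'f::field weyl \<Rightarrow> 'f \<Rightarrow> 'f weyl \<Rightarrow> 'f weyl" where
  "shifted_ad w c v \<equiv> weyl_bracket w v - weyl_scale c v"

lemma lower_midx_unit: "lower_midx (unit_midx p) = {0, unit_midx p}"
proof (intro equalityI subsetI)
  fix \<rho> assume "\<rho> \<in> lower_midx (unit_midx p)"
  then have *: "lookup \<rho> q \<le> (if q = p then 1 else 0)" for q
    by (auto simp: lower_midx_def lookup_unit)
  show "\<rho> \<in> {0, unit_midx p}"
  proof (cases "lookup \<rho> p = 0")
    case True
    then have "lookup \<rho> q = 0" for q using *[of q] by (cases "q = p") auto
    then have "\<rho> = 0" by (intro poly_mapping_eqI) simp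
    then show ?thesis by simp
  next
    case False
    then have "lookup \<rho> q = lookup (unit_midx p) q" for q
      using *[of q] by (cases "q = p") (auto simp: lookup_unit)
    then have "\<rho> = unit_midx p" by (intro poly_mapping_eqI) simp
    then show ?thesis by simp
  qed
qed (auto simp: lower_midx_def)

lemma lower_midx_zero [simp]: "lower_midx 0 = {0}"
  by (auto simp: lower_midx_def intro: poly_mapping_eqI)

lemma zero_in_lower_midx [simp]: "0 \<in> lower_midx \<mu>"
  by (simp add: lower_midx_def)

lemma x_monom_zero: "x_monom 0 0 = 1"
  by (simp add: x_monom_def flip: single_one zero_prod_def)

text \<open>Derivatives of 1 vanish, so multiplying by \<open>partial_elem p\<close> on the right
  gives a single term; it cancels the higher of the two terms of the product on the left.\<close>

lemma weyl_bracket_partial: "weyl_bracket (partial_elem p) (single \<nu> v) = single \<nu> (alg_deriv p v)"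
proof -
  have "weyl_mult (single \<nu> v) (partial_elem p) =
      (\<Sum>\<rho>\<in>{0}. single (\<nu> + unit_midx p - \<rho>) (pm_scale (of_nat (multi_binomial \<nu> \<rho>)) (v * alg_deriv_pow \<rho> 1)))"
    unfolding partial_elem_def x_monom_zero weyl_mult_single weyl_mult_monom_def
    by (rule sum.mono_neutral_right) (auto simp: finite_lower_midx alg_deriv_pow_one)
  moreover have "weyl_mult (partial_elem p) (single \<nu> v) =
      single (unit_midx p + \<nu>) v + single \<nu> (alg_deriv p v)"
    by (simp add: partial_elem_def x_monom_zero weyl_mult_single weyl_mult_monom_def lower_midx_unit lookup_unit)
  ultimately show ?thesis
    by (simp add: weyl_bracket_def add.commute)
qed

lemma weyl_bracket_alg: "weyl_bracket (single 0 u) (single 0 v) = 0"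
  by (simp add: weyl_bracket_def weyl_mult_single weyl_mult_monom_def mult.commute)

lemma weyl_bracket_anticommute: "weyl_bracket a b = - weyl_bracket b a"
  by (simp add: weyl_bracket_def)

section \<open>Total orders on torsion-free abelian groups\<close>

text \<open>The n-fold sum in any abelian group, so that torsion-freeness can be stated for products
  of different groups.\<close>

definition nmult :: "nat \<Rightarrow> 'a::ab_group_add \<Rightarrow> 'a" where
  "nmult n x = ((+) x ^^ n) 0"

lemma nmult_0 [simp]: "nmult 0 x = 0"
  and nmult_Suc [simp]: "nmult (Suc n) x = x + nmult n x"
  by (simp_all add: nmult_def)

lemma nmult_add: "nmult (m + n) x = nmult m x + nmult n x"
  by (induction m) (simp_all add: add_ac)

lemma nmult_minus: "nmult n (- x) = - nmult n x"
  by (induction n) simp_all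

lemma nmult_zero_right [simp]: "nmult n 0 = 0"
  by (induction n) simp_all

lemma nmult_add_right: "nmult n (x + y) = nmult n x + nmult n y"
  by (induction n) (simp_all add: add_ac)

lemma nmult_commute: "nmult m (nmult n x) = nmult n (nmult m x)"
  by (induction m) (simp_all add: nmult_add_right)

lemma nmult_closed:
  assumes "\<And>x y. x \<in> P \<Longrightarrow> y \<in> P \<Longrightarrow> x + y \<in> P" "x \<in> P" "n > 0"
  shows "nmult n x \<in> P"
  using assms(3)
proof (induction n)
  case (Suc n)
  then show ?case using assms(1,2) by (cases n) auto
qed simp

text \<open>The positive elements of a translation-invariant total order, with x < y iff y - x lies
  in \<open>P\<close>. An element and its negative cannot both be positive, as their sum is
  0.\<close>

definition positive_cone :: "'a::ab_group_add set \<Rightarrow> bool" where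
  "positive_cone P \<longleftrightarrow> 0 \<notin> P \<and> (\<forall>x\<in>P. \<forall>y\<in>P. x + y \<in> P) \<and> (\<forall>x. x = 0 \<or> x \<in> P \<or> - x \<in> P)"

text \<open>A maximal subsemigroup avoiding 0 is total: if \<open>x\<close> cannot be adjoined, a negative multiple
  of \<open>x\<close> already belongs to it.\<close>

lemma positive_cone_extension:
  fixes P0 :: "'a::ab_group_add set"
  assumes torsion_free: "\<And>n x :: 'a. n > 0 \<Longrightarrow> nmult n x = 0 \<Longrightarrow> x = 0"
    and P0: "0 \<notin> P0" "\<And>x y. x \<in> P0 \<Longrightarrow> y \<in> P0 \<Longrightarrow> x + y \<in> P0"
  obtains P where "positive_cone P" "P0 \<subseteq> P"
proof -
  define \<A> where "\<A> = {P. P0 \<subseteq> P \<and> 0 \<notin> P \<and> (\<forall>x\<in>P. \<forall>y\<in>P. x + y \<in> P)}"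
  have "\<exists>M\<in>\<A>. \<forall>X\<in>\<A>. M \<subseteq> X \<longrightarrow> X = M"
  proof (rule subset_Zorn_nonempty)
    show "\<A> \<noteq> {}" using P0 by (auto simp: \<A>_def)
    fix \<C> assume C: "\<C> \<noteq> {}" "subset.chain \<A> \<C>"
    then have sub: "\<C> \<subseteq> \<A>" by (simp add: subset_chain_def)
    have "x + y \<in> \<Union>\<C>" if xy: "x \<in> \<Union>\<C>" "y \<in> \<Union>\<C>" for x y
    proof -
      obtain X Y where XY: "X \<in> \<C>" "x \<in> X" "Y \<in> \<C>" "y \<in> Y" using xy by blast
      then have "X \<subseteq> Y \<or> Y \<subseteq> X" using C(2) by (auto simp: subset_chain_def)
      then obtain Z where "Z \<in> \<C>" "x \<in> Z" "y \<in> Z" using XY by blast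
      moreover from this have "x + y \<in> Z" using sub by (auto simp: \<A>_def)
      ultimately show ?thesis by blast
    qed
    moreover have "0 \<notin> \<Union>\<C>" using sub by (auto simp: \<A>_def)
    moreover have "P0 \<subseteq> \<Union>\<C>" using sub C(1) unfolding \<A>_def by blast
    ultimately show "\<Union>\<C> \<in> \<A>" by (auto simp: \<A>_def)
  qed
  then obtain P where P: "P \<in> \<A>" and max: "\<And>X. X \<in> \<A> \<Longrightarrow> P \<subseteq> X \<Longrightarrow> X = P" by blast
  have PP: "P0 \<subseteq> P" "0 \<notin> P" "\<And>x y. x \<in> P \<Longrightarrow> y \<in> P \<Longrightarrow> x + y \<in> P"
    using P by (auto simp: \<A>_def)
  have neg: "\<exists>n>0. - nmult n x \<in> P" if x: "x \<noteq> 0" "x \<notin> P" for x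
  proof -
    \<comment> \<open>The subsemigroup generated by \<open>P\<close> and \<open>x\<close>;
      \<open>insert 0 P\<close> admits the pure multiples of \<open>x\<close>.\<close>
    define X where "X = P \<union> {nmult n x + p | n p. n > 0 \<and> p \<in> insert 0 P}"
    have "x = nmult 1 x + 0" by simp
    then have "x \<in> X" unfolding X_def by blast
    then have "X \<noteq> P" using x by blast
    moreover have "P \<subseteq> X" by (auto simp: X_def)
    moreover have "a + b \<in> X" if "a \<in> X" "b \<in> X" for a b
    proof -
      have mixed: "u + v \<in> X" if "u \<in> P" "v = nmult n x + p" "n > 0" "p \<in> insert 0 P" for u v n p
      proof -
        have "u + v = nmult n x + (u + p)" using that by (simp add: add_ac)
        moreover have "u + p \<in> P" using that PP(3) by auto
        ultimately show ?thesis using that(3) unfolding X_def by blast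
      qed
      consider "a \<in> P" "b \<in> P" | "a \<in> P" "b \<notin> P" | "a \<notin> P" "b \<in> P"
        | n p m q where "a = nmult n x + p" "n > 0" "p \<in> insert 0 P" "b = nmult m x + q" "m > 0" "q \<in> insert 0 P"
        using \<open>a \<in> X\<close> \<open>b \<in> X\<close> unfolding X_def by blast
      then show ?thesis
      proof cases
        case 1
        then show ?thesis using PP(3) by (simp add: X_def)
      next
        case 2
        then show ?thesis using mixed \<open>b \<in> X\<close> unfolding X_def by blast
      next
        case 3
        then have "b + a \<in> X" using mixed \<open>a \<in> X\<close> unfolding X_def by blast
        then show ?thesis by (simp only: add.commute)
      next
        case 4
        have "a + b = nmult (n + m) x + (p + q)" using 4 by (simp add: nmult_add add_ac)
        moreover have "p + q \<in> insert 0 P" using 4 PP(3) by auto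
        moreover have "n + m > 0" using 4 by simp
        ultimately show ?thesis unfolding X_def by blast
      qed
    qed
    ultimately have "0 \<in> X" using max[of X] PP(1) by (auto simp: \<A>_def)
    then obtain n p where np: "n > 0" "p \<in> insert 0 P" "0 = nmult n x + p"
      using PP(2) unfolding X_def by blast
    have "p \<noteq> 0" using np torsion_free[of n x] x by auto
    moreover have "p = - nmult n x" using np(3) by (metis add_eq_0_iff)
    ultimately show ?thesis using np by blast
  qed
  have "x \<in> P \<or> - x \<in> P" if "x \<noteq> 0" for x
  proof (rule ccontr)
    assume "\<not> ?thesis"
    then obtain n m where nm: "n > 0" "- nmult n x \<in> P" "m > 0" "- nmult m (- x) \<in> P"
      using neg[of x] neg[of "- x"] \<open>x \<noteq> 0\<close> by auto
    \<comment> \<open>m copies of -(n x) and n copies of m x are both in \<open>P\<close>, and they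
      cancel.\<close>
    then have "nmult m (- nmult n x) + nmult n (- nmult m (- x)) \<in> P"
      using PP(3) nmult_closed[of P] by blast
    moreover have "nmult m (- nmult n x) + nmult n (- nmult m (- x)) = 0"
      by (simp add: nmult_minus nmult_commute[of m n])
    ultimately show False using PP(2) by simp
  qed
  then have "positive_cone P" using PP unfolding positive_cone_def by blast
  then show ?thesis using that PP(1) by blast
qed

text \<open>In terms of the cone, \<open>m - x \<in> insert 0 P\<close> says x <= m. By totality, a
  new element not below the old maximum exceeds it and hence all earlier elements.\<close>

lemma finite_cone_maximal:
  assumes P: "positive_cone P" and "finite S" "S \<noteq> {}"
  obtains m where "m \<in> S" "\<And>x. x \<in> S \<Longrightarrow> m - x \<in> insert 0 P"
proof -
  have "\<exists>m\<in>S. \<forall>x\<in>S. m - x \<in> insert 0 P"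
    using assms(2,3)
  proof (induction S rule: finite_ne_induct)
    case (insert a S)
    then obtain m where m: "m \<in> S" "\<forall>x\<in>S. m - x \<in> insert 0 P" by blast
    show ?case
    proof (cases "m - a \<in> insert 0 P")
      case False
      then have a: "a - m \<in> P" using P unfolding positive_cone_def
        by (metis insertCI minus_diff_eq)
      have "a - x \<in> insert 0 P" if "x \<in> S" for x
      proof -
        have "a - x = (a - m) + (m - x)" by simp
        moreover have "m - x \<in> insert 0 P" using m that by blast
        ultimately show ?thesis using a P unfolding positive_cone_def
          by (metis add.right_neutral insertCI insertE)
      qed
      then show ?thesis by auto
    qed (use m in auto)
  qed simp
  then show ?thesis using that by blast
qed

section \<open>Polynomial functions on a nondegenerate subgroup\<close>

text \<open>Values lie in an arbitrary commutative ring because three are used: scalars, univariate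
  polynomials along a line, and A itself when elements are substituted for variables.\<close>

definition monom_eval :: "(nat \<Rightarrow> 'r::comm_ring_1) \<Rightarrow> midx \<Rightarrow> 'r" where
  "monom_eval g \<mu> = (\<Prod>p\<in>keys \<mu>. g p ^ lookup \<mu> p)"

lemma monom_eval_superset:
  assumes "finite K" "keys \<mu> \<subseteq> K"
  shows "monom_eval g \<mu> = (\<Prod>p\<in>K. g p ^ lookup \<mu> p)"
  unfolding monom_eval_def using assms by (intro prod.mono_neutral_left) (auto simp: in_keys_iff)

lemma monom_eval_zero [simp]: "monom_eval g 0 = 1"
  by (simp add: monom_eval_def)

lemma monom_eval_unit [simp]: "monom_eval g (unit_midx p) = g p"
  by (simp add: monom_eval_def lookup_unit)

lemma monom_eval_add: "monom_eval g (\<mu> + \<nu>) = monom_eval g \<mu> * monom_eval g \<nu>"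
proof -
  have K: "finite (keys \<mu> \<union> keys \<nu>)" "keys (\<mu> + \<nu>) \<subseteq> keys \<mu> \<union> keys \<nu>"
    by (simp_all add: keys_add_midx)
  show ?thesis
    unfolding monom_eval_superset[OF K] monom_eval_superset[OF K(1) Un_upper1]
      monom_eval_superset[OF K(1) Un_upper2]
    by (simp add: lookup_add power_add prod.distrib)
qed

section \<open>Polynomials in several variables and their restrictions to lines xi + y alpha\<close>

definition line_monom :: "'f::field vec \<Rightarrow> 'f vec \<Rightarrow> midx \<Rightarrow> 'f poly" where
  "line_monom \<xi> \<alpha> = monom_eval (\<lambda>p. [:lookup \<xi> p, lookup \<alpha> p:])"

lemma poly_line_monom:
  "poly (line_monom \<xi> \<alpha> \<mu>) y = monom_eval (lookup (\<xi> + pm_scale y \<alpha>)) \<mu>"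
  by (simp add: line_monom_def monom_eval_def poly_prod lookup_add mult.commute)

lemma pderiv_line_monom:
  "pderiv (line_monom \<xi> \<alpha> \<mu>) =
    (\<Sum>p\<in>keys \<mu>. smult (of_nat (lookup \<mu> p) * lookup \<alpha> p) (line_monom \<xi> \<alpha> (\<mu> - unit_midx p)))"
  (is "_ = ?rhs")
proof -
  let ?g = "\<lambda>p. [:lookup \<xi> p, lookup \<alpha> p:]"
  have "(\<Prod>q\<in>keys \<mu> - {p}. ?g q ^ lookup \<mu> q) * pderiv (?g p ^ lookup \<mu> p) =
      smult (of_nat (lookup \<mu> p) * lookup \<alpha> p) (line_monom \<xi> \<alpha> (\<mu> - unit_midx p))"
    if "p \<in> keys \<mu>" for p
  proof -
    have "line_monom \<xi> \<alpha> (\<mu> - unit_midx p) = (\<Prod>q\<in>keys \<mu>. ?g q ^ lookup (\<mu> - unit_midx p) q)"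
      unfolding line_monom_def by (rule monom_eval_superset) (simp_all add: keys_minus_midx)
    also have "\<dots> = ?g p ^ (lookup \<mu> p - 1) * (\<Prod>q\<in>keys \<mu> - {p}. ?g q ^ lookup \<mu> q)"
      using that by (simp add: prod.remove lookup_minus lookup_unit)
    finally show ?thesis
      by (simp add: pderiv_power pderiv_pCons mult_ac)
  qed
  then show ?thesis
    by (simp add: line_monom_def monom_eval_def pderiv_prod)
qed

definition mpoly_eval :: "(midx \<Rightarrow>\<^sub>0 'f::field) \<Rightarrow> 'f vec \<Rightarrow> 'f" where
  "mpoly_eval c \<xi> = (\<Sum>\<mu>\<in>keys c. lookup c \<mu> * monom_eval (lookup \<xi>) \<mu>)"

definition mpoly_line :: "(midx \<Rightarrow>\<^sub>0 'f::field) \<Rightarrow> 'f vec \<Rightarrow> 'f vec \<Rightarrow> 'f poly" where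
  "mpoly_line c \<xi> \<alpha> = (\<Sum>\<mu>\<in>keys c. smult (lookup c \<mu>) (line_monom \<xi> \<alpha> \<mu>))"

definition mpoly_pderiv :: "nat \<Rightarrow> (midx \<Rightarrow>\<^sub>0 'f::field) \<Rightarrow> (midx \<Rightarrow>\<^sub>0 'f)" where
  "mpoly_pderiv p c = (\<Sum>\<mu>\<in>keys c. single (\<mu> - unit_midx p) (of_nat (lookup \<mu> p) * lookup c \<mu>))"

lemma poly_mpoly_line: "poly (mpoly_line c \<xi> \<alpha>) y = mpoly_eval c (\<xi> + pm_scale y \<alpha>)"
  by (simp add: mpoly_line_def mpoly_eval_def poly_sum poly_line_monom)

lemma mpoly_eval_add: "mpoly_eval (c + d) \<xi> = mpoly_eval c \<xi> + mpoly_eval d \<xi>"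
  unfolding mpoly_eval_def
  by (rule sum_keys_add[where f = "\<lambda>\<mu> a. a * monom_eval (lookup \<xi>) \<mu>"]) (simp_all add: algebra_simps)

lemma mpoly_line_add: "mpoly_line (c + d) \<xi> \<alpha> = mpoly_line c \<xi> \<alpha> + mpoly_line d \<xi> \<alpha>"
  unfolding mpoly_line_def
  by (rule sum_keys_add[where f = "\<lambda>\<mu> a. smult a (line_monom \<xi> \<alpha> \<mu>)"]) (simp_all add: smult_add_left)

lemma mpoly_pderiv_add: "mpoly_pderiv p (c + d) = mpoly_pderiv p c + mpoly_pderiv p d"
  unfolding mpoly_pderiv_def
  by (rule sum_keys_add[where f = "\<lambda>\<mu> a. single (\<mu> - unit_midx p) (of_nat (lookup \<mu> p) * a)"])
    (simp_all add: algebra_simps single_add)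

lemma mpoly_eval_single [simp]: "mpoly_eval (single \<mu> a) \<xi> = a * monom_eval (lookup \<xi>) \<mu>"
  by (simp add: mpoly_eval_def)

lemma mpoly_line_single [simp]: "mpoly_line (single \<mu> a) \<xi> \<alpha> = smult a (line_monom \<xi> \<alpha> \<mu>)"
  by (simp add: mpoly_line_def)

lemma mpoly_line_zero [simp]: "mpoly_line 0 \<xi> \<alpha> = 0"
  by (simp add: mpoly_line_def)

lemma mpoly_pderiv_single [simp]:
  "mpoly_pderiv p (single \<mu> a) = single (\<mu> - unit_midx p) (of_nat (lookup \<mu> p) * a)"
  by (simp add: mpoly_pderiv_def)

lemma lookup_mpoly_pderiv:
  "lookup (mpoly_pderiv p c) \<nu> = of_nat (Suc (lookup \<nu> p)) * lookup c (\<nu> + unit_midx p)"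
proof (rule additive_eqI[where f = "\<lambda>c. lookup (mpoly_pderiv p c) \<nu>"
      and g = "\<lambda>c. of_nat (Suc (lookup \<nu> p)) * lookup c (\<nu> + unit_midx p)"])
  fix \<mu> :: midx and a :: 'a
  show "lookup (mpoly_pderiv p (single \<mu> a)) \<nu> =
    of_nat (Suc (lookup \<nu> p)) * lookup (single \<mu> a) (\<nu> + unit_midx p)"
  proof (cases "lookup \<mu> p = 0")
    case True
    then have "\<mu> \<noteq> \<nu> + unit_midx p" by (auto simp: lookup_add lookup_unit)
    then show ?thesis using True by (simp add: lookup_single)
  next
    case False
    then have "\<mu> - unit_midx p = \<nu> \<longleftrightarrow> \<mu> = \<nu> + unit_midx p"
      using midx_minus_unit_add[of \<mu> p] by auto
    then show ?thesis by (auto simp: lookup_single when_def lookup_add lookup_unit)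
  qed
qed (simp_all add: mpoly_pderiv_add lookup_add algebra_simps)

lemma smult_sum_right: "smult a (sum f S) = (\<Sum>s\<in>S. smult a (f s))"
  by (induction S rule: infinite_finite_induct) (simp_all add: smult_add_right)

lemma pderiv_mpoly_line:
  assumes "keys c \<subseteq> multi_indices l"
  shows "pderiv (mpoly_line c \<xi> \<alpha>) = (\<Sum>p=1..l. smult (lookup \<alpha> p) (mpoly_line (mpoly_pderiv p c) \<xi> \<alpha>))"
proof (rule additive_eqI[where f = "\<lambda>c. pderiv (mpoly_line c \<xi> \<alpha>)"
      and g = "\<lambda>c. \<Sum>p=1..l. smult (lookup \<alpha> p) (mpoly_line (mpoly_pderiv p c) \<xi> \<alpha>)"])
  fix \<mu> a assume "\<mu> \<in> keys c"
  then have \<mu>: "keys \<mu> \<subseteq> {1..l}" using assms by (auto simp: multi_indices_def)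
  have "(\<Sum>p=1..l. smult (lookup \<alpha> p) (mpoly_line (mpoly_pderiv p (single \<mu> a)) \<xi> \<alpha>)) =
    (\<Sum>p\<in>keys \<mu>. smult (lookup \<alpha> p) (mpoly_line (mpoly_pderiv p (single \<mu> a)) \<xi> \<alpha>))"
    using \<mu> by (intro sum.mono_neutral_right) (auto simp: in_keys_iff)
  then show "pderiv (mpoly_line (single \<mu> a) \<xi> \<alpha>) =
    (\<Sum>p=1..l. smult (lookup \<alpha> p) (mpoly_line (mpoly_pderiv p (single \<mu> a)) \<xi> \<alpha>))"
    by (simp add: pderiv_smult pderiv_line_monom smult_sum_right mult_ac)
qed (simp_all add: mpoly_line_add mpoly_pderiv_add pderiv_add smult_add_right sum.distrib)

text \<open>\<open>\<Gamma>\<close> is closed under integer multiples only, so vanishing on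
  \<open>\<Gamma>\<close> gives vanishing at natural parameters of a line; in characteristic 0 these
  are infinitely many roots.\<close>

lemma poly_eq_0_of_nat_roots:
  assumes "\<And>n::nat. poly (q :: 'f::field_char_0 poly) (of_nat n) = 0"
  shows "q = 0"
proof (rule ccontr)
  assume "q \<noteq> 0"
  then have "finite {x. poly q x = 0}" by (rule poly_roots_finite)
  then have "finite (range (of_nat :: nat \<Rightarrow> 'f))" by (rule finite_subset[rotated]) (use assms in auto)
  then show False by (simp add: finite_image_iff inj_of_nat)
qed

text \<open>The vectors on which the linear form with coefficients \<open>a\<close> vanishes form a
  subspace containing a basis, hence all unit vectors.\<close>

lemma nondegenerate_separates:
  assumes \<Gamma>: "nondegenerate_subgroup l (\<Gamma> :: 'f::field vec set)"
    and "\<And>\<beta>. \<beta> \<in> \<Gamma> \<Longrightarrow> (\<Sum>p=1..l. lookup \<beta> p * a p) = 0" "p \<in> {1..l}"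
  shows "a p = 0"
proof -
  let ?N = "{v. (\<Sum>p=1..l. lookup v p * a p) = 0}"
  obtain B where B: "B \<subseteq> \<Gamma>" "pm.span B = coord_space l"
    using \<Gamma> by (auto simp: nondegenerate_subgroup_def)
  have "pm.subspace ?N"
    by (rule pm.subspaceI) (simp_all add: lookup_add algebra_simps sum.distrib flip: sum_distrib_left)
  moreover have "B \<subseteq> ?N" using B assms(2) by auto
  ultimately have "coord_space l \<subseteq> ?N" using pm.span_minimal[of B ?N] B(2) by simp
  moreover have "single p 1 \<in> coord_space l" using assms(3) by (simp add: coord_space_def)
  ultimately have "(\<Sum>q=1..l. lookup (single p 1) q * a q) = 0" by blast
  moreover have "(\<Sum>q=1..l. lookup (single p 1) q * a q) = (\<Sum>q=1..l. if q = p then a q else 0)"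
    by (rule sum.cong) (auto simp: lookup_single when_def)
  ultimately show ?thesis using assms(3) by simp
qed

lemma keys_mpoly_pderiv:
  assumes "keys c \<subseteq> multi_indices l"
  shows "keys (mpoly_pderiv p c) \<subseteq> multi_indices l"
proof
  fix \<nu> assume "\<nu> \<in> keys (mpoly_pderiv p c)"
  then have "\<nu> + unit_midx p \<in> keys c" by (auto simp: in_keys_iff lookup_mpoly_pderiv)
  then have "\<nu> + unit_midx p \<in> multi_indices l" using assms by blast
  then show "\<nu> \<in> multi_indices l" by (simp add: multi_indices_def keys_add_midx)
qed

lemma mpoly_pderiv_zero_imp_const:
  fixes c :: "midx \<Rightarrow>\<^sub>0 'f::field_char_0"
  assumes "keys c \<subseteq> multi_indices l" "\<And>p. p \<in> {1..l} \<Longrightarrow> mpoly_pderiv p c = 0"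
  shows "keys c \<subseteq> {0}"
proof
  fix \<mu> assume \<mu>: "\<mu> \<in> keys c"
  show "\<mu> \<in> {0}"
  proof (rule ccontr)
    assume "\<mu> \<notin> {0}"
    then obtain p where p: "lookup \<mu> p \<noteq> 0" by (metis singletonI poly_mapping_eqI lookup_zero)
    then have "p \<in> keys \<mu>" by (simp add: in_keys_iff)
    then have "p \<in> {1..l}" using \<mu> assms(1) unfolding multi_indices_def by blast
    then have "lookup (mpoly_pderiv p c) (\<mu> - unit_midx p) = 0" using assms(2) by simp
    then show False using \<mu> p
      by (simp add: lookup_mpoly_pderiv midx_minus_unit_add in_keys_iff del: of_nat_Suc)
  qed
qed

text \<open>Zariski density of \<open>\<Gamma>\<close>, by induction on the degree. Along a line
  through gamma in a direction beta of \<open>\<Gamma>\<close> the polynomial vanishes at all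
  natural parameters, so its directional derivative at gamma is 0. As such beta separate
  coordinates, all partial derivatives vanish on \<open>\<Gamma>\<close>, and the polynomial is
  constant.\<close>

lemma mpoly_eval_zero_imp_zero:
  fixes c :: "midx \<Rightarrow>\<^sub>0 'f::field_char_0"
  assumes \<Gamma>: "nondegenerate_subgroup l \<Gamma>" and "keys c \<subseteq> multi_indices l"
    and "\<And>\<gamma>. \<gamma> \<in> \<Gamma> \<Longrightarrow> mpoly_eval c \<gamma> = 0"
  shows "c = 0"
proof -
  have "\<forall>c. keys c \<subseteq> multi_indices l \<longrightarrow> (\<forall>\<mu>\<in>keys c. mdeg \<mu> < n) \<longrightarrow> (\<forall>\<gamma>\<in>\<Gamma>. mpoly_eval c \<gamma> = 0) \<longrightarrow> c = (0 :: midx \<Rightarrow>\<^sub>0 'f)" for n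
  proof (induction n)
    case 0
    show ?case
    proof (intro allI impI)
      fix c :: "midx \<Rightarrow>\<^sub>0 'f" assume "\<forall>\<mu>\<in>keys c. mdeg \<mu> < 0"
      then show "c = 0" by (intro poly_mapping_eqI) (auto simp: in_keys_iff)
    qed
  next
    case (Suc n)
    show ?case
    proof (intro allI impI)
      fix c :: "midx \<Rightarrow>\<^sub>0 'f"
      assume c: "keys c \<subseteq> multi_indices l" "\<forall>\<mu>\<in>keys c. mdeg \<mu> < Suc n" "\<forall>\<gamma>\<in>\<Gamma>. mpoly_eval c \<gamma> = 0"
      have "mpoly_eval (mpoly_pderiv p c) \<gamma> = 0" if p: "p \<in> {1..l}" and \<gamma>: "\<gamma> \<in> \<Gamma>" for p \<gamma>
      proof (rule nondegenerate_separates[OF \<Gamma> _ p])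
        fix \<beta> assume \<beta>: "\<beta> \<in> \<Gamma>"
        have "\<gamma> + pm_scale (of_nat k) \<beta> \<in> \<Gamma>" for k
          by (induction k) (use \<Gamma> \<gamma> \<beta> in \<open>auto simp: nondegenerate_subgroup_def pm.scale_left_distrib add_ac\<close>)
        then have "mpoly_line c \<gamma> \<beta> = 0"
          using c(3) by (intro poly_eq_0_of_nat_roots) (simp add: poly_mpoly_line)
        then have "poly (pderiv (mpoly_line c \<gamma> \<beta>)) 0 = 0" by simp
        then show "(\<Sum>p=1..l. lookup \<beta> p * mpoly_eval (mpoly_pderiv p c) \<gamma>) = 0"
          by (simp add: pderiv_mpoly_line[OF c(1)] poly_sum poly_mpoly_line)
      qed
      moreover have "mdeg \<nu> < n" if "\<nu> \<in> keys (mpoly_pderiv p c)" for p \<nu>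
      proof -
        have "\<nu> + unit_midx p \<in> keys c" using that by (auto simp: in_keys_iff lookup_mpoly_pderiv)
        then show ?thesis using c(2) by fastforce
      qed
      ultimately have "mpoly_pderiv p c = 0" if "p \<in> {1..l}" for p
        using Suc.IH keys_mpoly_pderiv[OF c(1)] that by blast
      then have "keys c \<subseteq> {0}" by (rule mpoly_pderiv_zero_imp_const[OF c(1)])
      then have c0: "c = single 0 (lookup c 0)"
        by (intro poly_mapping_eqI) (auto simp: lookup_single when_def in_keys_iff)
      moreover have "mpoly_eval c 0 = 0" using c(3) \<Gamma> by (auto simp: nondegenerate_subgroup_def)
      ultimately have "lookup c 0 = 0" by (metis mpoly_eval_single monom_eval_zero mult.right_neutral)
      then show "c = 0" using c0 by simp
    qed
  qed
  moreover have "\<forall>\<mu>\<in>keys c. mdeg \<mu> < Suc (Max (mdeg ` keys c))" by (simp add: le_imp_less_Suc)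
  ultimately show ?thesis using assms by blast
qed

text \<open>The factor D_beta h of the Poisson recursion, restricted to the line through
  \<open>\<xi>\<close> in direction \<open>\<alpha>\<close>.\<close>

definition mpoly_line_dir :: "nat \<Rightarrow> (midx \<Rightarrow>\<^sub>0 'f::field) \<Rightarrow> 'f vec \<Rightarrow> 'f vec \<Rightarrow> 'f vec \<Rightarrow> 'f poly" where
  "mpoly_line_dir l c \<beta> \<xi> \<alpha> = (\<Sum>p=1..l. smult (lookup \<beta> p) (mpoly_line (mpoly_pderiv p c) \<xi> \<alpha>))"

lemma poly_mpoly_line_dir:
  assumes "keys c \<subseteq> multi_indices l"
  shows "poly (mpoly_line_dir l c \<beta> \<xi> \<alpha>) y = poly (pderiv (mpoly_line c (\<xi> + pm_scale y \<alpha>) \<beta>)) 0"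
  by (simp add: mpoly_line_dir_def pderiv_mpoly_line[OF assms] poly_sum poly_mpoly_line)

text \<open>Either h varies along some line in direction alpha, and beta = alpha serves; or h is
  invariant under translation by multiples of alpha, and beta is any direction in
  \<open>\<Gamma>\<close> in which h has a nonzero derivative at some point. In the second case
  D_beta h is a nonzero constant along the line. Each alternative has its own nonvanishing argument
  for \<open>bracket_seq\<close>.\<close>

lemma mpoly_line_dir_exists:
  fixes c :: "midx \<Rightarrow>\<^sub>0 'f::field_char_0"
  assumes \<Gamma>: "nondegenerate_subgroup l \<Gamma>" and c: "keys c \<subseteq> multi_indices l" and nc: "\<not> keys c \<subseteq> {0}"
    and \<alpha>: "\<alpha> \<in> \<Gamma>"
  obtains \<beta> \<xi> where "\<beta> \<in> \<Gamma>" "\<beta> = \<alpha>" "pderiv (mpoly_line c \<xi> \<alpha>) \<noteq> 0"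
      "mpoly_line_dir l c \<beta> \<xi> \<alpha> = pderiv (mpoly_line c \<xi> \<alpha>)"
  | \<beta> \<xi> where "\<beta> \<in> \<Gamma>" "pderiv (mpoly_line c \<xi> \<alpha>) = 0" "mpoly_line_dir l c \<beta> \<xi> \<alpha> \<noteq> 0"
      "pderiv (mpoly_line_dir l c \<beta> \<xi> \<alpha>) = 0"
proof (cases "\<exists>\<xi>. pderiv (mpoly_line c \<xi> \<alpha>) \<noteq> 0")
  case True
  then show ?thesis using that(1)[of \<alpha>] \<alpha> by (auto simp: mpoly_line_dir_def pderiv_mpoly_line[OF c])
next
  case False
  have const: "mpoly_eval c (\<xi> + pm_scale y \<alpha>) = mpoly_eval c \<xi>" for \<xi> y
  proof -
    from False have "degree (mpoly_line c \<xi> \<alpha>) = 0" by (simp add: pderiv_eq_0_iff)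
    then obtain a where "mpoly_line c \<xi> \<alpha> = [:a:]" using degree_eq_zeroE by blast
    then have "poly (mpoly_line c \<xi> \<alpha>) y = poly (mpoly_line c \<xi> \<alpha>) 0" by simp
    then show ?thesis by (simp add: poly_mpoly_line)
  qed
  obtain p where p: "p \<in> {1..l}" "mpoly_pderiv p c \<noteq> 0"
    using mpoly_pderiv_zero_imp_const[OF c] nc by blast
  obtain \<xi> where \<xi>: "mpoly_eval (mpoly_pderiv p c) \<xi> \<noteq> 0"
    using mpoly_eval_zero_imp_zero[OF \<Gamma> keys_mpoly_pderiv[OF c]] p(2) by blast
  obtain \<beta> where \<beta>: "\<beta> \<in> \<Gamma>" "(\<Sum>p=1..l. lookup \<beta> p * mpoly_eval (mpoly_pderiv p c) \<xi>) \<noteq> 0"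
    using nondegenerate_separates[OF \<Gamma> _ p(1), of "\<lambda>p. mpoly_eval (mpoly_pderiv p c) \<xi>"] \<xi> by blast
  then have "poly (mpoly_line_dir l c \<beta> \<xi> \<alpha>) 0 \<noteq> 0"
    by (simp add: mpoly_line_dir_def poly_sum poly_mpoly_line)
  then have "mpoly_line_dir l c \<beta> \<xi> \<alpha> \<noteq> 0" by auto
  moreover have "mpoly_line_dir l c \<beta> \<xi> \<alpha> = [:poly (mpoly_line_dir l c \<beta> \<xi> \<alpha>) 0:]"
  proof -
    \<comment> \<open>Invariance under translation by multiples of alpha makes the restrictions of
      \<open>c\<close> to parallel lines in direction beta coincide, so their derivatives at 0 do
      too.\<close>
    have "poly (mpoly_line_dir l c \<beta> \<xi> \<alpha>) y = poly (mpoly_line_dir l c \<beta> \<xi> \<alpha>) 0" for y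
    proof -
      have "poly (mpoly_line c (\<xi> + pm_scale y \<alpha>) \<beta>) s = poly (mpoly_line c (\<xi> + pm_scale 0 \<alpha>) \<beta>) s" for s
        using const[of "\<xi> + pm_scale s \<beta>" y] by (simp add: poly_mpoly_line add_ac)
      then have "mpoly_line c (\<xi> + pm_scale y \<alpha>) \<beta> - mpoly_line c (\<xi> + pm_scale 0 \<alpha>) \<beta> = 0"
        by (intro poly_eq_0_of_nat_roots) simp
      then show ?thesis by (simp add: poly_mpoly_line_dir[OF c])
    qed
    then have "mpoly_line_dir l c \<beta> \<xi> \<alpha> - [:poly (mpoly_line_dir l c \<beta> \<xi> \<alpha>) 0:] = 0"
      by (intro poly_eq_0_of_nat_roots) simp
    then show ?thesis by simp
  qed
  then have "pderiv (mpoly_line_dir l c \<beta> \<xi> \<alpha>) = 0" by (metis pderiv_singleton)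
  ultimately show ?thesis using that(2) \<beta>(1) False by blast
qed

section \<open>The Poisson recursion along a line\<close>

lemma line_monom_add: "line_monom \<xi> \<alpha> (\<mu> + \<nu>) = line_monom \<xi> \<alpha> \<mu> * line_monom \<xi> \<alpha> \<nu>"
  by (simp add: line_monom_def monom_eval_add)

lemma mpoly_line_dir_single:
  assumes "keys \<mu> \<subseteq> {1..l}"
  shows "mpoly_line_dir l (single \<mu> c) \<beta> \<xi> \<alpha> =
    (\<Sum>p\<in>keys \<mu>. smult (c * (of_nat (lookup \<mu> p) * lookup \<beta> p)) (line_monom \<xi> \<alpha> (\<mu> - unit_midx p)))"
proof -
  have "mpoly_line_dir l (single \<mu> c) \<beta> \<xi> \<alpha> =
    (\<Sum>p\<in>keys \<mu>. smult (lookup \<beta> p) (mpoly_line (mpoly_pderiv p (single \<mu> c)) \<xi> \<alpha>))"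
    unfolding mpoly_line_dir_def using assms by (intro sum.mono_neutral_right) (auto simp: in_keys_iff)
  then show ?thesis by (simp add: mult_ac)
qed

lemma mpoly_line_sum: "mpoly_line (sum f S) \<xi> \<alpha> = (\<Sum>s\<in>S. mpoly_line (f s) \<xi> \<alpha>)"
  by (induction S rule: infinite_finite_induct) (simp_all add: mpoly_line_add)

lemma mpoly_line_diff: "mpoly_line (c - d) \<xi> \<alpha> = mpoly_line c \<xi> \<alpha> - mpoly_line d \<xi> \<alpha>"
  using mpoly_line_add[of "c - d" d \<xi> \<alpha>] by simp

lemma mpoly_line_one [simp]: "mpoly_line 1 \<xi> \<alpha> = 1"
  using mpoly_line_single[of 0 1 \<xi> \<alpha>] by (simp add: line_monom_def)

lemma mpoly_line_dir_add: "mpoly_line_dir l (c + d) \<beta> \<xi> \<alpha> = mpoly_line_dir l c \<beta> \<xi> \<alpha> + mpoly_line_dir l d \<beta> \<xi> \<alpha>"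
  by (simp add: mpoly_line_dir_def mpoly_pderiv_add mpoly_line_add smult_add_right sum.distrib)

lemma mpoly_line_dir_zero [simp]: "mpoly_line_dir l 0 \<beta> \<xi> \<alpha> = 0"
  by (simp add: mpoly_line_dir_def mpoly_pderiv_def)

text \<open>After n brackets with an element of leading weight alpha, the weight beta has become
  beta + n alpha; along a line in direction alpha each additional alpha contributes one h'.\<close>

lemma mpoly_line_dir_nmult:
  assumes "keys c \<subseteq> multi_indices l"
  shows "mpoly_line_dir l c (\<beta> + nmult n \<alpha>) \<xi> \<alpha> =
    mpoly_line_dir l c \<beta> \<xi> \<alpha> + of_nat n * pderiv (mpoly_line c \<xi> \<alpha>)"
proof (induction n)
  case (Suc n)
  have "mpoly_line_dir l c (\<beta> + nmult (Suc n) \<alpha>) \<xi> \<alpha> =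
    mpoly_line_dir l c (\<beta> + nmult n \<alpha>) \<xi> \<alpha> + pderiv (mpoly_line c \<xi> \<alpha>)"
    by (simp add: pderiv_mpoly_line[OF assms] mpoly_line_dir_def lookup_add smult_add_left sum.distrib)
  then show ?case by (simp add: Suc algebra_simps)
qed simp

text \<open>The leading parts of iterated brackets on a line: \<open>k\<close> stands for D_beta h,
  \<open>k + of_nat n * pderiv h\<close> is the derivative of h in direction beta + n alpha, and
  \<open>pderiv\<close> is D_alpha.\<close>

primrec bracket_seq :: "'f::field poly \<Rightarrow> 'f poly \<Rightarrow> nat \<Rightarrow> 'f poly" where
  "bracket_seq k h 0 = 1"
| "bracket_seq k h (Suc n) = (k + of_nat n * pderiv h) * bracket_seq k h n - h * pderiv (bracket_seq k h n)"

text \<open>With h' = 0 and k constant, every derivative term drops out and the sequence is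
  k^n.\<close>

lemma bracket_seq_nonzero_const:
  assumes "pderiv h = 0" "k \<noteq> 0" "pderiv k = 0"
  shows "bracket_seq k h n \<noteq> 0"
proof -
  have "bracket_seq k h n \<noteq> 0 \<and> pderiv (bracket_seq k h n) = 0"
    by (induction n) (simp_all add: assms pderiv_mult pderiv_diff)
  then show ?thesis ..
qed

text \<open>With d = deg h the degree of the n-th term q is at most n(d - 1), which is carried
  through the induction. If the next term vanished, then (n + 1) h' q = h q', and comparing leading
  coefficients would give deg q = (n + 1) d, which is too large.\<close>

lemma bracket_seq_nonzero:
  fixes h :: "'f::field_char_0 poly"
  assumes h': "pderiv h \<noteq> 0"
  shows "bracket_seq (pderiv h) h n \<noteq> 0"
proof -
  define d where "d = degree h"
  have d: "d > 0" using h' by (simp add: d_def pderiv_eq_0_iff)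
  have "bracket_seq (pderiv h) h n \<noteq> 0 \<and> degree (bracket_seq (pderiv h) h n) \<le> n * (d - 1)"
  proof (induction n)
    case (Suc n)
    define q where "q = bracket_seq (pderiv h) h n"
    have q: "q \<noteq> 0" "degree q \<le> n * (d - 1)" using Suc by (simp_all add: q_def)
    have eq: "bracket_seq (pderiv h) h (Suc n) = smult (of_nat (Suc n)) (pderiv h * q) - h * pderiv q"
      by (simp add: q_def[symmetric] algebra_simps of_nat_poly smult_add_left)
    have "degree (pderiv h * q) \<le> Suc n * (d - 1)"
      using degree_mult_le[of "pderiv h" q] q(2) by (simp add: degree_pderiv d_def)
    moreover have "degree (h * pderiv q) \<le> Suc n * (d - 1)"
    \<comment> \<open>For constant q the number \<open>degree q - 1\<close> is truncated to 0 and
      the bound below could fail, but then q' = 0.\<close>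
    proof (cases "degree q = 0")
      case True
      then have "pderiv q = 0" by (simp add: pderiv_eq_0_iff)
      then show ?thesis by simp
    next
      case False
      then have "d + (degree q - 1) \<le> Suc n * (d - 1)" using q(2) d by simp
      moreover have "degree (h * pderiv q) \<le> d + (degree q - 1)"
        using degree_mult_le[of h "pderiv q"] by (simp add: degree_pderiv d_def)
      ultimately show ?thesis by simp
    qed
    ultimately have "degree (bracket_seq (pderiv h) h (Suc n)) \<le> Suc n * (d - 1)"
      unfolding eq by (intro degree_diff_le) (auto intro: degree_smult_le[THEN le_trans])
    moreover have "bracket_seq (pderiv h) h (Suc n) \<noteq> 0"
    proof
      assume "bracket_seq (pderiv h) h (Suc n) = 0"
      then have e: "smult (of_nat (Suc n)) (pderiv h * q) = h * pderiv q" using eq by simp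
      have "h * pderiv q \<noteq> 0" using h' q(1) by (simp flip: e del: of_nat_Suc)
      then have dq: "degree q > 0" by (auto simp: pderiv_eq_0_iff)
      have "coeff (pderiv h * q) (d - 1 + degree q) = of_nat d * lead_coeff h * lead_coeff q"
        using coeff_mult_degree_sum[of "pderiv h" q] d by (simp add: degree_pderiv d_def coeff_pderiv)
      moreover have "coeff (h * pderiv q) (d + (degree q - 1)) = lead_coeff h * (of_nat (degree q) * lead_coeff q)"
        using coeff_mult_degree_sum[of h "pderiv q"] dq by (simp add: degree_pderiv d_def coeff_pderiv)
      moreover have "d - 1 + degree q = d + (degree q - 1)" using d dq by simp
      ultimately have "of_nat (Suc n) * (of_nat d * lead_coeff h * lead_coeff q) =
          lead_coeff h * (of_nat (degree q) * lead_coeff q)"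
        using arg_cong[OF e, of "\<lambda>r. coeff r (d - 1 + degree q)"] by simp
      moreover have "lead_coeff h \<noteq> 0" using h' by auto
      ultimately have "of_nat (Suc n) * of_nat d = (of_nat (degree q) :: 'f)"
        using q(1) by (simp add: mult_ac)
      then have "of_nat (Suc n * d) = (of_nat (degree q) :: 'f)" by (simp only: of_nat_mult)
      then have "Suc n * d = degree q" using of_nat_eq_iff by blast
      then have "Suc n * d \<le> n * (d - 1)" using q(2) by simp
      also have "\<dots> \<le> n * d" by simp
      finally show False using d by simp
    qed
    ultimately show ?case by blast
  qed simp
  then show ?thesis ..
qed

section \<open>Leading terms\<close>

lemma weyl_induct [case_names zero add single]:
  assumes "P 0" "\<And>a b. P a \<Longrightarrow> P b \<Longrightarrow> P (a + b)"
    and "\<And>\<mu> \<alpha> i. lookup (lookup w \<mu>) (\<alpha>, i) \<noteq> 0 \<Longrightarrow> P (single \<mu> (single (\<alpha>, i) (lookup (lookup w \<mu>) (\<alpha>, i))))"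
  shows "P (w :: 'f::field weyl)"
proof (rule poly_mapping_add_induct)
  fix \<mu> assume "\<mu> \<in> keys w"
  show "P (single \<mu> (lookup w \<mu>))"
  proof (rule poly_mapping_add_induct[where P = "\<lambda>u. P (single \<mu> u)"])
    fix k assume "k \<in> keys (lookup w \<mu>)"
    then show "P (single \<mu> (single k (lookup (lookup w \<mu>) k)))"
      using assms(3)[of \<mu> "fst k" "snd k"] by (simp add: in_keys_iff)
  qed (simp_all add: assms single_add)
qed (simp_all add: assms)

definition vec_of_midx :: "midx \<Rightarrow> 'f::field_char_0 vec" where
  "vec_of_midx i = Poly_Mapping.map of_nat i"

lemma lookup_vec_of_midx [simp]: "lookup (vec_of_midx i) p = of_nat (lookup i p)"
  by (simp add: vec_of_midx_def Poly_Mapping.map.rep_eq when_def)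

lemma vec_of_midx_add: "vec_of_midx (i + j) = vec_of_midx i + vec_of_midx j"
  by (rule poly_mapping_eqI) (simp add: lookup_add)

lemma vec_of_midx_inject [simp]: "vec_of_midx i = vec_of_midx j \<longleftrightarrow> i = j"
proof
  assume "vec_of_midx i = (vec_of_midx j :: 'a vec)"
  then have "of_nat (lookup i p) = (of_nat (lookup j p) :: 'a)" for p
    by (metis lookup_vec_of_midx)
  then show "i = j" by (intro poly_mapping_eqI) (simp only: of_nat_eq_iff)
qed simp

lemma vec_of_midx_zero [simp]: "vec_of_midx 0 = 0"
  by (rule poly_mapping_eqI) simp

lemma vec_of_midx_eq_0_iff [simp]: "vec_of_midx i = 0 \<longleftrightarrow> i = 0"
  using vec_of_midx_inject[of i 0] by simp

section \<open>Keys made of order, weight and t-exponent, and orders on them\<close>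

type_synonym 'f wkey = "'f \<times> 'f vec \<times> 'f vec"

text \<open>Order and exponents are embedded into the field, so that the keys form part of a torsion-free
  group.\<close>

definition weyl_key :: "midx \<Rightarrow> 'f::field_char_0 vec \<Rightarrow> midx \<Rightarrow> 'f wkey" where
  "weyl_key \<mu> \<alpha> i = (of_nat (mdeg \<mu>), \<alpha>, vec_of_midx i)"

lemma nmult_field: "nmult n (x :: 'f::field) = of_nat n * x"
  by (induction n) (simp_all add: algebra_simps)

lemma nmult_prod: "nmult n x = (nmult n (fst x), nmult n (snd x))"
  by (induction n) (simp_all add: zero_prod_def plus_prod_def)

lemma lookup_nmult: "lookup (nmult n v) p = nmult n (lookup v p)"
  by (induction n) (simp_all add: lookup_add)

lemma nmult_vec_eq_0: "n > 0 \<Longrightarrow> nmult n (v :: 'f::field_char_0 vec) = 0 \<Longrightarrow> v = 0"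
  by (rule poly_mapping_eqI)
    (metis lookup_nmult nmult_field lookup_zero mult_eq_0_iff of_nat_eq_0_iff not_gr_zero)

lemma nmult_wkey_eq_0:
  fixes x :: "'f::field_char_0 wkey"
  assumes "n > 0" "nmult n x = 0"
  shows "x = 0"
proof -
  obtain a b c where x: "x = (a, b, c)" by (cases x)
  have "nmult n a = 0" "nmult n b = 0" "nmult n c = 0"
    using assms(2) by (simp_all add: x nmult_prod[of n "(a, b, c)"] nmult_prod[of n "(b, c)"] zero_prod_def)
  then show ?thesis
    using assms(1) nmult_vec_eq_0[of n b] nmult_vec_eq_0[of n c] by (simp add: x nmult_field zero_prod_def)
qed

text \<open>\<open>degree_pos\<close> lets the order of an operator dominate weight and exponent. By
  \<open>midx_pos\<close>, a term in which a derivative has lowered the t-exponent is smaller than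
  its companion with the same order and weight.\<close>

locale weyl_order =
  fixes P :: "'f::field_char_0 wkey set"
  assumes cone: "positive_cone P"
    and degree_pos: "n > 0 \<Longrightarrow> (of_nat n, \<alpha>, \<beta>) \<in> P"
    and midx_pos: "i \<noteq> 0 \<Longrightarrow> (0, 0, vec_of_midx i) \<in> P"

text \<open>The three families in \<open>P0\<close> are together closed under addition and avoid 0,
  so they extend to a cone. The middle one, present only for nonzero \<open>\<alpha>1\<close>, makes
  that weight positive whatever the t-exponents are.\<close>

lemma weyl_order_exists:
  fixes \<alpha>1 :: "'f::field_char_0 vec"
  obtains P where "weyl_order P" "\<And>\<beta>. \<alpha>1 \<noteq> 0 \<Longrightarrow> (0, \<alpha>1, \<beta>) \<in> P"
proof -
  define P0 :: "'f wkey set" where "P0 = {(of_nat n, \<alpha>, \<beta>) | n \<alpha> \<beta>. n > 0} \<union>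
    {(0, nmult n \<alpha>1, \<beta>) | n \<beta>. n > 0 \<and> \<alpha>1 \<noteq> 0} \<union> {(0, 0, vec_of_midx i) | i. i \<noteq> 0}"
  have "0 \<notin> P0" using nmult_vec_eq_0[of _ \<alpha>1] by (auto simp: P0_def zero_prod_def)
  moreover have "x + y \<in> P0" if x: "x \<in> P0" and y: "y \<in> P0" for x y
  proof -
    have deg: "(of_nat n, \<alpha>, \<beta>) \<in> P0" if "n > 0" for n \<alpha> \<beta> using that by (auto simp: P0_def)
    have mid: "(0, nmult n \<alpha>1, \<beta>) \<in> P0" if "n > 0" "\<alpha>1 \<noteq> 0" for n \<beta> using that by (auto simp: P0_def)
    have low: "(0, 0, vec_of_midx i) \<in> P0" if "i \<noteq> 0" for i using that by (auto simp: P0_def)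
    consider n \<alpha> \<beta> where "x = (of_nat n, \<alpha>, \<beta>)" "n > 0" | n \<beta> where "x = (0, nmult n \<alpha>1, \<beta>)" "n > 0" "\<alpha>1 \<noteq> 0"
      | i where "x = (0, 0, vec_of_midx i)" "i \<noteq> 0"
      using x unfolding P0_def by blast
    note x_cases = this
    consider n \<alpha> \<beta> where "y = (of_nat n, \<alpha>, \<beta>)" "n > 0" | n \<beta> where "y = (0, nmult n \<alpha>1, \<beta>)" "n > 0" "\<alpha>1 \<noteq> 0"
      | i where "y = (0, 0, vec_of_midx i)" "i \<noteq> 0"
      using y unfolding P0_def by blast
    note y_cases = this
    show ?thesis
    proof (cases rule: x_cases)
      case (1 n \<alpha> \<beta>)
      have "\<exists>m. fst y = of_nat m" by (cases rule: y_cases) (auto intro: exI[of _ 0])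
      then obtain m where "fst y = of_nat m" ..
      then have "x + y = (of_nat (n + m), snd (x + y))" using 1(1) by (simp add: plus_prod_def)
      then show ?thesis using 1(2) deg[of "n + m"]
        by (metis prod.collapse add_gr_0)
    next
      case x2: (2 n \<beta>)
      show ?thesis
      proof (cases rule: y_cases)
        case (1 m \<alpha> \<gamma>)
        then show ?thesis using x2 deg by simp
      next
        case (2 m \<gamma>)
        then show ?thesis using x2 mid[of "n + m"]
          by (simp add: nmult_add)
      next
        case (3 i)
        then show ?thesis using x2 mid[of n] by simp
      qed
    next
      case x3: (3 i)
      show ?thesis
      proof (cases rule: y_cases)
        case (1 m \<alpha> \<gamma>)
        then show ?thesis using x3 deg by simp
      next
        case (2 m \<gamma>)
        then show ?thesis using x3 mid[of m] by simp
      next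
        case y3: (3 j)
        have "i + j \<noteq> 0" using x3(2) by (metis mdeg_add mdeg_eq_0_iff add_is_0)
        then show ?thesis using x3 y3 low[of "i + j"]
          by (simp add: vec_of_midx_add)
      qed
    qed
  qed
  ultimately obtain P where P: "positive_cone P" "P0 \<subseteq> P"
    using positive_cone_extension[of P0] nmult_wkey_eq_0 by blast
  have "nmult 1 \<alpha>1 = \<alpha>1" by simp
  then have "(0, \<alpha>1, \<beta>) \<in> P0" if "\<alpha>1 \<noteq> 0" for \<beta>
    unfolding P0_def using that zero_less_one by (metis (mono_tags, lifting) UnCI mem_Collect_eq)
  moreover have "weyl_order P" using P by unfold_locales (auto simp: P0_def)
  ultimately show ?thesis using that P(2) by blast
qed

text \<open>A key fixes the weight, the t-exponent and the total degree of the derivation part, but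
  not the multi-index itself; the part of \<open>w\<close> with key \<open>\<kappa>\<close> is
  therefore a homogeneous polynomial in the derivations.\<close>

definition lead :: "'f::field_char_0 wkey \<Rightarrow> 'f weyl \<Rightarrow> (midx \<Rightarrow>\<^sub>0 'f)" where
  "lead \<kappa> w = (\<Sum>\<mu>\<in>keys w. \<Sum>k\<in>keys (lookup w \<mu>).
     if weyl_key \<mu> (fst k) (snd k) = \<kappa> then single \<mu> (lookup (lookup w \<mu>) k) else 0)"

lemma lead_add: "lead \<kappa> (a + b) = lead \<kappa> a + lead \<kappa> b"
proof -
  have inner: "(\<Sum>k\<in>keys (u + v). if weyl_key \<mu> (fst k) (snd k) = \<kappa> then single \<mu> (lookup (u + v) k) else 0) =
    (\<Sum>k\<in>keys u. if weyl_key \<mu> (fst k) (snd k) = \<kappa> then single \<mu> (lookup u k) else 0) +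
    (\<Sum>k\<in>keys v. if weyl_key \<mu> (fst k) (snd k) = \<kappa> then single \<mu> (lookup v k) else 0)" for \<mu> u v
    by (rule sum_keys_add[where f = "\<lambda>k c. if weyl_key \<mu> (fst k) (snd k) = \<kappa> then single \<mu> c else 0"])
      (simp_all add: single_add)
  show ?thesis unfolding lead_def
    by (rule sum_keys_add[where f = "\<lambda>\<mu> u. \<Sum>k\<in>keys u.
        if weyl_key \<mu> (fst k) (snd k) = \<kappa> then single \<mu> (lookup u k) else 0"])
      (simp_all only: inner keys_zero sum.empty)
qed

lemma lead_zero [simp]: "lead \<kappa> 0 = 0"
  by (simp add: lead_def)

lemma lead_sum: "lead \<kappa> (sum f S) = (\<Sum>s\<in>S. lead \<kappa> (f s))"
  by (induction S rule: infinite_finite_induct) (simp_all add: lead_add)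

lemma lead_diff: "lead \<kappa> (a - b) = lead \<kappa> a - lead \<kappa> b"
  using lead_add[of \<kappa> "a - b" b] by simp

lemma lead_single: "lead \<kappa> (single \<mu> (single (\<alpha>, i) c)) = (if weyl_key \<mu> \<alpha> i = \<kappa> then single \<mu> c else 0)"
  by (cases "c = 0") (simp_all add: lead_def)

lemma lookup_lead: "lookup (lead (weyl_key \<mu> \<alpha> i) w) \<mu> = lookup (lookup w \<mu>) (\<alpha>, i)"
proof (induction w rule: weyl_induct)
  case (single \<nu> \<beta> j)
  then show ?case by (auto simp: lead_single lookup_single when_def weyl_key_def)
qed (simp_all add: lead_add lookup_add)

lemma keys_lead: "keys (lead \<kappa> w) \<subseteq> keys w"
  unfolding lead_def
  by (rule order_trans[OF keys_sum] UN_least)+ (auto dest!: subsetD[OF keys_sum] split: if_splits)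

lemma mdeg_eq_1: "mdeg \<rho> = 1 \<Longrightarrow> \<exists>p. \<rho> = unit_midx p"
proof -
  assume 1: "mdeg \<rho> = 1"
  then have "\<rho> \<noteq> 0" by auto
  then obtain p where p: "lookup \<rho> p \<noteq> 0" by (metis poly_mapping_eqI lookup_zero)
  then have "\<rho> - unit_midx p = 0" using mdeg_minus_unit[OF p] 1 by simp
  then show ?thesis using midx_minus_unit_add[OF p] by auto
qed

text \<open>Separates the product formula by the number of derivatives applied to the right factor:
  none (the commutative product), one (the Poisson term), and at least two (lower terms).\<close>

lemma lower_midx_split:
  "lower_midx \<mu> = insert 0 (unit_midx ` keys \<mu> \<union> {\<rho> \<in> lower_midx \<mu>. mdeg \<rho> \<ge> 2})"
proof (intro equalityI subsetI)
  fix \<rho> assume \<rho>: "\<rho> \<in> lower_midx \<mu>"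
  consider "mdeg \<rho> = 0" | "mdeg \<rho> = 1" | "mdeg \<rho> \<ge> 2" by linarith
  then show "\<rho> \<in> insert 0 (unit_midx ` keys \<mu> \<union> {\<rho> \<in> lower_midx \<mu>. mdeg \<rho> \<ge> 2})"
  proof cases
    case 2
    then obtain p where p: "\<rho> = unit_midx p" using mdeg_eq_1 by blast
    then have "p \<in> keys \<mu>" using \<rho>
      by (auto simp: lower_midx_def lookup_unit in_keys_iff dest: spec[of _ p])
    then show ?thesis using p by simp
  qed (use \<rho> in auto)
qed (auto simp: lower_midx_def lookup_unit in_keys_iff)

lemma lower_midx_minus_add: "\<rho> \<in> lower_midx \<mu> \<Longrightarrow> \<mu> + \<nu> - \<rho> + \<rho> = \<mu> + \<nu>"
  by (rule poly_mapping_eqI) (simp add: lower_midx_def lookup_add lookup_minus trans_le_add1)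

text \<open>The first-order terms of a product in which the derivative hits x^beta instead of a
  power of t: the derivative of the polynomial \<partial>^mu in direction beta, times
  \<partial>^nu.\<close>

definition contraction :: "'f::field_char_0 \<Rightarrow> midx \<Rightarrow> midx \<Rightarrow> 'f vec \<Rightarrow> 'f vec \<times> midx \<Rightarrow> 'f weyl" where
  "contraction c \<mu> \<nu> \<beta> k =
    (\<Sum>p\<in>keys \<mu>. single (\<mu> + \<nu> - unit_midx p) (single k (c * (of_nat (lookup \<mu> p) * lookup \<beta> p))))"

section \<open>The filtration of the Weyl algebra by keys\<close>

context weyl_order
begin

definition below :: "'f wkey \<Rightarrow> 'f weyl set" where
  "below \<kappa> = {w. \<forall>\<mu> \<alpha> i. lookup (lookup w \<mu>) (\<alpha>, i) \<noteq> 0 \<longrightarrow> \<kappa> - weyl_key \<mu> \<alpha> i \<in> insert 0 P}"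

definition strictly_below :: "'f wkey \<Rightarrow> 'f weyl set" where
  "strictly_below \<kappa> = {w. \<forall>\<mu> \<alpha> i. lookup (lookup w \<mu>) (\<alpha>, i) \<noteq> 0 \<longrightarrow> \<kappa> - weyl_key \<mu> \<alpha> i \<in> P}"

lemma add_P: "x \<in> P \<Longrightarrow> y \<in> P \<Longrightarrow> x + y \<in> P" and zero_P: "0 \<notin> P"
  using cone by (auto simp: positive_cone_def)

lemma add_P1: "x \<in> P \<Longrightarrow> y \<in> insert 0 P \<Longrightarrow> x + y \<in> P"
  by (metis add.right_neutral add_P insert_iff)

lemma below_zero [simp]: "0 \<in> below \<kappa>" "0 \<in> strictly_below \<kappa>"
  by (simp_all add: below_def strictly_below_def)

lemma below_add: "a \<in> below \<kappa> \<Longrightarrow> b \<in> below \<kappa> \<Longrightarrow> a + b \<in> below \<kappa>"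
  unfolding below_def mem_Collect_eq lookup_add by (metis add.right_neutral)

lemma strictly_below_add: "a \<in> strictly_below \<kappa> \<Longrightarrow> b \<in> strictly_below \<kappa> \<Longrightarrow> a + b \<in> strictly_below \<kappa>"
  unfolding strictly_below_def mem_Collect_eq lookup_add by (metis add.right_neutral)

lemma strictly_below_minus: "a \<in> strictly_below \<kappa> \<Longrightarrow> - a \<in> strictly_below \<kappa>"
  by (simp add: strictly_below_def)

lemma below_minus: "a \<in> below \<kappa> \<Longrightarrow> - a \<in> below \<kappa>"
  by (simp add: below_def)

lemma below_diff: "a \<in> below \<kappa> \<Longrightarrow> b \<in> below \<kappa> \<Longrightarrow> a - b \<in> below \<kappa>"
  using below_add[of a \<kappa> "- b"] by (simp add: below_minus)

lemma strictly_below_diff: "a \<in> strictly_below \<kappa> \<Longrightarrow> b \<in> strictly_below \<kappa> \<Longrightarrow> a - b \<in> strictly_below \<kappa>"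
  using strictly_below_add[of a \<kappa> "- b"] by (simp add: strictly_below_minus)

lemma strictly_below_sum: "(\<And>s. s \<in> S \<Longrightarrow> f s \<in> strictly_below \<kappa>) \<Longrightarrow> sum f S \<in> strictly_below \<kappa>"
  by (induction S rule: infinite_finite_induct) (auto simp: strictly_below_add)

lemma below_sum: "(\<And>s. s \<in> S \<Longrightarrow> f s \<in> below \<kappa>) \<Longrightarrow> sum f S \<in> below \<kappa>"
  by (induction S rule: infinite_finite_induct) (auto simp: below_add)

lemma strictly_below_imp_below: "a \<in> strictly_below \<kappa> \<Longrightarrow> a \<in> below \<kappa>"
  by (auto simp: strictly_below_def below_def)

lemma below_scale: "a \<in> below \<kappa> \<Longrightarrow> weyl_scale c a \<in> below \<kappa>"
  by (simp add: below_def)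

lemma below_mono: "a \<in> below \<kappa> \<Longrightarrow> \<kappa>' - \<kappa> \<in> P \<Longrightarrow> a \<in> strictly_below \<kappa>'"
  unfolding below_def strictly_below_def mem_Collect_eq
proof (intro allI impI)
  fix \<mu> \<alpha> i
  assume a: "\<forall>\<mu> \<alpha> i. lookup (lookup a \<mu>) (\<alpha>, i) \<noteq> 0 \<longrightarrow> \<kappa> - weyl_key \<mu> \<alpha> i \<in> insert 0 P"
    "\<kappa>' - \<kappa> \<in> P" "lookup (lookup a \<mu>) (\<alpha>, i) \<noteq> 0"
  have "(\<kappa>' - \<kappa>) + (\<kappa> - weyl_key \<mu> \<alpha> i) \<in> P" using a by (intro add_P1) blast+
  then show "\<kappa>' - weyl_key \<mu> \<alpha> i \<in> P" by simp
qed

lemma strictly_below_single: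
  assumes "\<And>\<alpha> i. (\<alpha>, i) \<in> keys u \<Longrightarrow> \<kappa> - weyl_key \<mu> \<alpha> i \<in> P"
  shows "single \<mu> u \<in> strictly_below \<kappa>"
  using assms by (auto simp: strictly_below_def lookup_single when_def in_keys_iff)

lemma below_single_single: "\<kappa> - weyl_key \<mu> \<alpha> i \<in> insert 0 P \<Longrightarrow> single \<mu> (single (\<alpha>, i) c) \<in> below \<kappa>"
  by (auto simp: below_def lookup_single when_def)

lemma lead_strictly_below: "a \<in> strictly_below \<kappa> \<Longrightarrow> lead \<kappa> a = 0"
proof -
  assume a: "a \<in> strictly_below \<kappa>"
  have "weyl_key \<mu> (fst k) (snd k) \<noteq> \<kappa>" if "k \<in> keys (lookup a \<mu>)" for \<mu> k
  proof
    assume "weyl_key \<mu> (fst k) (snd k) = \<kappa>"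
    moreover have "\<kappa> - weyl_key \<mu> (fst k) (snd k) \<in> P"
      using a that by (simp add: strictly_below_def in_keys_iff)
    ultimately show False using zero_P by simp
  qed
  then show ?thesis by (simp add: lead_def)
qed

text \<open>The reference key is one order below the sum of the two keys. Terms with at least two
  derivatives have still smaller order. A single derivative applied to a power of t, collected in
  \<open>?D\<close>, has the reference order and weight but a smaller t-exponent.\<close>

lemma weyl_mult_single_single:
  obtains r where
    "weyl_mult (single \<mu> (single (\<alpha>, i) c)) (single \<nu> (single (\<beta>, j) d)) =
      single (\<mu> + \<nu>) (single (\<alpha> + \<beta>, i + j) (c * d)) +
      contraction (c * d) \<mu> \<nu> \<beta> (\<alpha> + \<beta>, i + j) + r"
    "r \<in> strictly_below (weyl_key \<mu> \<alpha> i + weyl_key \<nu> \<beta> j - (1, 0, 0))"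
proof -
  let ?\<kappa> = "weyl_key \<mu> \<alpha> i + weyl_key \<nu> \<beta> j - (1, 0, 0)"
  let ?t = "\<lambda>\<rho>. single (\<mu> + \<nu> - \<rho>) (pm_scale (of_nat (multi_binomial \<mu> \<rho>))
    (single (\<alpha>, i) c * alg_deriv_pow \<rho> (single (\<beta>, j) d)))"
  let ?D = "(\<Sum>p\<in>keys \<mu>. single (\<mu> + \<nu> - unit_midx p)
        (single (\<alpha> + \<beta>, i + (j - unit_midx p)) (c * d * (of_nat (lookup \<mu> p) * of_nat (lookup j p)))))"
  let ?L = "{\<rho> \<in> lower_midx \<mu>. mdeg \<rho> \<ge> 2}"
  have fin: "finite ?L" using finite_lower_midx by simp
  have disj: "unit_midx ` keys \<mu> \<inter> ?L = {}" by auto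
  have "0 \<notin> unit_midx ` keys \<mu> \<union> ?L" by auto
  then have "weyl_mult (single \<mu> (single (\<alpha>, i) c)) (single \<nu> (single (\<beta>, j) d)) =
      ?t 0 + (\<Sum>\<rho>\<in>unit_midx ` keys \<mu> \<union> ?L. ?t \<rho>)"
    unfolding weyl_mult_single weyl_mult_monom_def
    by (subst lower_midx_split, subst sum.insert) (use fin in auto)
  also have "(\<Sum>\<rho>\<in>unit_midx ` keys \<mu> \<union> ?L. ?t \<rho>) = (\<Sum>\<rho>\<in>unit_midx ` keys \<mu>. ?t \<rho>) + (\<Sum>\<rho>\<in>?L. ?t \<rho>)"
    by (rule sum.union_disjoint[OF _ fin disj]) simp
  also have "(\<Sum>\<rho>\<in>unit_midx ` keys \<mu>. ?t \<rho>) = (\<Sum>p\<in>keys \<mu>. ?t (unit_midx p))"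
    by (subst sum.reindex) (auto intro: inj_onI)
  also have "\<dots> = contraction (c * d) \<mu> \<nu> \<beta> (\<alpha> + \<beta>, i + j) + ?D"
    unfolding contraction_def sum.distrib[symmetric]
    by (rule sum.cong) (simp_all add: alg_deriv_single ring_distribs mult_single pm.scale_right_distrib single_add mult_ac)
  finally have "weyl_mult (single \<mu> (single (\<alpha>, i) c)) (single \<nu> (single (\<beta>, j) d)) =
      single (\<mu> + \<nu>) (single (\<alpha> + \<beta>, i + j) (c * d)) +
      contraction (c * d) \<mu> \<nu> \<beta> (\<alpha> + \<beta>, i + j) + (?D + (\<Sum>\<rho>\<in>?L. ?t \<rho>))"
    by (simp add: mult_single add_ac)
  moreover have "(\<Sum>\<rho>\<in>?L. ?t \<rho>) \<in> strictly_below ?\<kappa>"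
  proof (intro strictly_below_sum strictly_below_single)
    fix \<rho> \<alpha>' i'
    assume \<rho>: "\<rho> \<in> ?L" and k: "(\<alpha>', i') \<in> keys (pm_scale (of_nat (multi_binomial \<mu> \<rho>))
      (single (\<alpha>, i) c * alg_deriv_pow \<rho> (single (\<beta>, j) d)))"
    have "keys (alg_deriv_pow \<rho> (single (\<beta>, j) d)) \<subseteq> {\<beta>} \<times> UNIV"
    proof (rule alg_deriv_pow_induct)
      fix p and v :: "'f alg" assume v: "keys v \<subseteq> {\<beta>} \<times> UNIV"
      have "keys (alg_deriv_monom p \<beta> i) \<subseteq> {\<beta>} \<times> UNIV" for i
        unfolding alg_deriv_monom_eq by (rule order_trans[OF Poly_Mapping.keys_add]) auto
      then have "keys (pm_scale x (alg_deriv_monom p \<beta> i)) \<subseteq> {\<beta>} \<times> UNIV" for i x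
        by (force simp: in_keys_iff)
      then show "keys (alg_deriv p v) \<subseteq> {\<beta>} \<times> UNIV"
        unfolding alg_deriv_def using v
        by (intro order_trans[OF keys_sum] UN_least) auto
    qed auto
    moreover have "(\<alpha>', i') \<in> keys (single (\<alpha>, i) c * alg_deriv_pow \<rho> (single (\<beta>, j) d))"
      using k by (simp add: in_keys_iff)
    then obtain k1 k2 where "(\<alpha>', i') = k1 + k2" "k1 \<in> keys (single (\<alpha>, i) c)"
      "k2 \<in> keys (alg_deriv_pow \<rho> (single (\<beta>, j) d))"
      using keys_mult by blast
    ultimately have "\<alpha>' = \<alpha> + \<beta>"
      by (cases k2) (auto split: if_splits)
    moreover have "mdeg (\<mu> + \<nu> - \<rho>) + mdeg \<rho> = mdeg \<mu> + mdeg \<nu>"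
      using \<rho> lower_midx_minus_add[of \<rho> \<mu> \<nu>] by (metis (mono_tags, lifting) mdeg_add mem_Collect_eq)
    then have "of_nat (mdeg \<mu>) + of_nat (mdeg \<nu>) - of_nat (mdeg (\<mu> + \<nu> - \<rho>)) = (of_nat (mdeg \<rho>) :: 'f)"
      by (metis add_diff_cancel_left' of_nat_add)
    moreover have "of_nat (mdeg \<rho>) - 1 = (of_nat (mdeg \<rho> - 1) :: 'f)" using \<rho> by (simp add: of_nat_diff)
    ultimately have "?\<kappa> - weyl_key (\<mu> + \<nu> - \<rho>) \<alpha>' i' =
        (of_nat (mdeg \<rho> - 1), 0, vec_of_midx i + vec_of_midx j - vec_of_midx i')"
      by (simp add: weyl_key_def diff_right_commute algebra_simps)
    then show "?\<kappa> - weyl_key (\<mu> + \<nu> - \<rho>) \<alpha>' i' \<in> P" using degree_pos[of "mdeg \<rho> - 1"] \<rho> by simp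
  qed
  moreover have "?D \<in> strictly_below ?\<kappa>"
  proof (intro strictly_below_sum strictly_below_single)
    fix p \<alpha>' i'
    assume p: "p \<in> keys \<mu>"
      and "(\<alpha>', i') \<in> keys (single (\<alpha> + \<beta>, i + (j - unit_midx p)) (c * d * (of_nat (lookup \<mu> p) * of_nat (lookup j p))))"
    then have *: "\<alpha>' = \<alpha> + \<beta>" "i' = i + (j - unit_midx p)" "lookup j p \<noteq> 0" by (auto split: if_splits)
    have "Suc (mdeg (\<mu> + \<nu> - unit_midx p)) = mdeg \<mu> + mdeg \<nu>"
      using p mdeg_minus_unit[of "\<mu> + \<nu>" p] by (simp add: lookup_add in_keys_iff)
    then have "of_nat (mdeg \<mu>) + of_nat (mdeg \<nu>) = 1 + (of_nat (mdeg (\<mu> + \<nu> - unit_midx p)) :: 'f)"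
      by (metis of_nat_Suc of_nat_add)
    moreover have "vec_of_midx i + vec_of_midx j = vec_of_midx i' + (vec_of_midx (unit_midx p) :: 'f vec)"
      using midx_minus_unit_add[OF *(3)] *(2) by (simp flip: vec_of_midx_add add: add.assoc)
    ultimately have "?\<kappa> - weyl_key (\<mu> + \<nu> - unit_midx p) \<alpha>' i' = (0, 0, vec_of_midx (unit_midx p))"
      using * by (simp add: weyl_key_def)
    then show "?\<kappa> - weyl_key (\<mu> + \<nu> - unit_midx p) \<alpha>' i' \<in> P" using midx_pos by simp
  qed
  ultimately show ?thesis using that strictly_below_add by blast
qed

lemma weyl_key_unit:
  fixes \<alpha> \<beta> :: "'f vec"
  assumes "p \<in> keys \<mu>"
  shows "weyl_key (\<mu> + \<nu> - unit_midx p) (\<alpha> + \<beta>) (i + j) = weyl_key \<mu> \<alpha> i + weyl_key \<nu> \<beta> j - (1, 0, 0)"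
proof -
  have "Suc (mdeg (\<mu> + \<nu> - unit_midx p)) = mdeg \<mu> + mdeg \<nu>"
    using assms mdeg_minus_unit[of "\<mu> + \<nu>" p] by (simp add: lookup_add in_keys_iff)
  then have "of_nat (mdeg \<mu>) + of_nat (mdeg \<nu>) = 1 + (of_nat (mdeg (\<mu> + \<nu> - unit_midx p)) :: 'f)"
    by (metis of_nat_Suc of_nat_add)
  then have "of_nat (mdeg (\<mu> + \<nu> - unit_midx p)) = of_nat (mdeg \<mu>) + of_nat (mdeg \<nu>) - (1 :: 'f)" by simp
  then show ?thesis by (simp add: weyl_key_def vec_of_midx_add)
qed

text \<open>The commutative top terms of the two products cancel and leave the difference of two
  contractions, a Poisson bracket. The second contraction differentiates in direction alpha, which
  along the chosen line is \<open>pderiv\<close>.\<close>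

lemma weyl_bracket_single_single:
  fixes \<alpha> \<beta> \<xi> :: "'f vec" and \<mu> i \<nu> j :: midx and c d :: 'f
  defines "\<kappa>1 \<equiv> weyl_key \<mu> \<alpha> i" and "\<kappa>2 \<equiv> weyl_key \<nu> \<beta> j"
  defines "B \<equiv> weyl_bracket (single \<mu> (single (\<alpha>, i) c)) (single \<nu> (single (\<beta>, j) d))"
  assumes \<mu>: "keys \<mu> \<subseteq> {1..l}"
  shows "B \<in> below (\<kappa>1 + \<kappa>2 - (1, 0, 0))"
    and "mpoly_line (lead (\<kappa>1 + \<kappa>2 - (1, 0, 0)) B) \<xi> \<alpha> =
      mpoly_line_dir l (single \<mu> c) \<beta> \<xi> \<alpha> * mpoly_line (single \<nu> d) \<xi> \<alpha> -
      mpoly_line (single \<mu> c) \<xi> \<alpha> * pderiv (mpoly_line (single \<nu> d) \<xi> \<alpha>)"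
proof -
  let ?\<kappa> = "\<kappa>1 + \<kappa>2 - (1, 0, 0)"
  define S1 where "S1 = contraction (c * d) \<mu> \<nu> \<beta> (\<alpha> + \<beta>, i + j)"
  define S2 where "S2 = contraction (c * d) \<nu> \<mu> \<alpha> (\<alpha> + \<beta>, i + j)"
  have S2_eq: "S2 = (\<Sum>p\<in>keys \<nu>. single (\<mu> + \<nu> - unit_midx p)
      (single (\<alpha> + \<beta>, i + j) (c * d * (of_nat (lookup \<nu> p) * lookup \<alpha> p))))"
    by (simp add: S2_def contraction_def add.commute[of \<nu>])
  obtain r1 where r1: "weyl_mult (single \<mu> (single (\<alpha>, i) c)) (single \<nu> (single (\<beta>, j) d)) =
      single (\<mu> + \<nu>) (single (\<alpha> + \<beta>, i + j) (c * d)) + S1 + r1" "r1 \<in> strictly_below ?\<kappa>"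
    using weyl_mult_single_single unfolding S1_def \<kappa>1_def \<kappa>2_def by blast
  obtain r2 where "weyl_mult (single \<nu> (single (\<beta>, j) d)) (single \<mu> (single (\<alpha>, i) c)) =
      single (\<nu> + \<mu>) (single (\<beta> + \<alpha>, j + i) (d * c)) +
      contraction (d * c) \<nu> \<mu> \<alpha> (\<beta> + \<alpha>, j + i) + r2"
      "r2 \<in> strictly_below (\<kappa>2 + \<kappa>1 - (1, 0, 0))"
    using weyl_mult_single_single unfolding \<kappa>1_def \<kappa>2_def by blast
  then have r2: "weyl_mult (single \<nu> (single (\<beta>, j) d)) (single \<mu> (single (\<alpha>, i) c)) =
      single (\<mu> + \<nu>) (single (\<alpha> + \<beta>, i + j) (c * d)) + S2 + r2" "r2 \<in> strictly_below ?\<kappa>"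
    by (simp_all add: S2_def add.commute mult.commute[of c d])
  have B: "B = (S1 - S2) + (r1 - r2)" by (simp add: B_def weyl_bracket_def r1(1) r2(1))
  have r: "r1 - r2 \<in> strictly_below ?\<kappa>" using r1(2) r2(2) by (rule strictly_below_diff)
  have key1: "weyl_key (\<mu> + \<nu> - unit_midx p) (\<alpha> + \<beta>) (i + j) = ?\<kappa>" if "p \<in> keys \<mu>" for p
    using weyl_key_unit[OF that] by (simp add: \<kappa>1_def \<kappa>2_def)
  have key2: "weyl_key (\<mu> + \<nu> - unit_midx p) (\<alpha> + \<beta>) (i + j) = ?\<kappa>" if "p \<in> keys \<nu>" for p
    using weyl_key_unit[OF that, of \<mu> \<beta> \<alpha> j i] by (simp add: \<kappa>1_def \<kappa>2_def add.commute)
  have "S1 \<in> below ?\<kappa>" unfolding S1_def contraction_def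
    by (intro below_sum below_single_single) (simp add: key1)
  moreover have "S2 \<in> below ?\<kappa>" unfolding S2_eq
    by (intro below_sum below_single_single) (simp add: key2)
  ultimately show "B \<in> below ?\<kappa>"
    using r strictly_below_imp_below unfolding B by (blast intro: below_add below_diff)
  have l1: "line_monom \<xi> \<alpha> (\<mu> + \<nu> - unit_midx p) = line_monom \<xi> \<alpha> (\<mu> - unit_midx p) * line_monom \<xi> \<alpha> \<nu>"
    if "p \<in> keys \<mu>" for p
  proof -
    have "\<mu> + \<nu> - unit_midx p = \<mu> - unit_midx p + \<nu>"
      using that by (intro poly_mapping_eqI) (auto simp: lookup_add lookup_minus lookup_unit in_keys_iff)
    then show ?thesis by (simp add: line_monom_add)
  qed
  have l2: "line_monom \<xi> \<alpha> (\<mu> + \<nu> - unit_midx p) = line_monom \<xi> \<alpha> \<mu> * line_monom \<xi> \<alpha> (\<nu> - unit_midx p)"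
    if "p \<in> keys \<nu>" for p
  proof -
    have "\<mu> + \<nu> - unit_midx p = \<mu> + (\<nu> - unit_midx p)"
      using that by (intro poly_mapping_eqI) (auto simp: lookup_add lookup_minus lookup_unit in_keys_iff)
    then show ?thesis by (simp add: line_monom_add)
  qed
  have "lead ?\<kappa> B = lead ?\<kappa> S1 - lead ?\<kappa> S2"
    by (simp add: B lead_add lead_diff[of _ S1] lead_strictly_below[OF r])
  moreover have "mpoly_line (lead ?\<kappa> S1) \<xi> \<alpha> = mpoly_line_dir l (single \<mu> c) \<beta> \<xi> \<alpha> * mpoly_line (single \<nu> d) \<xi> \<alpha>"
    by (simp add: S1_def contraction_def lead_sum lead_single key1 mpoly_line_sum mpoly_line_dir_single[OF \<mu>] l1 sum_distrib_left smult_sum_right mult_ac)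
  moreover have "mpoly_line (lead ?\<kappa> S2) \<xi> \<alpha> = mpoly_line (single \<mu> c) \<xi> \<alpha> * pderiv (mpoly_line (single \<nu> d) \<xi> \<alpha>)"
    by (simp add: S2_eq lead_sum lead_single key2 mpoly_line_sum pderiv_smult pderiv_line_monom l2 smult_sum_right sum_distrib_left mult_ac)
  ultimately show "mpoly_line (lead ?\<kappa> B) \<xi> \<alpha> =
      mpoly_line_dir l (single \<mu> c) \<beta> \<xi> \<alpha> * mpoly_line (single \<nu> d) \<xi> \<alpha> -
      mpoly_line (single \<mu> c) \<xi> \<alpha> * pderiv (mpoly_line (single \<nu> d) \<xi> \<alpha>)"
    by (simp only: mpoly_line_diff)
qed

text \<open>Bilinear extension of the monomial case: a pair of monomials that do not both have the
  top key has its bracket strictly below the expected key and contributes nothing to the leading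
  part.\<close>

lemma lead_bracket:
  assumes "a \<in> below \<kappa>1" "b \<in> below \<kappa>2" "keys a \<subseteq> multi_indices l"
    and \<alpha>: "\<alpha> = fst (snd \<kappa>1)" and \<beta>: "\<beta> = fst (snd \<kappa>2)"
  shows "weyl_bracket a b \<in> below (\<kappa>1 + \<kappa>2 - (1, 0, 0)) \<and>
    mpoly_line (lead (\<kappa>1 + \<kappa>2 - (1, 0, 0)) (weyl_bracket a b)) \<xi> \<alpha> =
      mpoly_line_dir l (lead \<kappa>1 a) \<beta> \<xi> \<alpha> * mpoly_line (lead \<kappa>2 b) \<xi> \<alpha> -
      mpoly_line (lead \<kappa>1 a) \<xi> \<alpha> * pderiv (mpoly_line (lead \<kappa>2 b) \<xi> \<alpha>)"
proof (induction a rule: weyl_induct)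
  case (single \<mu> \<alpha>' i)
  let ?c = "lookup (lookup a \<mu>) (\<alpha>', i)"
  have "\<mu> \<in> keys a" using single by (auto simp: in_keys_iff)
  then have \<mu>: "keys \<mu> \<subseteq> {1..l}" using assms(3) unfolding multi_indices_def by blast
  have le1: "\<kappa>1 - weyl_key \<mu> \<alpha>' i \<in> insert 0 P" using assms(1) single unfolding below_def by blast
  show ?case
  proof (induction b rule: weyl_induct)
    case (single \<nu> \<beta>' j)
    let ?d = "lookup (lookup b \<nu>) (\<beta>', j)"
    have le2: "\<kappa>2 - weyl_key \<nu> \<beta>' j \<in> insert 0 P" using assms(2) single unfolding below_def by blast
    show ?case
    proof (cases "weyl_key \<mu> \<alpha>' i = \<kappa>1 \<and> weyl_key \<nu> \<beta>' j = \<kappa>2")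
      case True
      then have "\<alpha>' = \<alpha>" "\<beta>' = \<beta>" using \<alpha> \<beta> by (auto simp: weyl_key_def)
      then show ?thesis using weyl_bracket_single_single[OF \<mu>, where \<alpha> = \<alpha>' and i = i and c = ?c
            and \<nu> = \<nu> and \<beta> = \<beta>' and j = j and d = ?d] True
        by (simp add: lead_single)
    next
      case False
      let ?\<delta> = "(\<kappa>1 - weyl_key \<mu> \<alpha>' i) + (\<kappa>2 - weyl_key \<nu> \<beta>' j)"
      have "?\<delta> \<in> P"
      proof (cases "weyl_key \<mu> \<alpha>' i = \<kappa>1")
        case True
        then show ?thesis using False le2 by auto
      next
        case False
        then show ?thesis using le1 le2 by (intro add_P1) auto
      qed
      moreover have "\<kappa>1 + \<kappa>2 - (1, 0, 0) - (weyl_key \<mu> \<alpha>' i + weyl_key \<nu> \<beta>' j - (1, 0, 0)) = ?\<delta>"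
        by (simp add: algebra_simps)
      ultimately have s: "weyl_bracket (single \<mu> (single (\<alpha>', i) ?c)) (single \<nu> (single (\<beta>', j) ?d))
          \<in> strictly_below (\<kappa>1 + \<kappa>2 - (1, 0, 0))"
        using weyl_bracket_single_single(1)[OF \<mu>, where \<alpha> = \<alpha>' and i = i and c = ?c
            and \<nu> = \<nu> and \<beta> = \<beta>' and j = j and d = ?d] below_mono by metis
      show ?thesis
        using False strictly_below_imp_below[OF s] lead_strictly_below[OF s] by (auto simp: lead_single)
    qed
  qed (simp_all add: weyl_bracket_add_right lead_add mpoly_line_add below_add algebra_simps pderiv_add)
qed (simp_all add: weyl_bracket_add_left lead_add mpoly_line_add mpoly_line_dir_add below_add algebra_simps)

text \<open>Each step raises the key by \<open>\<kappa> - (1, 0, 0)\<close>, which is positive, so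
  the subtracted multiple of the previous vector lies strictly below. Thus the leading part depends
  on the number of scalars and not on their values.\<close>

lemma foldr_bracket_lead:
  fixes \<beta> \<xi> :: "'f vec"
  assumes w: "w \<in> below \<kappa>" "keys w \<subseteq> multi_indices l" and \<delta>: "\<kappa> - (1, 0, 0) \<in> P"
    and \<alpha>: "\<alpha> = fst (snd \<kappa>)"
  defines "v \<equiv> \<lambda>cs. foldr (shifted_ad w) cs (single 0 (x_monom \<beta> 0))"
    and "\<kappa>' \<equiv> \<lambda>n. weyl_key 0 \<beta> 0 + nmult n (\<kappa> - (1, 0, 0))"
  shows "v cs \<in> below (\<kappa>' (length cs)) \<and>
    mpoly_line (lead (\<kappa>' (length cs)) (v cs)) \<xi> \<alpha> =
      bracket_seq (mpoly_line_dir l (lead \<kappa> w) \<beta> \<xi> \<alpha>) (mpoly_line (lead \<kappa> w) \<xi> \<alpha>) (length cs)"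
proof (induction cs)
  case Nil
  show ?case
    by (simp add: v_def \<kappa>'_def x_monom_def lead_single below_single_single line_monom_def)
next
  case (Cons c cs)
  let ?n = "length cs"
  have \<kappa>'_Suc: "\<kappa>' (Suc ?n) = \<kappa> + \<kappa>' ?n - (1, 0, 0)" by (simp add: \<kappa>'_def algebra_simps)
  have fst_snd: "fst (snd (\<kappa>' ?n)) = \<beta> + nmult ?n \<alpha>"
    unfolding \<kappa>'_def \<alpha> nmult_prod[of ?n "\<kappa> - (1, 0, 0)"] nmult_prod[of ?n "snd (\<kappa> - (1, 0, 0))"]
    by (simp add: weyl_key_def)
  note br = lead_bracket[OF w(1) conjunct1[OF Cons.IH] w(2) \<alpha> fst_snd[symmetric], of \<xi>, folded \<kappa>'_Suc]
  have "\<kappa>' (Suc ?n) - \<kappa>' ?n \<in> P" using \<delta> by (simp add: \<kappa>'_def)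
  then have sc: "weyl_scale c (v cs) \<in> strictly_below (\<kappa>' (Suc ?n))"
    using below_mono below_scale Cons.IH by blast
  have c: "keys (lead \<kappa> w) \<subseteq> multi_indices l" using keys_lead w(2) by blast
  have v: "v (c # cs) = weyl_bracket w (v cs) - weyl_scale c (v cs)" by (simp add: v_def)
  show ?case
    unfolding v using br Cons.IH strictly_below_imp_below[OF sc] lead_strictly_below[OF sc]
    by (simp add: below_diff lead_diff mpoly_line_dir_nmult[OF c])
qed

end

text \<open>The offending term need not be the leading one; it only ensures that the maximal key
  exceeds (1, 0, 0). The direction alpha and the polynomial h are then taken from the maximal key,
  and beta from \<open>mpoly_line_dir_exists\<close>.\<close>

lemma not_locally_split:
  fixes w :: "'f::field_char_0 weyl"
  assumes \<Gamma>: "nondegenerate_subgroup (l1 + l2) \<Gamma>" and w: "w \<in> weyl_carrier l1 l2 \<Gamma>"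
    and nz: "lookup (lookup w \<mu>1) (\<alpha>1, i1) \<noteq> 0"
    and big: "mdeg \<mu>1 \<ge> 2 \<or> mdeg \<mu>1 = 1 \<and> (\<alpha>1 \<noteq> 0 \<or> i1 \<noteq> 0)"
  obtains \<beta> where "\<beta> \<in> \<Gamma>"
    "\<And>cs. foldr (shifted_ad w) cs (single 0 (x_monom \<beta> 0)) \<noteq> 0"
proof -
  note witness = that
  obtain P where P: "weyl_order P" "\<And>\<beta>. \<alpha>1 \<noteq> 0 \<Longrightarrow> (0, \<alpha>1, \<beta>) \<in> P" using weyl_order_exists by metis
  interpret weyl_order P by (rule P(1))
  define S where "S = (\<Union>\<mu>\<in>keys w. (\<lambda>k. weyl_key \<mu> (fst k) (snd k)) ` keys (lookup w \<mu>))"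
  have S: "weyl_key \<mu> \<alpha> i \<in> S" if "lookup (lookup w \<mu>) (\<alpha>, i) \<noteq> 0" for \<mu> \<alpha> i
    unfolding S_def by (rule UN_I[of \<mu>], use that in \<open>force simp: in_keys_iff\<close>)
      (rule image_eqI[of _ _ "(\<alpha>, i)"], use that in \<open>simp_all add: in_keys_iff\<close>)
  have "finite S" by (simp add: S_def)
  moreover have "S \<noteq> {}" using S[OF nz] by blast
  ultimately obtain \<kappa> where \<kappa>: "\<kappa> \<in> S" "\<And>x. x \<in> S \<Longrightarrow> \<kappa> - x \<in> insert 0 P"
    using finite_cone_maximal[OF cone] by blast
  obtain \<mu> \<alpha> i where \<mu>: "\<kappa> = weyl_key \<mu> \<alpha> i" "lookup (lookup w \<mu>) (\<alpha>, i) \<noteq> 0"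
    using \<kappa>(1) by (auto simp: S_def in_keys_iff)
  have wb: "w \<in> below \<kappa>" using S \<kappa>(2) by (simp add: below_def)
  \<comment> \<open>Three cases of \<open>big\<close>: positive order remains after subtracting 1;
    order 0 remains with \<open>\<alpha>1\<close> positive by the choice of \<open>P\<close>; or
    order and weight are 0 and the t-exponent is nonzero.\<close>
  have "weyl_key \<mu>1 \<alpha>1 i1 - (1, 0, 0) \<in> P"
  proof -
    have "weyl_key \<mu>1 \<alpha>1 i1 - (1, 0, 0) = (of_nat (mdeg \<mu>1 - 1), \<alpha>1, vec_of_midx i1)"
      using big by (auto simp: weyl_key_def of_nat_diff)
    then show ?thesis using big degree_pos[of "mdeg \<mu>1 - 1" \<alpha>1 "vec_of_midx i1"] P(2) midx_pos[of i1]
      by (cases "\<alpha>1 = 0") auto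
  qed
  then have "(weyl_key \<mu>1 \<alpha>1 i1 - (1, 0, 0)) + (\<kappa> - weyl_key \<mu>1 \<alpha>1 i1) \<in> P"
    using \<kappa>(2)[OF S[OF nz]] add_P1 by blast
  then have \<delta>: "\<kappa> - (1, 0, 0) \<in> P" by (simp add: algebra_simps)
  \<comment> \<open>A maximal key of order 0 would give \<open>\<kappa> - (1, 0, 0)\<close> order
    -1, contradicting positivity. Hence the leading polynomial is not constant.\<close>
  have "\<mu> \<noteq> 0"
  proof
    assume "\<mu> = 0"
    then have "\<kappa> - (1, 0, 0) + (1, - \<alpha>, - vec_of_midx i) = 0" by (simp add: \<mu>(1) weyl_key_def zero_prod_def)
    moreover have "(1, - \<alpha>, - vec_of_midx i) \<in> P" using degree_pos[of 1] by simp
    ultimately show False using add_P[OF \<delta>] zero_P by metis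
  qed
  let ?c = "lead \<kappa> w"
  have "\<mu> \<in> keys ?c" using \<mu> by (simp add: in_keys_iff lookup_lead)
  then have nc: "\<not> keys ?c \<subseteq> {0}" using \<open>\<mu> \<noteq> 0\<close> by blast
  have wl: "keys w \<subseteq> multi_indices (l1 + l2)" using w by (simp add: weyl_carrier_def)
  then have cl: "keys ?c \<subseteq> multi_indices (l1 + l2)" using keys_lead by blast
  have "lookup w \<mu> \<in> alg_carrier l1 \<Gamma>" using w by (simp add: weyl_carrier_def)
  then have "\<alpha> \<in> \<Gamma>" using \<mu>(2) by (auto simp: alg_carrier_def in_keys_iff)
  have "\<alpha> = fst (snd \<kappa>)" by (simp add: \<mu>(1) weyl_key_def)
  note lead = foldr_bracket_lead[OF wb wl \<delta> this]
  have concl: thesis if "\<beta> \<in> \<Gamma>" "\<And>n. bracket_seq (mpoly_line_dir (l1 + l2) ?c \<beta> \<xi> \<alpha>) (mpoly_line ?c \<xi> \<alpha>) n \<noteq> 0" for \<beta> \<xi>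
  proof (rule witness[OF \<open>\<beta> \<in> \<Gamma>\<close>])
    fix cs
    show "foldr (shifted_ad w) cs (single 0 (x_monom \<beta> 0)) \<noteq> 0"
    proof
      assume "foldr (shifted_ad w) cs (single 0 (x_monom \<beta> 0)) = 0"
      then show False using conjunct2[OF lead[of cs \<beta> \<xi>]] that(2)[of "length cs"] by simp
    qed
  qed
  from \<Gamma> cl nc \<open>\<alpha> \<in> \<Gamma>\<close> show thesis
  proof (cases rule: mpoly_line_dir_exists)
    case (1 \<beta> \<xi>)
    show thesis by (rule concl[of \<beta> \<xi>]) (use 1 bracket_seq_nonzero in simp_all)
  next
    case (2 \<beta> \<xi>)
    show thesis by (rule concl[of \<beta> \<xi>]) (use 2 bracket_seq_nonzero_const in simp_all)
  qed
qed

section \<open>Locally split elements\<close>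

text \<open>The vectors killed by a polynomial in ad w that splits into linear factors over F. Only
  brackets and scalars occur, so Lie isomorphisms preserve this set.\<close>

definition split_kernel :: "'f::field weyl \<Rightarrow> 'f weyl set" where
  "split_kernel w = {v. \<exists>cs. foldr (shifted_ad w) cs v = 0}"

lemma shifted_ad_add: "shifted_ad w c (u + v) = shifted_ad w c u + shifted_ad w c v"
  by (simp add: weyl_bracket_add_right weyl.scale_right_distrib)

lemma foldr_shifted_ad_add:
  "foldr (shifted_ad w) cs (u + v) = foldr (shifted_ad w) cs u + foldr (shifted_ad w) cs v"
  by (induction cs) (simp_all only: foldr.simps id_apply o_apply shifted_ad_add)

lemma foldr_shifted_ad_zero: "foldr (shifted_ad w) cs 0 = 0"
  by (induction cs) simp_all

lemma shifted_ad_commute: "shifted_ad w c (shifted_ad w d v) = shifted_ad w d (shifted_ad w c v)"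
  by (simp add: weyl_bracket_diff_right weyl_bracket_scale_right weyl.scale_right_diff_distrib mult.commute)

lemma foldr_shifted_ad_commute1:
  "shifted_ad w c (foldr (shifted_ad w) ds v) = foldr (shifted_ad w) ds (shifted_ad w c v)"
proof (induction ds)
  case (Cons d ds)
  show ?case
    by (simp only: foldr.simps o_apply shifted_ad_commute[where c = c and d = d] Cons.IH)
qed simp

lemma foldr_shifted_ad_commute:
  "foldr (shifted_ad w) cs (foldr (shifted_ad w) ds v) = foldr (shifted_ad w) ds (foldr (shifted_ad w) cs v)"
proof (induction cs)
  case (Cons c cs)
  show ?case
    by (simp only: foldr.simps o_apply Cons.IH foldr_shifted_ad_commute1)
qed simp

lemma split_kernel_zero: "0 \<in> split_kernel w"
  unfolding split_kernel_def by (auto intro: exI[of _ "[]"])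

text \<open>The factors commute, so the concatenation of two annihilating products kills both
  summands.\<close>

lemma split_kernel_add:
  assumes "u \<in> split_kernel w" "v \<in> split_kernel w"
  shows "u + v \<in> split_kernel w"
proof -
  obtain cs ds where cs: "foldr (shifted_ad w) cs u = 0" and ds: "foldr (shifted_ad w) ds v = 0"
    using assms by (auto simp: split_kernel_def)
  have "foldr (shifted_ad w) (cs @ ds) (u + v) =
      foldr (shifted_ad w) ds (foldr (shifted_ad w) cs u) + foldr (shifted_ad w) cs (foldr (shifted_ad w) ds v)"
    by (simp only: foldr_append foldr_shifted_ad_add foldr_shifted_ad_commute[of w cs ds u])
  then have "foldr (shifted_ad w) (cs @ ds) (u + v) = 0" by (simp only: cs ds foldr_shifted_ad_zero add_0)
  then show ?thesis unfolding split_kernel_def by blast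
qed

lemma split_kernel_step:
  assumes "shifted_ad w c v \<in> split_kernel w"
  shows "v \<in> split_kernel w"
proof -
  obtain cs where "foldr (shifted_ad w) cs (shifted_ad w c v) = 0"
    using assms by (auto simp: split_kernel_def)
  \<comment> \<open>\<open>foldr\<close> applies the last entry first, so \<open>c\<close> is
    appended at the end.\<close>
  then have "foldr (shifted_ad w) (cs @ [c]) v = 0" by simp
  then show ?thesis unfolding split_kernel_def by blast
qed

definition locally_split :: "'f::field weyl set \<Rightarrow> 'f weyl set" where
  "locally_split W = {w \<in> W. W \<subseteq> split_kernel w}"

lemma split_kernel_sum: "(\<And>s. s \<in> S \<Longrightarrow> f s \<in> split_kernel w) \<Longrightarrow> sum f S \<in> split_kernel w"
  by (induction S rule: infinite_finite_induct) (auto simp: split_kernel_zero split_kernel_add)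

section \<open>The space D, its coordinates and its action on A\<close>

lemma D_coeff_add: "D_coeff (a + b) p = D_coeff a p + D_coeff b p"
  by (simp add: D_coeff_def lookup_add)

lemma D_coeff_scale: "D_coeff (weyl_scale c a) p = c * D_coeff a p"
  by (simp add: D_coeff_def)

lemma D_coeff_zero [simp]: "D_coeff 0 p = 0"
  by (simp add: D_coeff_def)

lemma D_coeff_partial: "D_coeff (partial_elem q) p = (if p = q then 1 else 0)"
  by (simp add: D_coeff_def partial_elem_def x_monom_def lookup_single when_def zero_prod_def)

lemma partial_span_expansion:
  fixes d :: "'f::field weyl"
  assumes "finite I" "d \<in> weyl.span (partial_elem ` I)"
  shows "d = (\<Sum>p\<in>I. weyl_scale (D_coeff d p) (partial_elem p))"
proof -
  let ?V = "{d :: 'f weyl. d = (\<Sum>p\<in>I. weyl_scale (D_coeff d p) (partial_elem p))}"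
  have "weyl.span (partial_elem ` I) \<subseteq> ?V"
  proof (rule weyl.span_minimal)
    show "partial_elem ` I \<subseteq> ?V"
    proof clarify
      fix q assume q: "q \<in> I"
      have "(\<Sum>p\<in>I. weyl_scale (D_coeff (partial_elem q) p) (partial_elem p)) =
          (\<Sum>p\<in>I. if p = q then partial_elem q else 0)"
        by (rule sum.cong) (auto simp: D_coeff_partial)
      also have "\<dots> = partial_elem q" using q assms(1) by simp
      finally show "partial_elem q = (\<Sum>p\<in>I. weyl_scale (D_coeff (partial_elem q) p) (partial_elem p))" ..
    qed
    show "weyl.subspace ?V"
    proof (rule weyl.subspaceI)
      fix x y assume "x \<in> ?V" "y \<in> ?V"
      then show "x + y \<in> ?V"
        by (simp add: D_coeff_add weyl.scale_left_distrib sum.distrib)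
    next
      fix c x assume "x \<in> ?V"
      then have x: "(\<Sum>p\<in>I. weyl_scale (D_coeff x p) (partial_elem p)) = x" by simp
      have "(\<Sum>p\<in>I. weyl_scale (D_coeff (weyl_scale c x) p) (partial_elem p)) =
          weyl_scale c (\<Sum>p\<in>I. weyl_scale (D_coeff x p) (partial_elem p))"
        by (simp add: D_coeff_scale weyl.scale_sum_right)
      then show "weyl_scale c x \<in> ?V" by (simp only: x mem_Collect_eq)
    qed simp
  qed
  then show ?thesis using assms(2) by blast
qed

lemma D_space_expansion: "d \<in> D_space l1 l2 \<Longrightarrow> d = (\<Sum>p=1..l1 + l2. weyl_scale (D_coeff d p) (partial_elem p))"
  unfolding D_space_def by (rule partial_span_expansion) simp_all

lemma partial_in_D_space: "p \<in> {1..l1 + l2} \<Longrightarrow> partial_elem p \<in> D_space l1 l2"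
  unfolding D_space_def by (rule weyl.span_base) blast

lemma sum_partial_in_D_space: "(\<Sum>p=1..l1 + l2. weyl_scale (a p) (partial_elem p)) \<in> D_space l1 l2"
  unfolding D_space_def by (intro weyl.span_sum weyl.span_scale weyl.span_base) blast

lemma D_space_add: "d \<in> D_space l1 l2 \<Longrightarrow> d' \<in> D_space l1 l2 \<Longrightarrow> d + d' \<in> D_space l1 l2"
  and D_space_scale: "d \<in> D_space l1 l2 \<Longrightarrow> weyl_scale c d \<in> D_space l1 l2"
  and D_space_zero: "0 \<in> D_space l1 l2"
  by (auto simp: D_space_def weyl.span_add weyl.span_scale weyl.span_zero)

lemma D2_space_iff:
  "d \<in> D2_space l1 l2 \<longleftrightarrow> d \<in> D_space l1 l2 \<and> (\<forall>p\<in>{1..l1}. D_coeff d p = 0)"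
proof
  assume d: "d \<in> D2_space l1 l2"
  have "partial_elem ` {l1 + 1..l1 + l2} \<subseteq> partial_elem ` {1..l1 + l2}" by auto
  then have "d \<in> D_space l1 l2"
    using d weyl.span_mono unfolding D_space_def D2_space_def by blast
  moreover have "D_coeff d p = 0" if p: "p \<in> {1..l1}" for p
  proof -
    have "weyl.span (partial_elem ` {l1 + 1..l1 + l2}) \<subseteq> {d. D_coeff d p = 0}"
      by (intro weyl.span_minimal weyl.subspaceI)
        (use p in \<open>auto simp: D_coeff_add D_coeff_scale D_coeff_partial\<close>)
    then show ?thesis using d by (auto simp: D2_space_def)
  qed
  ultimately show "d \<in> D_space l1 l2 \<and> (\<forall>p\<in>{1..l1}. D_coeff d p = 0)" by blast
next
  assume d: "d \<in> D_space l1 l2 \<and> (\<forall>p\<in>{1..l1}. D_coeff d p = 0)"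
  then have "d = (\<Sum>p=1..l1 + l2. weyl_scale (D_coeff d p) (partial_elem p))"
    using D_space_expansion by blast
  also have "\<dots> = (\<Sum>p=l1 + 1..l1 + l2. weyl_scale (D_coeff d p) (partial_elem p))"
    by (rule sum.mono_neutral_right) (use d in auto)
  also have "\<dots> \<in> D2_space l1 l2"
    unfolding D2_space_def by (intro weyl.span_sum weyl.span_scale weyl.span_base) blast
  finally show "d \<in> D2_space l1 l2" .
qed

definition D_act :: "nat \<Rightarrow> 'f::field weyl \<Rightarrow> 'f alg \<Rightarrow> 'f alg" where
  "D_act l d u = (\<Sum>p=1..l. pm_scale (D_coeff d p) (alg_deriv p u))"

text \<open>Elements of D commute with all powers of the derivations, so ad d differentiates the
  coefficient only.\<close>

lemma weyl_bracket_D: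
  assumes "d \<in> D_space l1 l2"
  shows "weyl_bracket d (single \<nu> v) = single \<nu> (D_act (l1 + l2) d v)"
proof -
  have "weyl_bracket (\<Sum>p=1..l1 + l2. weyl_scale (D_coeff d p) (partial_elem p)) (single \<nu> v) =
      single \<nu> (D_act (l1 + l2) d v)"
    by (simp add: weyl_bracket_sum_left weyl_bracket_scale_left weyl_bracket_partial D_act_def single_sum)
  then show ?thesis by (simp only: D_space_expansion[OF assms, symmetric])
qed

lemma D_act_single:
  "D_act l d (single (\<alpha>, i) c) = pm_scale (pairing l \<alpha> d) (single (\<alpha>, i) c) +
    (\<Sum>p=1..l. single (\<alpha>, i - unit_midx p) (D_coeff d p * (c * of_nat (lookup i p))))"
  by (simp add: D_act_def alg_deriv_single pm.scale_right_distrib sum.distrib pairing_def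
      sum_distrib_left single_sum mult_ac)

text \<open>The term without derivatives cancels because A is commutative, and every other term has
  lost at least one derivation.\<close>

lemma bracket_alg_lowers:
  assumes "\<nu> \<in> keys (weyl_bracket (single 0 u) (single \<mu> v))"
  shows "mdeg \<nu> < mdeg \<mu>"
proof -
  have "weyl_mult (single \<mu> v) (single 0 u) = single \<mu> (v * u) +
      (\<Sum>\<rho>\<in>lower_midx \<mu> - {0}. single (\<mu> - \<rho>) (pm_scale (of_nat (multi_binomial \<mu> \<rho>)) (v * alg_deriv_pow \<rho> u)))"
    unfolding weyl_mult_single weyl_mult_monom_def
    by (subst sum.remove[of _ 0]) (simp_all add: finite_lower_midx)
  then have "weyl_bracket (single 0 u) (single \<mu> v) =
      - (\<Sum>\<rho>\<in>lower_midx \<mu> - {0}. single (\<mu> - \<rho>) (pm_scale (of_nat (multi_binomial \<mu> \<rho>)) (v * alg_deriv_pow \<rho> u)))"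
    by (simp add: weyl_bracket_def weyl_mult_single[of 0] weyl_mult_monom_def mult.commute)
  then have "\<nu> \<in> keys (\<Sum>\<rho>\<in>lower_midx \<mu> - {0}. single (\<mu> - \<rho>) (pm_scale (of_nat (multi_binomial \<mu> \<rho>)) (v * alg_deriv_pow \<rho> u)))"
    using assms by (simp add: in_keys_iff)
  then obtain \<rho> where \<rho>: "\<rho> \<in> lower_midx \<mu> - {0}" and
    "\<nu> \<in> keys (single (\<mu> - \<rho>) (pm_scale (of_nat (multi_binomial \<mu> \<rho>)) (v * alg_deriv_pow \<rho> u)))"
    by (rule UN_E[OF subsetD[OF keys_sum]])
  then have "\<nu> = \<mu> - \<rho>" by (auto split: if_splits)
  then have "\<nu> + \<rho> = \<mu>" using lower_midx_minus_add[of \<rho> \<mu> 0] \<rho> by simp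
  then have "mdeg \<nu> + mdeg \<rho> = mdeg \<mu>" by (metis mdeg_add)
  moreover have "mdeg \<rho> \<noteq> 0" using \<rho> by simp
  ultimately show ?thesis by linarith
qed

lemma alg_D_locally_split:
  assumes d: "d \<in> D_space l1 l2" and w: "w = single 0 u + d"
  shows "v \<in> split_kernel w"
proof -
  \<comment> \<open>Bracketing with \<open>u\<close> changes weight and t-exponent without control
    but lowers the order; the outer hypothesis must therefore hold for all \<open>\<alpha>\<close>
    and \<open>i\<close>, while the inner induction on the t-degree keeps \<open>\<mu>\<close> and
    \<open>\<alpha>\<close> fixed.\<close>
  have monom: "single \<mu> (single (\<alpha>, i) c) \<in> split_kernel w" for \<mu> \<alpha> i c
  proof (induction "mdeg \<mu>" arbitrary: \<mu> \<alpha> i c rule: less_induct)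
    case outer: less
    show ?case
    proof (induction "mdeg i" arbitrary: i c rule: less_induct)
      case inner: less
      have b1: "weyl_bracket (single 0 u) (single \<mu> (single (\<alpha>, i) c)) \<in> split_kernel w" (is "?b \<in> _")
      proof (rule weyl_induct[where w = ?b])
        fix \<nu> \<beta> j assume "lookup (lookup ?b \<nu>) (\<beta>, j) \<noteq> 0"
        then have "\<nu> \<in> keys ?b" by (auto simp: in_keys_iff)
        then show "single \<nu> (single (\<beta>, j) (lookup (lookup ?b \<nu>) (\<beta>, j))) \<in> split_kernel w"
          using bracket_alg_lowers outer by blast
      qed (simp_all add: split_kernel_zero split_kernel_add)
      have b2: "(\<Sum>p=1..l1 + l2. single \<mu> (single (\<alpha>, i - unit_midx p) (D_coeff d p * (c * of_nat (lookup i p))))) \<in> split_kernel w"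
      proof (rule split_kernel_sum)
        fix p
        show "single \<mu> (single (\<alpha>, i - unit_midx p) (D_coeff d p * (c * of_nat (lookup i p)))) \<in> split_kernel w"
        proof (cases "lookup i p = 0")
          case False
          then show ?thesis using mdeg_minus_unit[of i p] by (intro inner) simp
        qed (simp add: split_kernel_zero)
      qed
      \<comment> \<open>The scalar is the eigenvalue of d on x^alpha; subtracting it removes the
        only term that is not lower in one of the two inductions.\<close>
      have b3: "shifted_ad w (pairing (l1 + l2) \<alpha> d) (single \<mu> (single (\<alpha>, i) c)) = ?b +
        (\<Sum>p=1..l1 + l2. single \<mu> (single (\<alpha>, i - unit_midx p) (D_coeff d p * (c * of_nat (lookup i p)))))"
        by (simp add: w weyl_bracket_add_left weyl_bracket_D[OF d] D_act_single single_add single_sum)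
      show ?case
        by (rule split_kernel_step[where c = "pairing (l1 + l2) \<alpha> d"], unfold b3) (rule split_kernel_add[OF b1 b2])
    qed
  qed
  show ?thesis
    by (induction v rule: weyl_induct) (simp_all add: monom split_kernel_zero split_kernel_add)
qed

section \<open>The subspaces A and A + D, and closure of the carrier sets\<close>

definition alg_part :: "nat \<Rightarrow> 'f::field vec set \<Rightarrow> 'f weyl set" where
  "alg_part l1 \<Gamma> = single 0 ` alg_carrier l1 \<Gamma>"

definition alg_D_part :: "nat \<Rightarrow> nat \<Rightarrow> 'f::field vec set \<Rightarrow> 'f weyl set" where
  "alg_D_part l1 l2 \<Gamma> = {single 0 u + d | u d. u \<in> alg_carrier l1 \<Gamma> \<and> d \<in> D_space l1 l2}"

lemma alg_carrier_zero: "0 \<in> alg_carrier l1 \<Gamma>"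
  by (simp add: alg_carrier_def)

lemma alg_carrier_add: "u \<in> alg_carrier l1 \<Gamma> \<Longrightarrow> v \<in> alg_carrier l1 \<Gamma> \<Longrightarrow> u + v \<in> alg_carrier l1 \<Gamma>"
  using Poly_Mapping.keys_add[of u v] by (auto simp: alg_carrier_def)

lemma alg_carrier_scale: "u \<in> alg_carrier l1 \<Gamma> \<Longrightarrow> pm_scale c u \<in> alg_carrier l1 \<Gamma>"
  by (auto simp: alg_carrier_def in_keys_iff)

lemma alg_carrier_sum: "(\<And>s. s \<in> S \<Longrightarrow> f s \<in> alg_carrier l1 \<Gamma>) \<Longrightarrow> sum f S \<in> alg_carrier l1 \<Gamma>"
  by (induction S rule: infinite_finite_induct) (auto simp: alg_carrier_zero alg_carrier_add)

lemma alg_carrier_single: "\<alpha> \<in> \<Gamma> \<Longrightarrow> i \<in> multi_indices l1 \<Longrightarrow> single (\<alpha>, i) c \<in> alg_carrier l1 \<Gamma>"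
  by (simp add: alg_carrier_def)

lemma multi_indices_zero [simp]: "0 \<in> multi_indices l"
  by (simp add: multi_indices_def)

lemma multi_indices_add: "i \<in> multi_indices l \<Longrightarrow> j \<in> multi_indices l \<Longrightarrow> i + j \<in> multi_indices l"
  by (simp add: multi_indices_def keys_add_midx)

lemma multi_indices_minus: "i \<in> multi_indices l \<Longrightarrow> i - j \<in> multi_indices l"
  using keys_minus_midx[of i j] unfolding multi_indices_def by blast

lemma multi_indices_unit: "p \<in> {1..l} \<Longrightarrow> unit_midx p \<in> multi_indices l"
  by (simp add: multi_indices_def)

lemma alg_carrier_deriv: "u \<in> alg_carrier l1 \<Gamma> \<Longrightarrow> alg_deriv p u \<in> alg_carrier l1 \<Gamma>"
  unfolding alg_deriv_def alg_deriv_monom_eq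
  by (intro alg_carrier_sum, clarify, intro alg_carrier_scale alg_carrier_add alg_carrier_single)
    (auto simp: alg_carrier_def intro: multi_indices_minus)

lemma alg_carrier_D_act: "u \<in> alg_carrier l1 \<Gamma> \<Longrightarrow> D_act l d u \<in> alg_carrier l1 \<Gamma>"
  unfolding D_act_def by (intro alg_carrier_sum alg_carrier_scale alg_carrier_deriv)

lemma weyl_carrier_zero: "0 \<in> weyl_carrier l1 l2 \<Gamma>"
  by (simp add: weyl_carrier_def alg_carrier_zero)

lemma weyl_carrier_add: "a \<in> weyl_carrier l1 l2 \<Gamma> \<Longrightarrow> b \<in> weyl_carrier l1 l2 \<Gamma> \<Longrightarrow> a + b \<in> weyl_carrier l1 l2 \<Gamma>"
  using Poly_Mapping.keys_add[of a b] by (auto simp: weyl_carrier_def lookup_add alg_carrier_add)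

lemma weyl_carrier_scale: "a \<in> weyl_carrier l1 l2 \<Gamma> \<Longrightarrow> weyl_scale c a \<in> weyl_carrier l1 l2 \<Gamma>"
  by (auto simp: weyl_carrier_def alg_carrier_scale in_keys_iff)

lemma weyl_carrier_minus: "a \<in> weyl_carrier l1 l2 \<Gamma> \<Longrightarrow> - a \<in> weyl_carrier l1 l2 \<Gamma>"
  using weyl_carrier_scale[of a l1 l2 \<Gamma> "- 1"] by simp

lemma weyl_carrier_diff: "a \<in> weyl_carrier l1 l2 \<Gamma> \<Longrightarrow> b \<in> weyl_carrier l1 l2 \<Gamma> \<Longrightarrow> a - b \<in> weyl_carrier l1 l2 \<Gamma>"
  using weyl_carrier_add[of a l1 l2 \<Gamma> "- b"] by (simp add: weyl_carrier_minus)

lemma weyl_carrier_sum: "(\<And>s. s \<in> S \<Longrightarrow> f s \<in> weyl_carrier l1 l2 \<Gamma>) \<Longrightarrow> sum f S \<in> weyl_carrier l1 l2 \<Gamma>"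
  by (induction S rule: infinite_finite_induct) (auto simp: weyl_carrier_zero weyl_carrier_add)

lemma weyl_carrier_single: "\<mu> \<in> multi_indices (l1 + l2) \<Longrightarrow> u \<in> alg_carrier l1 \<Gamma> \<Longrightarrow> single \<mu> u \<in> weyl_carrier l1 l2 \<Gamma>"
  by (auto simp: weyl_carrier_def lookup_single when_def alg_carrier_zero)

lemma alg_carrier_mult:
  assumes \<Gamma>: "nondegenerate_subgroup l \<Gamma>" and uv: "u \<in> alg_carrier l1 \<Gamma>" "v \<in> alg_carrier l1 \<Gamma>"
  shows "u * v \<in> alg_carrier l1 \<Gamma>"
  unfolding alg_carrier_def
proof (rule CollectI, rule subsetI)
  fix k assume "k \<in> keys (u * v)"
  then obtain a b where k: "k = a + b" "a \<in> keys u" "b \<in> keys v" using keys_mult by blast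
  have "a \<in> \<Gamma> \<times> multi_indices l1" "b \<in> \<Gamma> \<times> multi_indices l1"
    using k uv unfolding alg_carrier_def by blast+
  then show "k \<in> \<Gamma> \<times> multi_indices l1"
    using k(1) \<Gamma> by (cases a, cases b) (auto simp: nondegenerate_subgroup_def multi_indices_add)
qed

lemma alg_carrier_deriv_pow: "u \<in> alg_carrier l1 \<Gamma> \<Longrightarrow> alg_deriv_pow \<rho> u \<in> alg_carrier l1 \<Gamma>"
  by (rule alg_deriv_pow_induct) (simp_all add: alg_carrier_deriv)

lemma weyl_carrier_mult:
  assumes \<Gamma>: "nondegenerate_subgroup l \<Gamma>" and ab: "a \<in> weyl_carrier l1 l2 \<Gamma>" "b \<in> weyl_carrier l1 l2 \<Gamma>"
  shows "weyl_mult a b \<in> weyl_carrier l1 l2 \<Gamma>"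
  unfolding weyl_mult_def weyl_mult_monom_def
  by (intro weyl_carrier_sum weyl_carrier_single alg_carrier_scale alg_carrier_mult[OF \<Gamma>]
      alg_carrier_deriv_pow multi_indices_minus multi_indices_add)
    (use ab in \<open>auto simp: weyl_carrier_def\<close>)

lemma weyl_carrier_bracket:
  assumes "nondegenerate_subgroup l \<Gamma>" "a \<in> weyl_carrier l1 l2 \<Gamma>" "b \<in> weyl_carrier l1 l2 \<Gamma>"
  shows "weyl_bracket a b \<in> weyl_carrier l1 l2 \<Gamma>"
  unfolding weyl_bracket_def by (intro weyl_carrier_diff weyl_carrier_mult[OF assms(1)] assms(2,3))

lemma one_in_alg_carrier:
  assumes "nondegenerate_subgroup l \<Gamma>"
  shows "1 \<in> alg_carrier l1 \<Gamma>"
  using alg_carrier_single[of 0 \<Gamma> 0 l1 1] assms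
  by (simp add: nondegenerate_subgroup_def flip: zero_prod_def)

lemma D_space_subset_weyl_carrier:
  assumes "nondegenerate_subgroup l \<Gamma>"
  shows "D_space l1 l2 \<subseteq> weyl_carrier l1 l2 \<Gamma>"
  unfolding D_space_def
proof (rule weyl.span_minimal)
  show "partial_elem ` {1..l1 + l2} \<subseteq> weyl_carrier l1 l2 \<Gamma>"
    unfolding partial_elem_def x_monom_zero
    using one_in_alg_carrier[OF assms] by (auto intro!: weyl_carrier_single multi_indices_unit)
  show "weyl.subspace (weyl_carrier l1 l2 \<Gamma>)"
    by (intro weyl.subspaceI weyl_carrier_zero weyl_carrier_add weyl_carrier_scale)
qed

lemma alg_part_subset: "alg_part l1 \<Gamma> \<subseteq> alg_D_part l1 l2 \<Gamma>"
  unfolding alg_part_def alg_D_part_def using D_space_zero by force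

lemma D_space_subset_alg_D_part: "D_space l1 l2 \<subseteq> alg_D_part l1 l2 \<Gamma>"
  unfolding alg_D_part_def using alg_carrier_zero by force

lemma alg_D_part_subset_weyl:
  assumes "nondegenerate_subgroup l \<Gamma>"
  shows "alg_D_part l1 l2 \<Gamma> \<subseteq> weyl_carrier l1 l2 \<Gamma>"
  using D_space_subset_weyl_carrier[OF assms, of l1 l2] unfolding alg_D_part_def
  by (auto intro!: weyl_carrier_add weyl_carrier_single)

lemma locally_split_weyl_carrier:
  fixes \<Gamma> :: "'f::field_char_0 vec set"
  assumes \<Gamma>: "nondegenerate_subgroup (l1 + l2) \<Gamma>"
  shows "locally_split (weyl_carrier l1 l2 \<Gamma>) = alg_D_part l1 l2 \<Gamma>"
proof (intro equalityI subsetI)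
  fix w assume "w \<in> alg_D_part l1 l2 \<Gamma>"
  then show "w \<in> locally_split (weyl_carrier l1 l2 \<Gamma>)"
    using alg_D_part_subset_weyl[OF \<Gamma>] alg_D_locally_split
    unfolding locally_split_def alg_D_part_def by blast
next
  fix w assume "w \<in> locally_split (weyl_carrier l1 l2 \<Gamma>)"
  then have w: "w \<in> weyl_carrier l1 l2 \<Gamma>" and split: "weyl_carrier l1 l2 \<Gamma> \<subseteq> split_kernel w"
    by (auto simp: locally_split_def)
  have small: "\<not> (mdeg \<mu> \<ge> 2 \<or> mdeg \<mu> = 1 \<and> (\<alpha> \<noteq> 0 \<or> i \<noteq> 0))"
    if nz: "lookup (lookup w \<mu>) (\<alpha>, i) \<noteq> 0" for \<mu> \<alpha> i
  proof
    assume "mdeg \<mu> \<ge> 2 \<or> mdeg \<mu> = 1 \<and> (\<alpha> \<noteq> 0 \<or> i \<noteq> 0)"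
    from not_locally_split[OF \<Gamma> w nz this] obtain \<beta> where \<beta>: "\<beta> \<in> \<Gamma>"
      "\<And>cs. foldr (shifted_ad w) cs (single 0 (x_monom \<beta> 0)) \<noteq> 0"
      by blast
    have "single 0 (x_monom \<beta> 0) \<in> weyl_carrier l1 l2 \<Gamma>"
      unfolding x_monom_def by (intro weyl_carrier_single alg_carrier_single) (simp_all add: \<beta>)
    then show False using split \<beta>(2) by (auto simp: split_kernel_def)
  qed
  \<comment> \<open>The only possible component in D, read off from the constant parts of the
    first-order coefficients; that \<open>w\<close> is its order 0 part plus \<open>d\<close> is
    then checked coefficient by coefficient.\<close>
  define d where "d = (\<Sum>p=1..l1 + l2. weyl_scale (D_coeff w p) (partial_elem p))"
  have "lookup (lookup w \<mu>) (\<alpha>, i) = lookup (lookup (single 0 (lookup w 0) + d) \<mu>) (\<alpha>, i)" for \<mu> \<alpha> i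
  proof -
    have d: "lookup (lookup d \<mu>) (\<alpha>, i) =
        (\<Sum>p=1..l1 + l2. if \<mu> = unit_midx p \<and> \<alpha> = 0 \<and> i = 0 then D_coeff w p else 0)"
      unfolding d_def lookup_sum
      by (rule sum.cong) (auto simp: partial_elem_def x_monom_def lookup_single when_def)
    consider "\<mu> = 0" | p where "\<mu> = unit_midx p" | "mdeg \<mu> \<ge> 2"
      by (metis mdeg_eq_0_iff mdeg_eq_1 less_2_cases not_less One_nat_def)
    then show ?thesis
    proof cases
      case 1
      then show ?thesis using d by (simp add: lookup_add)
    next
      case (2 p)
      have p: "p \<in> {1..l1 + l2}" if "lookup (lookup w \<mu>) (\<alpha>, i) \<noteq> 0"
      proof -
        have "\<mu> \<in> keys w" using that by (auto simp: in_keys_iff)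
        then have "\<mu> \<in> multi_indices (l1 + l2)" using w by (auto simp: weyl_carrier_def)
        then show ?thesis by (simp add: 2 multi_indices_def)
      qed
      have s: "(\<Sum>q=1..l1 + l2. if \<mu> = unit_midx q \<and> \<alpha> = 0 \<and> i = 0 then D_coeff w q else 0) =
          (if p \<in> {1..l1 + l2} \<and> \<alpha> = 0 \<and> i = 0 then D_coeff w p else 0)"
        by (cases "\<alpha> = 0 \<and> i = 0") (auto simp: 2)
      have "lookup (lookup d \<mu>) (\<alpha>, i) = (if p \<in> {1..l1 + l2} \<and> \<alpha> = 0 \<and> i = 0 then D_coeff w p else 0)"
        by (simp only: d s)
      then show ?thesis
        using p small[of \<mu> \<alpha> i] by (auto simp: lookup_add lookup_single when_def 2 D_coeff_def)
    next
      case 3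
      then have "\<mu> \<noteq> 0" "\<And>p. \<mu> \<noteq> unit_midx p" by auto
      then show ?thesis using 3 small[of \<mu> \<alpha> i] by (auto simp: lookup_add d lookup_single when_def)
    qed
  qed
  then have "w = single 0 (lookup w 0) + d"
    by (intro poly_mapping_eqI) auto
  moreover have "d \<in> D_space l1 l2" unfolding d_def by (rule sum_partial_in_D_space)
  moreover have "lookup w 0 \<in> alg_carrier l1 \<Gamma>" using w by (simp add: weyl_carrier_def)
  ultimately show "w \<in> alg_D_part l1 l2 \<Gamma>" unfolding alg_D_part_def by blast
qed

section \<open>Invariants of Lie isomorphisms\<close>

lemma D_space_lookup_0:
  assumes "d \<in> D_space l1 l2"
  shows "lookup d 0 = 0"
proof -
  have "weyl.span (partial_elem ` {1..l1 + l2}) \<subseteq> {d. lookup d 0 = 0}"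
    by (intro weyl.span_minimal weyl.subspaceI)
      (auto simp: partial_elem_def lookup_add lookup_single when_def)
  then show ?thesis using assms by (auto simp: D_space_def)
qed

text \<open>An element of A maps A + D into A, which it centralizes. Conversely, for w = u + d the
  square of ad w multiplies x^beta by the square of the pairing of beta with d, so d pairs to 0 with
  all of \<open>\<Gamma>\<close> and is 0.\<close>

lemma alg_part_iff:
  fixes \<Gamma> :: "'f::field_char_0 vec set"
  assumes \<Gamma>: "nondegenerate_subgroup (l1 + l2) \<Gamma>" and w: "w \<in> alg_D_part l1 l2 \<Gamma>"
  shows "w \<in> alg_part l1 \<Gamma> \<longleftrightarrow> (\<forall>v\<in>alg_D_part l1 l2 \<Gamma>. weyl_bracket w (weyl_bracket w v) = 0)"
proof
  assume "w \<in> alg_part l1 \<Gamma>"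
  then obtain u where u: "w = single 0 u" by (auto simp: alg_part_def)
  show "\<forall>v\<in>alg_D_part l1 l2 \<Gamma>. weyl_bracket w (weyl_bracket w v) = 0"
  proof
    fix v assume "v \<in> alg_D_part l1 l2 \<Gamma>"
    then obtain u' d where v: "v = single 0 u' + d" "d \<in> D_space l1 l2" by (auto simp: alg_D_part_def)
    have "weyl_bracket w v = - single 0 (D_act (l1 + l2) d u)"
      using weyl_bracket_anticommute[of w d] weyl_bracket_D[OF v(2), of 0 u]
      by (simp add: u v(1) weyl_bracket_add_right weyl_bracket_alg)
    then show "weyl_bracket w (weyl_bracket w v) = 0"
      by (simp add: u weyl_bracket_minus_right weyl_bracket_alg)
  qed
next
  assume nil: "\<forall>v\<in>alg_D_part l1 l2 \<Gamma>. weyl_bracket w (weyl_bracket w v) = 0"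
  obtain u d where u: "w = single 0 u + d" "u \<in> alg_carrier l1 \<Gamma>" and d: "d \<in> D_space l1 l2"
    using w by (auto simp: alg_D_part_def)
  have "D_coeff d p = 0" if p: "p \<in> {1..l1 + l2}" for p
  proof (rule nondegenerate_separates[OF \<Gamma> _ p])
    fix \<beta> assume "\<beta> \<in> \<Gamma>"
    then have "single 0 (x_monom \<beta> 0) \<in> alg_part l1 \<Gamma>"
      unfolding alg_part_def x_monom_def by (intro imageI alg_carrier_single) simp_all
    then have "weyl_bracket w (weyl_bracket w (single 0 (x_monom \<beta> 0))) = 0"
      using nil alg_part_subset by blast
    moreover have "weyl_bracket w (single 0 (pm_scale c (x_monom \<beta> 0))) =
        single 0 (pm_scale (c * pairing (l1 + l2) \<beta> d) (x_monom \<beta> 0))" for c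
      by (simp add: u(1) weyl_bracket_add_left weyl_bracket_alg weyl_bracket_D[OF d] x_monom_def D_act_single mult_ac)
    from this[of 1] this[of "pairing (l1 + l2) \<beta> d"]
    have "weyl_bracket w (weyl_bracket w (single 0 (x_monom \<beta> 0))) =
        single 0 (pm_scale (pairing (l1 + l2) \<beta> d * pairing (l1 + l2) \<beta> d) (x_monom \<beta> 0))"
      by simp
    ultimately have "pairing (l1 + l2) \<beta> d = 0" by (simp add: x_monom_def)
    then show "(\<Sum>p=1..l1 + l2. lookup \<beta> p * D_coeff d p) = 0" by (simp add: pairing_def mult.commute)
  qed
  then have "d = 0" using D_space_expansion[OF d] by simp
  then show "w \<in> alg_part l1 \<Gamma>" using u by (simp add: alg_part_def)
qed

section \<open>Weights and D_2 in terms of the action of D on A\<close>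

lemma lookup_alg_deriv:
  "lookup (alg_deriv p u) (\<alpha>, i) = lookup \<alpha> p * lookup u (\<alpha>, i) +
    of_nat (Suc (lookup i p)) * lookup u (\<alpha>, i + unit_midx p)"
proof (rule additive_eqI[where f = "\<lambda>u. lookup (alg_deriv p u) (\<alpha>, i)" and
      g = "\<lambda>u. lookup \<alpha> p * lookup u (\<alpha>, i) + of_nat (Suc (lookup i p)) * lookup u (\<alpha>, i + unit_midx p)"])
  fix k :: "'a vec \<times> midx" and c
  obtain \<beta> j where k: "k = (\<beta>, j)" by (cases k)
  show "lookup (alg_deriv p (single k c)) (\<alpha>, i) = lookup \<alpha> p * lookup (single k c) (\<alpha>, i) +
    of_nat (Suc (lookup i p)) * lookup (single k c) (\<alpha>, i + unit_midx p)"
  proof (cases "lookup j p = 0")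
    case True
    then have "j \<noteq> i + unit_midx p" by (auto simp: lookup_add lookup_unit)
    then show ?thesis using True by (auto simp: k alg_deriv_single lookup_add lookup_single when_def)
  next
    case False
    then have "j - unit_midx p = i \<longleftrightarrow> j = i + unit_midx p"
      using midx_minus_unit_add[of j p] by auto
    then show ?thesis
      by (auto simp: k alg_deriv_single lookup_add lookup_single lookup_unit when_def)
  qed
qed (simp_all add: alg_deriv_add lookup_add algebra_simps)

lemma lookup_D_act:
  "lookup (D_act l d u) (\<alpha>, i) = pairing l \<alpha> d * lookup u (\<alpha>, i) +
    (\<Sum>p=1..l. D_coeff d p * (of_nat (Suc (lookup i p)) * lookup u (\<alpha>, i + unit_midx p)))"
  by (simp add: D_act_def lookup_sum lookup_alg_deriv pairing_def sum_distrib_right ring_distribs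
      sum.distrib mult.assoc del: of_nat_Suc)

text \<open>At a monomial of maximal t-degree in the support of \<open>e\<close>, nothing arrives
  from lowering t-exponents, so the coefficient there is just multiplied by the pairing. This
  monomial is chosen independently of \<open>d\<close>, so one weight serves for all of
  \<open>V\<close>.\<close>

lemma D_act_eigenvector:
  assumes "e \<in> alg_carrier l1 \<Gamma>" "e \<noteq> 0" "\<And>d. d \<in> V \<Longrightarrow> D_act l d e = pm_scale (f d) e"
  obtains \<alpha> where "\<alpha> \<in> \<Gamma>" "\<And>d. d \<in> V \<Longrightarrow> pairing l \<alpha> d = f d"
proof -
  have "keys e \<noteq> {}"
    using assms(2) by (metis keys_zero poly_mapping_eq_sum_single sum.empty)
  moreover have "finite ((\<lambda>k. mdeg (snd k)) ` keys e)" by simp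
  ultimately obtain k where k: "k \<in> keys e" "\<And>k'. k' \<in> keys e \<Longrightarrow> mdeg (snd k') \<le> mdeg (snd k)"
    using Max_in[of "(\<lambda>k. mdeg (snd k)) ` keys e"] Max_ge[of "(\<lambda>k. mdeg (snd k)) ` keys e"]
    by (smt (verit, best) image_iff image_is_empty)
  obtain \<alpha> i where ki: "k = (\<alpha>, i)" by (cases k)
  have "lookup e (\<alpha>, i + unit_midx p) = 0" for p
    using k(2)[of "(\<alpha>, i + unit_midx p)"] by (auto simp: ki in_keys_iff)
  then have "pairing l \<alpha> d * lookup e k = f d * lookup e k" if "d \<in> V" for d
    using lookup_D_act[of l d e \<alpha> i] assms(3)[OF that] by (auto simp: ki)
  then have "pairing l \<alpha> d = f d" if "d \<in> V" for d using that k(1) by (simp add: in_keys_iff)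
  moreover have "\<alpha> \<in> \<Gamma>" using k(1) assms(1) by (auto simp: ki alg_carrier_def)
  ultimately show ?thesis using that by blast
qed

text \<open>Elements of D_2 act diagonally on monomials, since no variable t_p with p > l1 occurs in
  A; a diagonal operator has the same kernel as its square. If d has a nonzero coefficient at some p
  <= l1, then t_p goes to a nonzero constant and then to 0.\<close>

lemma D2_space_iff_D_act:
  assumes \<Gamma>: "nondegenerate_subgroup (l1 + l2) \<Gamma>" and d: "d \<in> D_space l1 l2"
  shows "d \<in> D2_space l1 l2 \<longleftrightarrow>
    (\<forall>u\<in>alg_carrier l1 \<Gamma>. D_act (l1 + l2) d (D_act (l1 + l2) d u) = 0 \<longrightarrow> D_act (l1 + l2) d u = 0)"
proof
  assume "d \<in> D2_space l1 l2"
  then have d2: "D_coeff d p = 0" if "p \<in> {1..l1}" for p using that by (simp add: D2_space_iff)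
  have diag: "lookup (D_act (l1 + l2) d u) (\<alpha>, i) = pairing (l1 + l2) \<alpha> d * lookup u (\<alpha>, i)"
    if u: "u \<in> alg_carrier l1 \<Gamma>" for u \<alpha> i
  proof -
    have "D_coeff d p * (of_nat (Suc (lookup i p)) * lookup u (\<alpha>, i + unit_midx p)) = 0"
      if p: "p \<in> {1..l1 + l2}" for p
    proof (cases "p \<le> l1")
      case False
      have "(\<alpha>, i + unit_midx p) \<notin> keys u"
      proof
        assume "(\<alpha>, i + unit_midx p) \<in> keys u"
        then have "i + unit_midx p \<in> multi_indices l1" using u by (auto simp: alg_carrier_def)
        then show False using False by (simp add: multi_indices_def keys_add_midx)
      qed
      then show ?thesis by (simp add: in_keys_iff)
    qed (use d2 p in auto)
    then have "(\<Sum>p=1..l1 + l2. D_coeff d p * (of_nat (Suc (lookup i p)) * lookup u (\<alpha>, i + unit_midx p))) = 0"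
      by (intro sum.neutral) blast
    then show ?thesis by (simp only: lookup_D_act add.right_neutral)
  qed
  show "\<forall>u\<in>alg_carrier l1 \<Gamma>. D_act (l1 + l2) d (D_act (l1 + l2) d u) = 0 \<longrightarrow> D_act (l1 + l2) d u = 0"
  proof (intro ballI impI)
    fix u assume u: "u \<in> alg_carrier l1 \<Gamma>" and nil: "D_act (l1 + l2) d (D_act (l1 + l2) d u) = 0"
    show "D_act (l1 + l2) d u = 0"
    proof (rule poly_mapping_eqI)
      fix k
      show "lookup (D_act (l1 + l2) d u) k = lookup 0 k"
        using arg_cong[OF nil, of "\<lambda>v. lookup v k"] u alg_carrier_D_act[OF u]
        by (cases k) (simp add: diag)
    qed
  qed
next
  assume *: "\<forall>u\<in>alg_carrier l1 \<Gamma>. D_act (l1 + l2) d (D_act (l1 + l2) d u) = 0 \<longrightarrow> D_act (l1 + l2) d u = 0"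
  have "D_coeff d p = 0" if p: "p \<in> {1..l1}" for p
  proof -
    let ?u = "single (0, unit_midx p) 1"
    have "?u \<in> alg_carrier l1 \<Gamma>"
      using \<Gamma> p by (intro alg_carrier_single multi_indices_unit) (auto simp: nondegenerate_subgroup_def)
    moreover have pair0: "pairing (l1 + l2) 0 d = 0" by (simp add: pairing_def)
    have act: "D_act (l1 + l2) d ?u = single (0, 0) (D_coeff d p)"
    proof -
      have "D_act (l1 + l2) d ?u = (\<Sum>q=1..l1 + l2. if q = p then single (0, 0) (D_coeff d p) else 0)"
        unfolding D_act_single pair0 pm.scale_zero_left add_0
        by (rule sum.cong) (auto simp: lookup_unit)
      then show ?thesis using p by simp
    qed
    moreover have "D_act (l1 + l2) d (single (0, 0) (D_coeff d p)) = 0"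
      by (simp add: D_act_single pair0)
    ultimately show ?thesis using * by (metis single_eq_0_iff)
  qed
  then show "d \<in> D2_space l1 l2" using d by (simp add: D2_space_iff)
qed

lemma pairing_add: "pairing l (\<alpha> + \<beta>) d = pairing l \<alpha> d + pairing l \<beta> d"
  by (simp add: pairing_def lookup_add algebra_simps sum.distrib)

lemma pairing_partial: "p \<in> {1..l} \<Longrightarrow> pairing l \<alpha> (partial_elem p) = lookup \<alpha> p"
proof -
  assume p: "p \<in> {1..l}"
  have "pairing l \<alpha> (partial_elem p) = (\<Sum>q=1..l. if q = p then lookup \<alpha> p else 0)"
    unfolding pairing_def by (rule sum.cong) (auto simp: D_coeff_partial)
  then show ?thesis using p by simp
qed

lemma pairing_injective:
  assumes "nondegenerate_subgroup (l1 + l2) \<Gamma>" "\<alpha> \<in> \<Gamma>" "\<beta> \<in> \<Gamma>"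
    and "\<And>d. d \<in> D_space l1 l2 \<Longrightarrow> pairing (l1 + l2) \<alpha> d = pairing (l1 + l2) \<beta> d"
  shows "\<alpha> = \<beta>"
proof (rule poly_mapping_eqI)
  fix p
  have supp: "keys \<alpha> \<subseteq> {1..l1 + l2}" "keys \<beta> \<subseteq> {1..l1 + l2}"
    using assms(1-3) unfolding nondegenerate_subgroup_def coord_space_def by blast+
  show "lookup \<alpha> p = lookup \<beta> p"
  proof (cases "p \<in> {1..l1 + l2}")
    case True
    then show ?thesis
      using assms(4)[OF partial_in_D_space[OF True]] by (simp only: pairing_partial[OF True])
  next
    case False
    then have "p \<notin> keys \<alpha>" "p \<notin> keys \<beta>" using supp by blast+
    then show ?thesis by (simp add: in_keys_iff)
  qed
qed

text \<open>The inverse map is a parameter so that the assumptions become symmetric, and each result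
  for \<open>\<sigma>\<close> also holds for \<open>\<sigma>'\<close>.\<close>

locale weyl_lie_iso =
  fixes l1 l2 l1' l2' :: nat and \<Gamma> \<Gamma>' :: "'f::field_char_0 vec set" and \<sigma> \<sigma>' :: "'f weyl \<Rightarrow> 'f weyl"
  assumes \<Gamma>: "nondegenerate_subgroup (l1 + l2) \<Gamma>" and \<Gamma>': "nondegenerate_subgroup (l1' + l2') \<Gamma>'"
    and in_W': "a \<in> weyl_carrier l1 l2 \<Gamma> \<Longrightarrow> \<sigma> a \<in> weyl_carrier l1' l2' \<Gamma>'"
    and in_W: "b \<in> weyl_carrier l1' l2' \<Gamma>' \<Longrightarrow> \<sigma>' b \<in> weyl_carrier l1 l2 \<Gamma>"
    and left_inverse: "a \<in> weyl_carrier l1 l2 \<Gamma> \<Longrightarrow> \<sigma>' (\<sigma> a) = a"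
    and right_inverse: "b \<in> weyl_carrier l1' l2' \<Gamma>' \<Longrightarrow> \<sigma> (\<sigma>' b) = b"
    and add: "a \<in> weyl_carrier l1 l2 \<Gamma> \<Longrightarrow> b \<in> weyl_carrier l1 l2 \<Gamma> \<Longrightarrow> \<sigma> (a + b) = \<sigma> a + \<sigma> b"
    and scale: "a \<in> weyl_carrier l1 l2 \<Gamma> \<Longrightarrow> \<sigma> (weyl_scale c a) = weyl_scale c (\<sigma> a)"
    and bracket: "a \<in> weyl_carrier l1 l2 \<Gamma> \<Longrightarrow> b \<in> weyl_carrier l1 l2 \<Gamma> \<Longrightarrow>
      \<sigma> (weyl_bracket a b) = weyl_bracket (\<sigma> a) (\<sigma> b)"
begin

abbreviation W where "W \<equiv> weyl_carrier l1 l2 \<Gamma>"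
abbreviation W' where "W' \<equiv> weyl_carrier l1' l2' \<Gamma>'"
abbreviation A where "A \<equiv> alg_carrier l1 \<Gamma>"
abbreviation A' where "A' \<equiv> alg_carrier l1' \<Gamma>'"
abbreviation D where "D \<equiv> D_space l1 l2 :: 'f weyl set"
abbreviation D' where "D' \<equiv> D_space l1' l2' :: 'f weyl set"

lemma inverse: "weyl_lie_iso l1' l2' l1 l2 \<Gamma>' \<Gamma> \<sigma>' \<sigma>"
proof
  fix a b assume ab: "a \<in> W'" "b \<in> W'"
  show "\<sigma>' (a + b) = \<sigma>' a + \<sigma>' b"
    using left_inverse[OF weyl_carrier_add[OF in_W[OF ab(1)] in_W[OF ab(2)]]] ab
    by (simp add: add in_W right_inverse)
  show "\<sigma>' (weyl_bracket a b) = weyl_bracket (\<sigma>' a) (\<sigma>' b)"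
    using left_inverse[OF weyl_carrier_bracket[OF \<Gamma> in_W[OF ab(1)] in_W[OF ab(2)]]] ab
    by (simp add: bracket in_W right_inverse)
next
  fix a c assume a: "a \<in> W'"
  show "\<sigma>' (weyl_scale c a) = weyl_scale c (\<sigma>' a)"
    using left_inverse[OF weyl_carrier_scale[OF in_W[OF a]]] a
    by (simp add: scale in_W right_inverse)
qed (use \<Gamma> \<Gamma>' in_W in_W' left_inverse right_inverse in auto)

lemma zero: "\<sigma> 0 = 0"
  using add[OF weyl_carrier_zero weyl_carrier_zero] by simp

lemma diff:
  assumes "a \<in> W" "b \<in> W"
  shows "\<sigma> (a - b) = \<sigma> a - \<sigma> b"
  using add[OF weyl_carrier_diff[OF assms] assms(2)] by simp

lemma split_kernel_image:
  assumes w: "w \<in> W" and v: "v \<in> W" "v \<in> split_kernel w"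
  shows "\<sigma> v \<in> split_kernel (\<sigma> w)"
proof -
  obtain cs where cs: "foldr (shifted_ad w) cs v = 0" using v(2) by (auto simp: split_kernel_def)
  have "foldr (shifted_ad w) cs v \<in> W \<and>
      \<sigma> (foldr (shifted_ad w) cs v) = foldr (shifted_ad (\<sigma> w)) cs (\<sigma> v)" for cs
    by (induction cs)
      (simp_all add: w v(1) weyl_carrier_diff weyl_carrier_bracket[OF \<Gamma>] weyl_carrier_scale diff bracket scale)
  then have "foldr (shifted_ad (\<sigma> w)) cs (\<sigma> v) = 0" using cs zero by metis
  then show ?thesis unfolding split_kernel_def by blast
qed

lemma alg_D_part_image:
  assumes "w \<in> alg_D_part l1 l2 \<Gamma>"
  shows "\<sigma> w \<in> alg_D_part l1' l2' \<Gamma>'"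
proof -
  have w: "w \<in> W" "W \<subseteq> split_kernel w"
    using assms unfolding locally_split_weyl_carrier[OF \<Gamma>, symmetric] by (auto simp: locally_split_def)
  have "v \<in> split_kernel (\<sigma> w)" if v: "v \<in> W'" for v
    using split_kernel_image[OF w(1) in_W[OF v]] w(2) in_W[OF v] right_inverse[OF v] by auto
  then have "\<sigma> w \<in> locally_split W'"
    using in_W'[OF w(1)] by (auto simp: locally_split_def)
  then show ?thesis by (simp add: locally_split_weyl_carrier[OF \<Gamma>'])
qed

lemma alg_part_image:
  assumes "w \<in> alg_part l1 \<Gamma>"
  shows "\<sigma> w \<in> alg_part l1' \<Gamma>'"
proof -
  \<comment> \<open>Applied to the inverse, \<open>alg_D_part_image\<close> shows that every element
    of A' + D' is the image of an element of A + D.\<close>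
  interpret inv: weyl_lie_iso l1' l2' l1 l2 \<Gamma>' \<Gamma> \<sigma>' \<sigma> by (rule inverse)
  have w: "w \<in> alg_D_part l1 l2 \<Gamma>" using assms alg_part_subset by blast
  have wW: "w \<in> W" using w alg_D_part_subset_weyl[OF \<Gamma>] by blast
  have "weyl_bracket (\<sigma> w) (weyl_bracket (\<sigma> w) v) = 0" if v: "v \<in> alg_D_part l1' l2' \<Gamma>'" for v
  proof -
    have v': "\<sigma>' v \<in> alg_D_part l1 l2 \<Gamma>" using v by (rule inv.alg_D_part_image)
    then have vW: "\<sigma>' v \<in> W" using alg_D_part_subset_weyl[OF \<Gamma>] by blast
    have "v \<in> W'" using v alg_D_part_subset_weyl[OF \<Gamma>'] by blast
    then have "weyl_bracket (\<sigma> w) (weyl_bracket (\<sigma> w) v) = \<sigma> (weyl_bracket w (weyl_bracket w (\<sigma>' v)))"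
      using wW vW by (simp add: bracket weyl_carrier_bracket[OF \<Gamma>] right_inverse)
    also have "\<dots> = 0" using alg_part_iff[OF \<Gamma> w] assms v' zero by simp
    finally show ?thesis .
  qed
  then show ?thesis using alg_part_iff[OF \<Gamma>' alg_D_part_image[OF w]] by blast
qed

definition A_map :: "'f alg \<Rightarrow> 'f alg" where
  "A_map u = lookup (\<sigma> (single 0 u)) 0"

text \<open>\<open>\<sigma> d\<close> may have a component in A'. Removing it amounts to the induced
  map (A + D)/A -> (A' + D')/A', with D and D' as representatives.\<close>

definition D_map :: "'f weyl \<Rightarrow> 'f weyl" where
  "D_map d = \<sigma> d - single 0 (lookup (\<sigma> d) 0)"

lemma A_map:
  assumes "u \<in> A"
  shows "\<sigma> (single 0 u) = single 0 (A_map u)" "A_map u \<in> A'"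
proof -
  have "single 0 u \<in> alg_part l1 \<Gamma>" using assms by (simp add: alg_part_def)
  from alg_part_image[OF this] show "\<sigma> (single 0 u) = single 0 (A_map u)" "A_map u \<in> A'"
    by (auto simp: alg_part_def A_map_def)
qed

lemma D_map:
  assumes "d \<in> D"
  shows "\<sigma> d = single 0 (lookup (\<sigma> d) 0) + D_map d" "D_map d \<in> D'"
    "lookup (\<sigma> d) 0 \<in> A'"
proof -
  have "\<sigma> d \<in> alg_D_part l1' l2' \<Gamma>'" using alg_D_part_image D_space_subset_alg_D_part assms by blast
  then obtain u' d' where "\<sigma> d = single 0 u' + d'" "u' \<in> A'" "d' \<in> D'"
    by (auto simp: alg_D_part_def)
  moreover from this have "lookup (\<sigma> d) 0 = u'" by (simp add: lookup_add D_space_lookup_0)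
  ultimately show "\<sigma> d = single 0 (lookup (\<sigma> d) 0) + D_map d" "D_map d \<in> D'"
      "lookup (\<sigma> d) 0 \<in> A'"
    by (simp_all add: D_map_def)
qed

lemma single_in_W: "u \<in> A \<Longrightarrow> single 0 u \<in> W"
  by (intro weyl_carrier_single) simp_all

lemma D_in_W: "d \<in> D \<Longrightarrow> d \<in> W"
  using D_space_subset_weyl_carrier[OF \<Gamma>] by blast

text \<open>The component of \<open>\<sigma> d\<close> in A' commutes with A', so only
  \<open>D_map d\<close> contributes to the bracket.\<close>

lemma A_map_D_act:
  assumes u: "u \<in> A" and d: "d \<in> D"
  shows "A_map (D_act (l1 + l2) d u) = D_act (l1' + l2') (D_map d) (A_map u)"
proof -
  have "single 0 (A_map (D_act (l1 + l2) d u)) = \<sigma> (weyl_bracket d (single 0 u))"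
    using A_map(1)[OF alg_carrier_D_act[OF u]] by (simp add: weyl_bracket_D[OF d])
  also have "\<dots> = weyl_bracket (\<sigma> d) (single 0 (A_map u))"
    by (simp add: bracket[OF D_in_W[OF d] single_in_W[OF u]] A_map(1)[OF u])
  also have "\<dots> = single 0 (D_act (l1' + l2') (D_map d) (A_map u))"
    by (subst D_map(1)[OF d])
      (simp add: weyl_bracket_add_left weyl_bracket_alg weyl_bracket_D[OF D_map(2)[OF d]])
  finally show ?thesis by simp
qed

lemma A_map_scale: "u \<in> A \<Longrightarrow> A_map (pm_scale c u) = pm_scale c (A_map u)"
  using scale[OF single_in_W, of u c] by (simp add: A_map_def)

lemma A_map_zero: "A_map 0 = 0"
  by (simp add: A_map_def zero)

lemma D_map_add: "d \<in> D \<Longrightarrow> d' \<in> D \<Longrightarrow> D_map (d + d') = D_map d + D_map d'"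
  by (simp add: D_map_def add D_in_W lookup_add single_add)

lemma D_map_scale: "d \<in> D \<Longrightarrow> D_map (weyl_scale c d) = weyl_scale c (D_map d)"
  by (simp add: D_map_def scale D_in_W weyl.scale_right_diff_distrib)

end

text \<open>Provides the induced maps of the inverse, such as \<open>inv.A_map\<close> and
  \<open>inv.D_map\<close>, next to those of \<open>\<sigma>\<close>.\<close>

locale weyl_lie_iso_pair = weyl_lie_iso l1 l2 l1' l2' \<Gamma> \<Gamma>' \<sigma> \<sigma>' +
  inv: weyl_lie_iso l1' l2' l1 l2 \<Gamma>' \<Gamma> \<sigma>' \<sigma>
  for l1 l2 l1' l2' :: nat and \<Gamma> \<Gamma>' :: "'f::field_char_0 vec set" and \<sigma> \<sigma>' :: "'f weyl \<Rightarrow> 'f weyl"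

lemma (in weyl_lie_iso) pair: "weyl_lie_iso_pair l1 l2 l1' l2' \<Gamma> \<Gamma>' \<sigma> \<sigma>'"
  by (intro weyl_lie_iso_pair.intro weyl_lie_iso_axioms inverse)

context weyl_lie_iso_pair
begin

lemma inv_A_map:
  assumes "u \<in> A"
  shows "inv.A_map (A_map u) = u"
  using inv.A_map(1)[OF A_map(2)[OF assms]] A_map(1)[OF assms] left_inverse[OF single_in_W[OF assms]]
  by simp

text \<open>The correction subtracted in \<open>D_map d\<close> lies in A', is sent by
  \<open>\<sigma>'\<close> into A, and disappears under the second projection.\<close>

lemma inv_D_map:
  assumes d: "d \<in> D"
  shows "inv.D_map (D_map d) = d"
proof -
  let ?u = "lookup (\<sigma> d) 0"
  have "D_map d = \<sigma> d - single 0 ?u" by (simp add: D_map_def)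
  then have "\<sigma>' (D_map d) = d - single 0 (inv.A_map ?u)"
    using inv.diff[OF in_W'[OF D_in_W[OF d]] inv.single_in_W[OF D_map(3)[OF d]]]
      left_inverse[OF D_in_W[OF d]] inv.A_map(1)[OF D_map(3)[OF d]] by simp
  then show ?thesis
    by (simp add: inv.D_map_def lookup_minus D_space_lookup_0[OF d] single_diff single_uminus)
qed

lemma inv_pair: "weyl_lie_iso_pair l1' l2' l1 l2 \<Gamma>' \<Gamma> \<sigma>' \<sigma>"
  by (rule inv.pair)

lemma D_map_inv: "d \<in> D' \<Longrightarrow> D_map (inv.D_map d) = d"
  using weyl_lie_iso_pair.inv_D_map[OF inv_pair] .

lemma A_map_inv: "u \<in> A' \<Longrightarrow> A_map (inv.A_map u) = u"
  using weyl_lie_iso_pair.inv_A_map[OF inv_pair] .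

lemma D_map_linear_iso: "linear_iso D D' D_map"
proof -
  have "bij_betw D_map D D'"
    by (rule bij_betw_byWitness[where f' = inv.D_map])
      (auto simp: inv_D_map D_map_inv D_map inv.D_map)
  then show ?thesis by (simp add: linear_iso_def D_map_add D_map_scale)
qed

text \<open>The image of x^alpha under \<open>A_map\<close> need not be a monomial, but it is a
  joint eigenvector of D', which forces its eigenvalues to come from an element of
  \<open>\<Gamma>'\<close>.\<close>

lemma weight_exists:
  assumes \<alpha>: "\<alpha> \<in> \<Gamma>"
  obtains \<alpha>' where "\<alpha>' \<in> \<Gamma>'" "\<And>d. d \<in> D \<Longrightarrow> pairing (l1' + l2') \<alpha>' (D_map d) = pairing (l1 + l2) \<alpha> d"
proof -
  let ?u = "single (\<alpha>, 0) 1"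
  have u: "?u \<in> A" using \<alpha> by (simp add: alg_carrier_single)
  have "A_map ?u \<noteq> 0"
    using inv_A_map[OF u] inv.A_map_zero by (metis single_eq_0_iff zero_neq_one)
  moreover have "D_act (l1' + l2') d' (A_map ?u) = pm_scale (pairing (l1 + l2) \<alpha> (inv.D_map d')) (A_map ?u)"
    if d': "d' \<in> D'" for d'
  proof -
    have "D_act (l1' + l2') d' (A_map ?u) = A_map (D_act (l1 + l2) (inv.D_map d') ?u)"
      using A_map_D_act[OF u inv.D_map(2)[OF d']] by (simp add: D_map_inv[OF d'])
    also have "\<dots> = A_map (pm_scale (pairing (l1 + l2) \<alpha> (inv.D_map d')) ?u)"
      by (simp add: D_act_single)
    finally show ?thesis by (simp only: A_map_scale[OF u])
  qed
  ultimately obtain \<alpha>' where "\<alpha>' \<in> \<Gamma>'"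
    "\<And>d'. d' \<in> D' \<Longrightarrow> pairing (l1' + l2') \<alpha>' d' = pairing (l1 + l2) \<alpha> (inv.D_map d')"
    using D_act_eigenvector[OF A_map(2)[OF u], of "D'" "l1' + l2'"
        "\<lambda>d'. pairing (l1 + l2) \<alpha> (inv.D_map d')"] by blast
  then show ?thesis using that D_map(2) inv_D_map by metis
qed

definition weight_map :: "'f vec \<Rightarrow> 'f vec" where
  "weight_map \<alpha> = (SOME \<alpha>'. \<alpha>' \<in> \<Gamma>' \<and>
    (\<forall>d\<in>D. pairing (l1' + l2') \<alpha>' (D_map d) = pairing (l1 + l2) \<alpha> d))"

lemma weight_map:
  assumes "\<alpha> \<in> \<Gamma>"
  shows "weight_map \<alpha> \<in> \<Gamma>'"
    "\<And>d. d \<in> D \<Longrightarrow> pairing (l1' + l2') (weight_map \<alpha>) (D_map d) = pairing (l1 + l2) \<alpha> d"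
proof -
  have "\<exists>\<alpha>'. \<alpha>' \<in> \<Gamma>' \<and> (\<forall>d\<in>D. pairing (l1' + l2') \<alpha>' (D_map d) = pairing (l1 + l2) \<alpha> d)"
    using weight_exists[OF assms] by metis
  from someI_ex[OF this] show "weight_map \<alpha> \<in> \<Gamma>'"
    "\<And>d. d \<in> D \<Longrightarrow> pairing (l1' + l2') (weight_map \<alpha>) (D_map d) = pairing (l1 + l2) \<alpha> d"
    unfolding weight_map_def by auto
qed

lemma weight_map_unique:
  assumes "\<alpha> \<in> \<Gamma>" "\<beta> \<in> \<Gamma>'"
    and "\<And>d. d \<in> D \<Longrightarrow> pairing (l1' + l2') \<beta> (D_map d) = pairing (l1 + l2) \<alpha> d"
  shows "weight_map \<alpha> = \<beta>"
proof (rule pairing_injective[OF \<Gamma>' weight_map(1)[OF assms(1)] assms(2)])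
  fix d' :: "'f weyl" assume d': "d' \<in> D'"
  note d = inv.D_map(2)[OF d']
  show "pairing (l1' + l2') (weight_map \<alpha>) d' = pairing (l1' + l2') \<beta> d'"
    using weight_map(2)[OF assms(1) d] assms(3)[OF d] by (simp add: D_map_inv[OF d'])
qed

text \<open>A weight is determined by its pairings, so additivity of the pairing makes the map
  additive; products in A are not involved. Surjectivity uses weights for the inverse
  isomorphism.\<close>

lemma weight_map_group_iso: "group_iso \<Gamma> \<Gamma>' weight_map"
  unfolding group_iso_def
proof (intro conjI ballI)
  fix \<alpha> \<beta> assume ab: "\<alpha> \<in> \<Gamma>" "\<beta> \<in> \<Gamma>"
  then have "\<alpha> + \<beta> \<in> \<Gamma>" "weight_map \<alpha> + weight_map \<beta> \<in> \<Gamma>'"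
    using \<Gamma> \<Gamma>' weight_map(1) by (auto simp: nondegenerate_subgroup_def)
  then show "weight_map (\<alpha> + \<beta>) = weight_map \<alpha> + weight_map \<beta>"
    by (rule weight_map_unique) (simp add: pairing_add weight_map ab)
next
  show "bij_betw weight_map \<Gamma> \<Gamma>'"
    unfolding bij_betw_def
  proof (intro conjI inj_onI equalityI subsetI)
    fix \<alpha> \<beta> assume ab: "\<alpha> \<in> \<Gamma>" "\<beta> \<in> \<Gamma>" "weight_map \<alpha> = weight_map \<beta>"
    show "\<alpha> = \<beta>"
      by (rule pairing_injective[OF \<Gamma> ab(1,2)]) (use weight_map(2) ab in metis)
  next
    fix \<beta> assume "\<beta> \<in> weight_map ` \<Gamma>"
    then show "\<beta> \<in> \<Gamma>'" using weight_map(1) by blast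
  next
    fix \<beta> assume \<beta>: "\<beta> \<in> \<Gamma>'"
    obtain \<alpha> where \<alpha>: "\<alpha> \<in> \<Gamma>"
      "\<And>d. d \<in> D' \<Longrightarrow> pairing (l1 + l2) \<alpha> (inv.D_map d) = pairing (l1' + l2') \<beta> d"
      using weyl_lie_iso_pair.weight_exists[OF inv_pair \<beta>] by metis
    have "weight_map \<alpha> = \<beta>"
      by (rule weight_map_unique[OF \<alpha>(1) \<beta>]) (use \<alpha>(2) D_map(2) inv_D_map in metis)
    then show "\<beta> \<in> weight_map ` \<Gamma>" using \<alpha>(1) by blast
  qed
qed

text \<open>The kernel condition describing D_2 is transported by \<open>A_map\<close>, which
  intertwines the two actions and is invertible.\<close>

lemma D_map_D2:
  assumes d: "d \<in> D2_space l1 l2"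
  shows "D_map d \<in> D2_space l1' l2'"
proof -
  have dD: "d \<in> D" using d by (simp add: D2_space_iff)
  have "D_act (l1' + l2') (D_map d) u' = 0"
    if u': "u' \<in> A'" and nil: "D_act (l1' + l2') (D_map d) (D_act (l1' + l2') (D_map d) u') = 0" for u'
  proof -
    let ?u = "inv.A_map u'"
    have u: "?u \<in> A" using u' by (rule inv.A_map(2))
    have act: "D_act (l1' + l2') (D_map d) u' = A_map (D_act (l1 + l2) d ?u)"
      using A_map_D_act[OF u dD] by (simp add: A_map_inv[OF u'])
    then have "A_map (D_act (l1 + l2) d (D_act (l1 + l2) d ?u)) = 0"
      using A_map_D_act[OF alg_carrier_D_act[OF u] dD] nil by simp
    then have "D_act (l1 + l2) d (D_act (l1 + l2) d ?u) = 0"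
      using inv_A_map[OF alg_carrier_D_act[OF alg_carrier_D_act[OF u]]] inv.A_map_zero by metis
    then have "D_act (l1 + l2) d ?u = 0" using D2_space_iff_D_act[OF \<Gamma> dD] d u by blast
    then show ?thesis by (simp add: act A_map_zero)
  qed
  then show ?thesis using D2_space_iff_D_act[OF \<Gamma>' D_map(2)[OF dD]] by blast
qed

lemma D_map_image_D2: "D_map ` D2_space l1 l2 = D2_space l1' l2'"
proof (intro equalityI subsetI)
  fix d' :: "'f weyl" assume d': "d' \<in> D2_space l1' l2'"
  then have "d' = D_map (inv.D_map d')" using D_map_inv by (simp add: D2_space_iff)
  moreover have "inv.D_map d' \<in> D2_space l1 l2"
    using weyl_lie_iso_pair.D_map_D2[OF inv_pair d'] .
  ultimately show "d' \<in> D_map ` D2_space l1 l2" by blast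
qed (use D_map_D2 in blast)

end

text \<open>An injective linear map sends the \<open>partial_elem p\<close> to independent vectors
  inside a span of \<open>card I'\<close> generators. Arbitrary index sets let one statement serve
  both D and D_2.\<close>

lemma partial_span_card_le:
  fixes f :: "'f::field weyl \<Rightarrow> 'f weyl"
  assumes "finite I" "finite I'" "inj_on f (weyl.span (partial_elem ` I))"
    and add: "\<And>a b. a \<in> weyl.span (partial_elem ` I) \<Longrightarrow> b \<in> weyl.span (partial_elem ` I) \<Longrightarrow> f (a + b) = f a + f b"
    and scale: "\<And>c a. a \<in> weyl.span (partial_elem ` I) \<Longrightarrow> f (weyl_scale c a) = weyl_scale c (f a)"
    and image: "f ` weyl.span (partial_elem ` I) \<subseteq> weyl.span (partial_elem ` I')"
  shows "card I \<le> card I'"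
proof -
  let ?V = "weyl.span (partial_elem ` I) :: 'f weyl set"
  have base: "partial_elem p \<in> ?V" if "p \<in> I" for p using that by (intro weyl.span_base) simp
  have f0: "f 0 = 0" using add[of 0 0] by (simp add: weyl.span_zero)
  have sum: "(\<Sum>p\<in>J. weyl_scale (a p) (partial_elem p)) \<in> ?V \<and>
      f (\<Sum>p\<in>J. weyl_scale (a p) (partial_elem p)) = (\<Sum>p\<in>J. weyl_scale (a p) (f (partial_elem p)))"
    if "finite J" "J \<subseteq> I" for J a
    using that
    by (induction J rule: finite_induct) (simp_all add: f0 add scale base weyl.span_add weyl.span_scale weyl.span_zero)
  have inj: "inj_on (\<lambda>p. f (partial_elem p)) I"
  proof (rule inj_onI)
    fix p q assume "p \<in> I" "q \<in> I" "f (partial_elem p) = f (partial_elem q)"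
    then have "partial_elem p = (partial_elem q :: 'f weyl)" using assms(3) base by (auto dest: inj_onD)
    then have "D_coeff (partial_elem p :: 'f weyl) p = D_coeff (partial_elem q :: 'f weyl) p" by simp
    then show "p = q" by (simp add: D_coeff_partial split: if_splits)
  qed
  have "weyl.independent ((\<lambda>p. f (partial_elem p)) ` I)"
  proof (rule weyl.independent_if_scalars_zero)
    fix g x assume "(\<Sum>x\<in>(\<lambda>p. f (partial_elem p)) ` I. weyl_scale (g x) x) = 0" and x: "x \<in> (\<lambda>p. f (partial_elem p)) ` I"
    then have "f (\<Sum>p\<in>I. weyl_scale (g (f (partial_elem p))) (partial_elem p)) = f 0"
      using sum[OF assms(1) order_refl, of "\<lambda>p. g (f (partial_elem p))"] by (simp add: sum.reindex[OF inj] f0)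
    from inj_onD[OF assms(3) this conjunct1[OF sum[OF assms(1) order_refl]] weyl.span_zero]
    have zero: "(\<Sum>p\<in>I. weyl_scale (g (f (partial_elem p))) (partial_elem p)) = (0 :: 'f weyl)" .
    obtain q where q: "q \<in> I" "x = f (partial_elem q)" using x by blast
    have D_sum: "D_coeff (\<Sum>p\<in>I. weyl_scale (a p) (partial_elem p)) q = (a q :: 'f)" for a
    proof -
      have "D_coeff (\<Sum>p\<in>J. weyl_scale (a p) (partial_elem p)) q = (\<Sum>p\<in>J. if p = q then a p else 0)"
        if "finite J" for J
        using that by (induction J rule: finite_induct) (simp_all add: D_coeff_add D_coeff_scale D_coeff_partial)
      then show ?thesis using q(1) assms(1) by simp
    qed
    show "g x = 0" using D_sum[of "\<lambda>p. g (f (partial_elem p))"] zero q by simp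
  qed (use assms(1) in simp)
  moreover have "(\<lambda>p. f (partial_elem p)) ` I \<subseteq> weyl.span (partial_elem ` I')" using image base by blast
  ultimately have "card ((\<lambda>p. f (partial_elem p)) ` I) \<le> card (partial_elem ` I' :: 'f weyl set)"
    using weyl.independent_span_bound[of "partial_elem ` I'"] assms(2) by blast
  then show ?thesis using card_image[OF inj] card_image_le[OF assms(2), of partial_elem] by (metis le_trans)
qed

text \<open>Dimension counts for D and D_2. Equality of the ranks follows by using the inverse
  isomorphism as well.\<close>

lemma weyl_lie_iso_pair_ranks:
  assumes "weyl_lie_iso_pair l1 l2 l1' l2' \<Gamma> \<Gamma>' \<sigma> \<sigma>'"
  shows "l1 + l2 \<le> l1' + l2'" "l2 \<le> l2'"
proof -
  interpret weyl_lie_iso_pair l1 l2 l1' l2' \<Gamma> \<Gamma>' \<sigma> \<sigma>' by (rule assms)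
  have inj: "inj_on D_map (D_space l1 l2)" using inv_D_map by (metis inj_on_inverseI)
  have "card {1..l1 + l2} \<le> card {1..l1' + l2'}"
    by (rule partial_span_card_le[where f = D_map], unfold D_space_def[symmetric])
      (use inj D_map_add D_map_scale D_map(2) in blast)+
  then show "l1 + l2 \<le> l1' + l2'" by simp
  have sub: "D2_space l1 l2 \<subseteq> D_space l1 l2" by (auto simp: D2_space_iff)
  have "card {l1 + 1..l1 + l2} \<le> card {l1' + 1..l1' + l2'}"
    by (rule partial_span_card_le[where f = D_map], unfold D2_space_def[symmetric])
      (use inj inj_on_subset[OF inj sub] sub D_map_add D_map_scale D_map_D2 in blast)+
  then show "l2 \<le> l2'" by simp
qed

lemma lie_iso_imp_pair:
  assumes \<Gamma>: "nondegenerate_subgroup (l1 + l2) \<Gamma>" "nondegenerate_subgroup (l1' + l2') \<Gamma>'"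
    and \<sigma>: "lie_iso (weyl_carrier l1 l2 \<Gamma>) (weyl_carrier l1' l2' \<Gamma>') \<sigma>"
  shows "weyl_lie_iso_pair l1 l2 l1' l2' \<Gamma> \<Gamma>' \<sigma> (inv_into (weyl_carrier l1 l2 \<Gamma>) \<sigma>)"
proof -
  have bij: "bij_betw \<sigma> (weyl_carrier l1 l2 \<Gamma>) (weyl_carrier l1' l2' \<Gamma>')"
    using \<sigma> by (simp add: lie_iso_def linear_iso_def)
  have "weyl_lie_iso l1 l2 l1' l2' \<Gamma> \<Gamma>' \<sigma> (inv_into (weyl_carrier l1 l2 \<Gamma>) \<sigma>)"
    by unfold_locales
      (use \<Gamma> \<sigma> bij bij_betw_inv_into_left[OF bij] bij_betw_inv_into_right[OF bij]
        bij_betwE[OF bij] bij_betwE[OF bij_betw_inv_into[OF bij]] in \<open>auto simp: lie_iso_def linear_iso_def\<close>)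
  then show ?thesis by (rule weyl_lie_iso.pair)
qed

section \<open>Faithfulness of the action on the algebra\<close>

lemma alg_deriv_pow_weight:
  "alg_deriv_pow \<mu> (single (\<gamma>, 0) 1) = single (\<gamma>, 0) (monom_eval (lookup \<gamma>) \<mu>)"
  using subset_UNIV[of "keys \<mu>"]
  by (induction \<mu> rule: midx_induct) (simp_all add: alg_deriv_pow_add_unit alg_deriv_single monom_eval_add)

lemma lookup_mult_weight:
  fixes u :: "'f::field alg"
  shows "lookup (u * single (\<gamma>, 0) c) (\<alpha> + \<gamma>, i) = lookup u (\<alpha>, i) * c"
proof (rule additive_eqI[where f = "\<lambda>u. lookup (u * single (\<gamma>, 0) c) (\<alpha> + \<gamma>, i)" and g = "\<lambda>u. lookup u (\<alpha>, i) * c"])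
  fix k :: "'f vec \<times> midx" and d
  show "lookup (single k d * single (\<gamma>, 0) c) (\<alpha> + \<gamma>, i) = lookup (single k d) (\<alpha>, i) * c"
    by (cases k) (simp add: mult_single lookup_single when_def)
qed (simp_all add: ring_distribs lookup_add)

lemma mpoly_eval_sum: "mpoly_eval (sum f S) \<xi> = (\<Sum>s\<in>S. mpoly_eval (f s) \<xi>)"
proof -
  have "mpoly_eval 0 \<xi> = 0" by (simp add: mpoly_eval_def)
  then show ?thesis
    by (induction S rule: infinite_finite_induct) (simp_all add: mpoly_eval_add)
qed

text \<open>Applied to x^gamma, \<open>w\<close> has at x^(alpha + gamma) t^i a coefficient that is
  a polynomial in gamma, formed from the coefficients of \<open>w\<close> at (alpha, i). It vanishes
  on \<open>\<Gamma>\<close>, hence identically.\<close>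

lemma wop_faithful:
  fixes \<Gamma> :: "'f::field_char_0 vec set"
  assumes \<Gamma>: "nondegenerate_subgroup (l1 + l2) \<Gamma>" and w: "w \<in> weyl_carrier l1 l2 \<Gamma>"
    and zero: "\<And>v. v \<in> alg_carrier l1 \<Gamma> \<Longrightarrow> wop w v = 0"
  shows "w = 0"
proof -
  have "lookup (lookup w \<mu>) (\<alpha>, i) = 0" for \<mu> \<alpha> i
  proof -
    define c where "c = (\<Sum>\<nu>\<in>keys w. single \<nu> (lookup (lookup w \<nu>) (\<alpha>, i)))"
    have "keys c \<subseteq> keys w"
      unfolding c_def by (rule order_trans[OF keys_sum]) (auto split: if_splits)
    then have "keys c \<subseteq> multi_indices (l1 + l2)" using w by (auto simp: weyl_carrier_def)
    moreover have "mpoly_eval c \<gamma> = 0" if "\<gamma> \<in> \<Gamma>" for \<gamma>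
    proof -
      have "wop w (single (\<gamma>, 0) 1) = 0" using that by (intro zero alg_carrier_single) simp_all
      then have "lookup (wop w (single (\<gamma>, 0) 1)) (\<alpha> + \<gamma>, i) = 0" by simp
      then show ?thesis
        by (simp add: wop_def lookup_sum alg_deriv_pow_weight lookup_mult_weight c_def mpoly_eval_sum)
    qed
    ultimately have "c = 0" by (rule mpoly_eval_zero_imp_zero[OF \<Gamma>])
    then have "lookup c \<mu> = 0" by simp
    then show ?thesis
      by (cases "lookup w \<mu> = 0") (simp_all add: c_def lookup_sum lookup_single when_def in_keys_iff)
  qed
  then show ?thesis by (intro poly_mapping_eqI) auto
qed

lemma wop_closed:
  assumes \<Gamma>: "nondegenerate_subgroup l \<Gamma>" and "w \<in> weyl_carrier l1 l2 \<Gamma>" "v \<in> alg_carrier l1 \<Gamma>"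
  shows "wop w v \<in> alg_carrier l1 \<Gamma>"
  unfolding wop_def using assms
  by (intro alg_carrier_sum alg_carrier_mult[OF \<Gamma>] alg_carrier_deriv_pow) (auto simp: weyl_carrier_def)

lemma wop_D: "d \<in> D_space l1 l2 \<Longrightarrow> wop d v = D_act (l1 + l2) d v"
proof -
  assume d: "d \<in> D_space l1 l2"
  have "wop (\<Sum>p=1..l1 + l2. weyl_scale (D_coeff d p) (partial_elem p)) v = D_act (l1 + l2) d v"
    by (simp add: wop_sum_left wop_scale_left partial_elem_def x_monom_zero D_act_def flip: pm_scale_mult_left)
  then show ?thesis by (simp only: D_space_expansion[OF d, symmetric])
qed

lemma D_act_add_right: "D_act l d (u + v) = D_act l d u + D_act l d v"
  by (simp add: D_act_def alg_deriv_add pm.scale_right_distrib sum.distrib)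

lemma D_act_scale_right: "D_act l d (pm_scale c u) = pm_scale c (D_act l d u)"
  by (simp add: D_act_def alg_deriv_scale pm.scale_sum_right mult.commute)

lemma D_act_mult: "D_act l d (u * v) = D_act l d u * v + u * D_act l d v"
  by (simp add: D_act_def alg_deriv_mult pm.scale_right_distrib sum.distrib
      sum_distrib_left sum_distrib_right flip: pm_scale_mult_left pm_scale_mult_right)

lemma D_act_sum_right: "D_act l d (sum f S) = (\<Sum>s\<in>S. D_act l d (f s))"
proof -
  have "D_act l d 0 = 0" by (simp add: D_act_def)
  then show ?thesis
    by (induction S rule: infinite_finite_induct) (simp_all add: D_act_add_right)
qed

lemma D_act_unit:
  assumes "r \<in> {1..l}"
  shows "D_act l d (single (0, unit_midx r) c) = single (0, 0) (D_coeff d r * c)"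
proof -
  have pairing0: "pairing l 0 d = 0" by (simp add: pairing_def)
  have "D_act l d (single (0, unit_midx r) c) =
      (\<Sum>q=1..l. single (0, unit_midx r - unit_midx q) (D_coeff d q * (c * of_nat (lookup (unit_midx r) q))))"
    by (simp only: D_act_single pairing0 pm.scale_zero_left add_0)
  also have "\<dots> = (\<Sum>q=1..l. if q = r then single (0, 0) (D_coeff d r * c) else 0)"
    by (rule sum.cong) (auto simp: lookup_unit)
  finally show ?thesis using assms by simp
qed

section \<open>Construction of associative isomorphisms\<close>

lemma single_prod_split: "single (\<alpha>, i) c = pm_scale c (single (\<alpha>, 0) 1 * single (0, i) 1)"
  by (simp add: mult_single)

lemma monom_eval_variables: "monom_eval (\<lambda>p. single (0, unit_midx p) 1) i = (single (0, i) 1 :: 'f::field alg)"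
  using subset_UNIV[of "keys i"]
proof (induction i rule: midx_induct)
  case zero
  then show ?case by (simp flip: zero_prod_def)
qed (simp add: monom_eval_add mult_single)

text \<open>The ranks are already identified, and the inverses of tau and phi are parameters, so
  that every construction is available in both directions.\<close>

locale weyl_iso_data =
  fixes l1 l2 :: nat and \<Gamma> \<Gamma>' :: "'f::field_char_0 vec set"
    and \<tau> \<tau>' :: "'f vec \<Rightarrow> 'f vec" and \<phi> \<phi>' :: "'f weyl \<Rightarrow> 'f weyl"
  assumes \<Gamma>: "nondegenerate_subgroup (l1 + l2) \<Gamma>" and \<Gamma>': "nondegenerate_subgroup (l1 + l2) \<Gamma>'"
    and \<tau>_in: "\<alpha> \<in> \<Gamma> \<Longrightarrow> \<tau> \<alpha> \<in> \<Gamma>'" and \<tau>'_in: "\<beta> \<in> \<Gamma>' \<Longrightarrow> \<tau>' \<beta> \<in> \<Gamma>"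
    and \<tau>'_\<tau>: "\<alpha> \<in> \<Gamma> \<Longrightarrow> \<tau>' (\<tau> \<alpha>) = \<alpha>" and \<tau>_\<tau>': "\<beta> \<in> \<Gamma>' \<Longrightarrow> \<tau> (\<tau>' \<beta>) = \<beta>"
    and \<tau>_add: "\<alpha> \<in> \<Gamma> \<Longrightarrow> \<beta> \<in> \<Gamma> \<Longrightarrow> \<tau> (\<alpha> + \<beta>) = \<tau> \<alpha> + \<tau> \<beta>"
    and \<phi>_in: "d \<in> D_space l1 l2 \<Longrightarrow> \<phi> d \<in> D_space l1 l2"
    and \<phi>'_in: "d \<in> D_space l1 l2 \<Longrightarrow> \<phi>' d \<in> D_space l1 l2"
    and \<phi>'_\<phi>: "d \<in> D_space l1 l2 \<Longrightarrow> \<phi>' (\<phi> d) = d" and \<phi>_\<phi>': "d \<in> D_space l1 l2 \<Longrightarrow> \<phi> (\<phi>' d) = d"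
    and \<phi>_add: "d \<in> D_space l1 l2 \<Longrightarrow> d' \<in> D_space l1 l2 \<Longrightarrow> \<phi> (d + d') = \<phi> d + \<phi> d'"
    and \<phi>_scale: "d \<in> D_space l1 l2 \<Longrightarrow> \<phi> (weyl_scale c d) = weyl_scale c (\<phi> d)"
    and \<phi>_D2: "d \<in> D2_space l1 l2 \<Longrightarrow> \<phi> d \<in> D2_space l1 l2"
    and \<phi>'_D2: "d \<in> D2_space l1 l2 \<Longrightarrow> \<phi>' d \<in> D2_space l1 l2"
    and pairing: "\<alpha> \<in> \<Gamma> \<Longrightarrow> d \<in> D_space l1 l2 \<Longrightarrow> pairing (l1 + l2) (\<tau> \<alpha>) (\<phi> d) = pairing (l1 + l2) \<alpha> d"
begin

abbreviation W where "W \<equiv> weyl_carrier l1 l2 \<Gamma>"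
abbreviation W' where "W' \<equiv> weyl_carrier l1 l2 \<Gamma>'"
abbreviation A where "A \<equiv> alg_carrier l1 \<Gamma>"
abbreviation A' where "A' \<equiv> alg_carrier l1 \<Gamma>'"
abbreviation D where "D \<equiv> D_space l1 l2 :: 'f weyl set"

lemma inverse: "weyl_iso_data l1 l2 \<Gamma>' \<Gamma> \<tau>' \<tau> \<phi>' \<phi>"
proof
  fix \<alpha> \<beta> assume ab: "\<alpha> \<in> \<Gamma>'" "\<beta> \<in> \<Gamma>'"
  have "\<tau>' \<alpha> + \<tau>' \<beta> \<in> \<Gamma>" using \<Gamma> ab \<tau>'_in by (auto simp: nondegenerate_subgroup_def)
  from \<tau>'_\<tau>[OF this] show "\<tau>' (\<alpha> + \<beta>) = \<tau>' \<alpha> + \<tau>' \<beta>" using ab by (simp add: \<tau>_add \<tau>'_in \<tau>_\<tau>')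
next
  fix d d' :: "'f weyl" assume dd: "d \<in> D" "d' \<in> D"
  from \<phi>'_\<phi>[OF D_space_add[OF dd[THEN \<phi>'_in]]] show "\<phi>' (d + d') = \<phi>' d + \<phi>' d'"
    using dd by (simp add: \<phi>_add \<phi>'_in \<phi>_\<phi>')
next
  fix d :: "'f weyl" and c assume d: "d \<in> D"
  from \<phi>'_\<phi>[OF D_space_scale[OF d[THEN \<phi>'_in]]] show "\<phi>' (weyl_scale c d) = weyl_scale c (\<phi>' d)"
    using d by (simp add: \<phi>_scale \<phi>'_in \<phi>_\<phi>')
next
  fix \<alpha> and d :: "'f weyl" assume "\<alpha> \<in> \<Gamma>'" "d \<in> D"
  then show "pairing (l1 + l2) (\<tau>' \<alpha>) (\<phi>' d) = pairing (l1 + l2) \<alpha> d"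
    using pairing[of "\<tau>' \<alpha>" "\<phi>' d"] by (simp add: \<tau>'_in \<phi>'_in \<tau>_\<tau>' \<phi>_\<phi>')
qed (use \<Gamma> \<Gamma>' \<tau>_in \<tau>'_in \<tau>'_\<tau> \<tau>_\<tau>' \<phi>_in \<phi>'_in \<phi>'_\<phi> \<phi>_\<phi>' \<phi>_D2 \<phi>'_D2 in auto)

lemma \<phi>_sum:
  "(\<And>s. s \<in> S \<Longrightarrow> f s \<in> D) \<Longrightarrow> \<phi> (sum f S) = (\<Sum>s\<in>S. \<phi> (f s)) \<and> sum f S \<in> D"
proof (induction S rule: infinite_finite_induct)
  case (insert x S)
  then show ?case by (simp add: \<phi>_add D_space_add)
qed (use \<phi>_add[OF D_space_zero D_space_zero] in \<open>simp_all add: D_space_zero\<close>)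

end

locale weyl_iso_data_pair = weyl_iso_data l1 l2 \<Gamma> \<Gamma>' \<tau> \<tau>' \<phi> \<phi>' +
  inv: weyl_iso_data l1 l2 \<Gamma>' \<Gamma> \<tau>' \<tau> \<phi>' \<phi>
  for l1 l2 :: nat and \<Gamma> \<Gamma>' :: "'f::field_char_0 vec set"
    and \<tau> \<tau>' :: "'f vec \<Rightarrow> 'f vec" and \<phi> \<phi>' :: "'f weyl \<Rightarrow> 'f weyl"

lemma (in weyl_iso_data) pair: "weyl_iso_data_pair l1 l2 \<Gamma> \<Gamma>' \<tau> \<tau>' \<phi> \<phi>'"
  by (intro weyl_iso_data_pair.intro weyl_iso_data_axioms inverse)

text \<open>The blocks with indices up to l1 describe phi and its inverse modulo D_2. They are
  inverse to each other because \<open>\<phi>'\<close> preserves D_2: the terms with r > l1 have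
  coefficient 0 at \<open>p\<close>.\<close>

lemma (in weyl_iso_data_pair) matrix_inverse:
  assumes "s \<in> {1..l1 + l2}" "p \<in> {1..l1}"
  shows "(\<Sum>r=1..l1. D_coeff (\<phi> (partial_elem s)) r * D_coeff (\<phi>' (partial_elem r)) p) = (if p = s then 1 else 0)"
proof -
  note s = partial_in_D_space[OF assms(1)]
  have expansion: "\<phi>' (\<phi> (partial_elem s)) = (\<Sum>r=1..l1 + l2. weyl_scale (D_coeff (\<phi> (partial_elem s)) r) (\<phi>' (partial_elem r)))"
    by (subst D_space_expansion[OF \<phi>_in[OF s]], subst conjunct1[OF inv.\<phi>_sum])
      (auto simp: partial_in_D_space D_space_scale inv.\<phi>_scale)
  have coeff_sum: "D_coeff (sum f S) p = (\<Sum>x\<in>S. D_coeff (f x) p)" for f :: "nat \<Rightarrow> 'f weyl" and S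
    by (induction S rule: infinite_finite_induct) (simp_all add: D_coeff_add)
  have "(\<Sum>r=1..l1 + l2. D_coeff (\<phi> (partial_elem s)) r * D_coeff (\<phi>' (partial_elem r)) p) =
      D_coeff (\<phi>' (\<phi> (partial_elem s))) p"
    unfolding expansion by (simp only: coeff_sum D_coeff_scale)
  also have "\<dots> = D_coeff (partial_elem s) p" by (simp only: \<phi>'_\<phi>[OF s])
  finally have "(\<Sum>r=1..l1 + l2. D_coeff (\<phi> (partial_elem s)) r * D_coeff (\<phi>' (partial_elem r)) p) =
      D_coeff (partial_elem s) p" .
  moreover have "(\<Sum>r=1..l1 + l2. D_coeff (\<phi> (partial_elem s)) r * D_coeff (\<phi>' (partial_elem r)) p) =
      (\<Sum>r=1..l1. D_coeff (\<phi> (partial_elem s)) r * D_coeff (\<phi>' (partial_elem r)) p)"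
  proof (rule sum.mono_neutral_right)
    show "\<forall>r\<in>{1..l1 + l2} - {1..l1}. D_coeff (\<phi> (partial_elem s)) r * D_coeff (\<phi>' (partial_elem r)) p = 0"
    proof
      fix r assume r: "r \<in> {1..l1 + l2} - {1..l1}"
      then have "partial_elem r \<in> D2_space l1 l2"
        using partial_in_D_space[of r l1 l2] by (auto simp: D2_space_iff D_coeff_partial)
      then have "\<phi>' (partial_elem r) \<in> D2_space l1 l2" by (rule \<phi>'_D2)
      then show "D_coeff (\<phi> (partial_elem s)) r * D_coeff (\<phi>' (partial_elem r)) p = 0"
        using assms(2) by (simp add: D2_space_iff)
    qed
  qed auto
  ultimately show ?thesis by (simp add: D_coeff_partial)
qed

context weyl_iso_data
begin

text \<open>The images of the variables are the linear combinations dual to \<open>\<phi> \<partial>\<^sub>1, \<dots>\<close>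
  modulo \<open>D\<^sub>2\<close>.\<close>

definition var_image :: "nat \<Rightarrow> 'f alg" where
  "var_image p = (\<Sum>r=1..l1. single (0, unit_midx r) (D_coeff (\<phi>' (partial_elem r)) p))"

definition alg_map :: "'f alg \<Rightarrow> 'f alg" where
  "alg_map u = (\<Sum>k\<in>keys u. pm_scale (lookup u k) (single (\<tau> (fst k), 0) 1 * monom_eval var_image (snd k)))"

lemma alg_map_add: "alg_map (u + v) = alg_map u + alg_map v"
  unfolding alg_map_def
  by (rule sum_keys_add[where f = "\<lambda>k c. pm_scale c (single (\<tau> (fst k), 0) 1 * monom_eval var_image (snd k))"])
    (simp_all add: pm.scale_left_distrib)

lemma alg_map_zero [simp]: "alg_map 0 = 0"
  by (simp add: alg_map_def)

lemma alg_map_single: "alg_map (single (\<alpha>, i) c) = pm_scale c (single (\<tau> \<alpha>, 0) 1 * monom_eval var_image i)"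
  by (cases "c = 0") (simp_all add: alg_map_def)

lemma alg_map_scale: "alg_map (pm_scale c u) = pm_scale c (alg_map u)"
proof (rule additive_eqI[where f = "\<lambda>u. alg_map (pm_scale c u)" and g = "\<lambda>u. pm_scale c (alg_map u)"])
  fix k :: "'f vec \<times> midx" and d
  show "alg_map (pm_scale c (single k d)) = pm_scale c (alg_map (single k d))"
    by (cases k) (simp add: alg_map_single)
qed (simp_all add: alg_map_add pm.scale_right_distrib)

lemma alg_map_sum: "alg_map (sum f S) = (\<Sum>s\<in>S. alg_map (f s))"
  by (induction S rule: infinite_finite_induct) (simp_all add: alg_map_add)

lemma \<tau>_zero: "\<tau> 0 = 0"
  using \<tau>_add[of 0 0] \<Gamma> by (simp add: nondegenerate_subgroup_def)

lemma alg_map_mult: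
  assumes "u \<in> A" "v \<in> A"
  shows "alg_map (u * v) = alg_map u * alg_map v"
proof (rule biadditive_eqI[where f = "\<lambda>u v. alg_map (u * v)" and g = "\<lambda>u v. alg_map u * alg_map v"])
  fix k l :: "'f vec \<times> midx" and c d
  assume k: "k \<in> keys u" and l: "l \<in> keys v"
  obtain \<alpha> i \<beta> j where kl: "k = (\<alpha>, i)" "l = (\<beta>, j)" by (cases k, cases l)
  have ab: "\<alpha> \<in> \<Gamma>" "\<beta> \<in> \<Gamma>" using assms k l by (auto simp: alg_carrier_def kl)
  have "single (\<tau> (\<alpha> + \<beta>), 0) 1 = (single (\<tau> \<alpha>, 0) 1 * single (\<tau> \<beta>, 0) 1 :: 'f alg)"
    by (simp add: \<tau>_add[OF ab] mult_single)
  then show "alg_map (single k c * single l d) = alg_map (single k c) * alg_map (single l d)"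
    by (simp add: kl mult_single[of "(\<alpha>, i)"] alg_map_single monom_eval_add pm_scale_mult_left[symmetric]
        pm_scale_mult_right[symmetric] mult_ac)
qed (simp_all add: alg_map_add ring_distribs)

lemma alg_map_one: "alg_map 1 = 1"
  using alg_map_single[of 0 0 1] \<tau>_zero by (simp flip: zero_prod_def)

lemma alg_map_var: "alg_map (single (0, unit_midx p) 1) = var_image p"
  using \<tau>_zero by (simp add: alg_map_single flip: zero_prod_def)

lemma var_image_in: "var_image p \<in> A'"
  unfolding var_image_def using \<Gamma>'
  by (intro alg_carrier_sum alg_carrier_single multi_indices_unit) (auto simp: nondegenerate_subgroup_def)

lemma monom_eval_var_image_in: "monom_eval var_image i \<in> A'"
  using subset_UNIV[of "keys i"]
  by (induction i rule: midx_induct)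
    (simp_all add: one_in_alg_carrier[OF \<Gamma>'] monom_eval_add alg_carrier_mult[OF \<Gamma>'] var_image_in)

lemma alg_map_in: "u \<in> A \<Longrightarrow> alg_map u \<in> A'"
  unfolding alg_map_def
  by (intro alg_carrier_sum alg_carrier_scale alg_carrier_mult[OF \<Gamma>'] monom_eval_var_image_in alg_carrier_single \<tau>_in)
    (auto simp: alg_carrier_def)

end

context weyl_iso_data_pair
begin

lemma inv_pair: "weyl_iso_data_pair l1 l2 \<Gamma>' \<Gamma> \<tau>' \<tau> \<phi>' \<phi>"
  by (rule inv.pair)

text \<open>Both maps act linearly on the span of the variables, and composing them multiplies the
  two matrices of \<open>matrix_inverse\<close>.\<close>

lemma inv_alg_map_var_image:
  assumes p: "p \<in> {1..l1}"
  shows "inv.alg_map (var_image p) = single (0, unit_midx p) 1"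
proof -
  have 1: "single (0, unit_midx r) c = pm_scale c (single (0, unit_midx r) (1::'f))" for r and c :: 'f
    by simp
  have "inv.alg_map (var_image p) = (\<Sum>r=1..l1. pm_scale (D_coeff (\<phi>' (partial_elem r)) p) (inv.var_image r))"
    unfolding var_image_def inv.alg_map_sum
    by (subst 1) (simp only: inv.alg_map_scale inv.alg_map_var)
  also have "\<dots> = (\<Sum>r=1..l1. \<Sum>s=1..l1. single (0, unit_midx s) (D_coeff (\<phi>' (partial_elem r)) p * D_coeff (\<phi> (partial_elem s)) r))"
    by (simp add: inv.var_image_def pm.scale_sum_right)
  also have "\<dots> = (\<Sum>s=1..l1. single (0, unit_midx s) (\<Sum>r=1..l1. D_coeff (\<phi> (partial_elem s)) r * D_coeff (\<phi>' (partial_elem r)) p))"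
    by (subst sum.swap) (simp add: single_sum mult.commute)
  also have "\<dots> = (\<Sum>s=1..l1. if s = p then single (0, unit_midx p) 1 else 0)"
    by (rule sum.cong[OF refl], subst matrix_inverse) (use p in auto)
  finally show ?thesis using p by simp
qed

lemma inv_alg_map_monom:
  assumes "i \<in> multi_indices l1"
  shows "inv.alg_map (monom_eval var_image i) = single (0, i) 1"
proof -
  have "keys i \<subseteq> {1..l1}" using assms by (simp add: multi_indices_def)
  then have "inv.alg_map (monom_eval var_image i) = monom_eval (\<lambda>p. single (0, unit_midx p) 1) i"
  proof (induction i rule: midx_induct)
    case zero
    then show ?case by (simp add: inv.alg_map_one)
  next
    case (add_unit \<mu> p)
    then show ?case
      by (simp add: monom_eval_add inv.alg_map_mult[OF monom_eval_var_image_in var_image_in]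
          inv_alg_map_var_image)
  qed
  then show ?thesis by (simp add: monom_eval_variables)
qed

lemma inv_alg_map:
  assumes "u \<in> A"
  shows "inv.alg_map (alg_map u) = u"
proof (rule additive_eqI[where f = "\<lambda>u. inv.alg_map (alg_map u)" and g = "\<lambda>u. u"])
  fix k :: "'f vec \<times> midx" and c assume k: "k \<in> keys u"
  obtain \<alpha> i where ki: "k = (\<alpha>, i)" by (cases k)
  have ai: "\<alpha> \<in> \<Gamma>" "i \<in> multi_indices l1" using assms k by (auto simp: alg_carrier_def ki)
  have "single (\<tau> \<alpha>, 0) 1 \<in> A'" using ai \<tau>_in by (simp add: alg_carrier_single)
  then show "inv.alg_map (alg_map (single k c)) = single k c"
    using ai by (simp add: ki alg_map_single inv.alg_map_scale inv.alg_map_mult monom_eval_var_image_in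
        inv_alg_map_monom inv.alg_map_single[of "\<tau> \<alpha>"] \<tau>'_\<tau> mult_single)
qed (simp_all add: alg_map_add inv.alg_map_add)

lemma alg_map_inv: "u \<in> A' \<Longrightarrow> alg_map (inv.alg_map u) = u"
  using weyl_iso_data_pair.inv_alg_map[OF inv_pair] .

text \<open>Both sides obey the same Leibniz rule along \<open>alg_map\<close>, so generators
  suffice: on x^alpha the identity is the pairing condition, on t_p it is
  \<open>matrix_inverse\<close>.\<close>

lemma alg_map_deriv:
  assumes q: "q \<in> {1..l1 + l2}" and u: "u \<in> A"
  shows "alg_map (alg_deriv q u) = D_act (l1 + l2) (\<phi> (partial_elem q)) (alg_map u)"
proof -
  let ?d = "\<phi> (partial_elem q)"
  \<comment> \<open>Membership in \<open>A\<close> is part of \<open>Q\<close> because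
    multiplicativity of \<open>alg_map\<close> is known on A only.\<close>
  define Q where "Q u \<longleftrightarrow> u \<in> A \<and> alg_map (alg_deriv q u) = D_act (l1 + l2) ?d (alg_map u)" for u
  have Q_mult: "Q (u * v)" if "Q u" "Q v" for u v
    using that by (simp add: Q_def alg_deriv_mult alg_map_add alg_map_mult alg_carrier_mult[OF \<Gamma>]
        alg_carrier_deriv D_act_mult)
  have Q_weight: "Q (single (\<alpha>, 0) 1)" if \<alpha>: "\<alpha> \<in> \<Gamma>" for \<alpha>
  proof -
    have "pairing (l1 + l2) (\<tau> \<alpha>) ?d = lookup \<alpha> q"
      using pairing[OF \<alpha> partial_in_D_space[OF q]] by (simp add: pairing_partial[OF q])
    then show ?thesis
      using \<alpha> by (simp add: Q_def alg_carrier_single alg_deriv_single alg_map_single D_act_single)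
  qed
  have Q_var: "Q (single (0, unit_midx p) 1)" if p: "p \<in> {1..l1}" for p
  proof -
    have "0 \<in> \<Gamma>" using \<Gamma> by (simp add: nondegenerate_subgroup_def)
    have "D_act (l1 + l2) ?d (var_image p) = (\<Sum>r=1..l1. single (0, 0) (D_coeff ?d r * D_coeff (\<phi>' (partial_elem r)) p))"
      unfolding var_image_def D_act_sum_right by (rule sum.cong) (simp_all add: D_act_unit)
    also have "\<dots> = single (0, 0) (\<Sum>r=1..l1. D_coeff ?d r * D_coeff (\<phi>' (partial_elem r)) p)"
      by (simp only: single_sum)
    also have "\<dots> = single (0, 0) (if p = q then 1 else 0)"
      using matrix_inverse[OF q p] by simp
    also have "\<dots> = alg_map (single (0, 0) (if p = q then 1 else 0))"
      by (simp add: alg_map_single \<tau>_zero)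
    finally show ?thesis
      using \<open>0 \<in> \<Gamma>\<close> p multi_indices_unit[OF p]
      by (auto simp: Q_def alg_carrier_single alg_deriv_single alg_map_var lookup_unit)
  qed
  have Q_monom: "Q (single (0, i) 1)" if "keys i \<subseteq> {1..l1}" for i
    using that
  proof (induction i rule: midx_induct)
    case zero
    show ?case using Q_weight[of 0] \<Gamma> by (simp add: nondegenerate_subgroup_def)
  next
    case (add_unit \<mu> p)
    have "single (0, \<mu> + unit_midx p) 1 = (single (0, \<mu>) 1 * single (0, unit_midx p) 1 :: 'f alg)"
      by (simp add: mult_single)
    then show ?case using Q_mult[OF add_unit(3) Q_var[OF add_unit(2)]] by simp
  qed
  show ?thesis
  proof (rule additive_eqI[where f = "\<lambda>u. alg_map (alg_deriv q u)" and g = "\<lambda>u. D_act (l1 + l2) ?d (alg_map u)"])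
    fix k :: "'f vec \<times> midx" and c assume k: "k \<in> keys u"
    obtain \<alpha> i where ki: "k = (\<alpha>, i)" by (cases k)
    have ai: "\<alpha> \<in> \<Gamma>" "keys i \<subseteq> {1..l1}" using u k by (auto simp: alg_carrier_def multi_indices_def ki)
    have "Q (single (\<alpha>, 0) 1 * single (0, i) 1)" by (intro Q_mult Q_weight Q_monom ai)
    then show "alg_map (alg_deriv q (single k c)) = D_act (l1 + l2) ?d (alg_map (single k c))"
      unfolding ki single_prod_split[of \<alpha> i c] Q_def
      by (simp only: alg_deriv_scale alg_map_scale D_act_scale_right)
  qed (simp_all add: alg_deriv_add alg_map_add D_act_add_right)
qed

text \<open>Says that \<open>w'\<close> represents the operator of \<open>w\<close> conjugated by
  \<open>alg_map\<close>. As a relation it needs no formula for \<open>w'\<close>: existence and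
  uniqueness are proved separately.\<close>

definition intertwines :: "'f weyl \<Rightarrow> 'f weyl \<Rightarrow> bool" where
  "intertwines w w' \<longleftrightarrow> w' \<in> W' \<and>
    (\<forall>v\<in>A. wop w' (alg_map v) = alg_map (wop w v))"

text \<open>Since \<open>alg_map\<close> is onto A', both candidates act alike on all of A', and the
  action is faithful.\<close>

lemma intertwines_unique:
  assumes "intertwines w w1" "intertwines w w2"
  shows "w1 = w2"
proof -
  have "w1 - w2 = 0"
  proof (rule wop_faithful[OF \<Gamma>'])
    show "w1 - w2 \<in> W'" using assms by (simp add: intertwines_def weyl_carrier_diff)
    fix v assume v: "v \<in> A'"
    have "wop w1 (alg_map (inv.alg_map v)) = wop w2 (alg_map (inv.alg_map v))"
      using assms inv.alg_map_in[OF v] by (simp add: intertwines_def)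
    then have "wop w1 v = wop w2 v" by (simp add: alg_map_inv[OF v])
    then show "wop (w1 - w2) v = 0" using wop_add_left[of "w1 - w2" w2 v] by simp
  qed
  then show ?thesis by simp
qed

text \<open>Conjugation turns multiplication by u into multiplication by its image, and \<partial>_p
  into phi(\<partial>_p); the derivations are split off one at a time.\<close>

lemma intertwines_single:
  assumes "keys \<mu> \<subseteq> {1..l1 + l2}" "u \<in> A"
  shows "\<exists>w'. intertwines (single \<mu> u) w'"
  using assms(1)
proof (induction \<mu> rule: midx_induct)
  case zero
  have "intertwines (single 0 u) (single 0 (alg_map u))"
    using assms(2) by (simp add: intertwines_def weyl_carrier_single alg_map_in alg_map_mult)
  then show ?case ..
next
  case (add_unit \<mu> p)
  then obtain w' where w': "intertwines (single \<mu> u) w'" by blast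
  note p = \<phi>_in[OF partial_in_D_space[OF add_unit(2)]]
  have "intertwines (single (\<mu> + unit_midx p) u) (weyl_mult w' (\<phi> (partial_elem p)))"
    using w' p D_space_subset_weyl_carrier[OF \<Gamma>']
    by (auto simp: intertwines_def wop_mult wop_D[OF p] alg_map_deriv[OF add_unit(2), symmetric]
        alg_carrier_deriv alg_deriv_pow_comp intro!: weyl_carrier_mult[OF \<Gamma>'])
  then show ?case ..
qed

lemma intertwines_exists:
  assumes w: "w \<in> W"
  shows "\<exists>w'. intertwines w w'"
proof (induction w rule: poly_mapping_add_induct)
  case zero
  then show ?case by (auto simp: intertwines_def weyl_carrier_zero intro: exI[of _ 0])
next
  case (add a b)
  then obtain a' b' where "intertwines a a'" "intertwines b b'" by blast
  then have "intertwines (a + b) (a' + b')"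
    by (simp add: intertwines_def weyl_carrier_add wop_add_left alg_map_add)
  then show ?case ..
next
  case (single \<mu>)
  then show ?case using w by (intro intertwines_single) (auto simp: weyl_carrier_def multi_indices_def)
qed

definition weyl_map :: "'f weyl \<Rightarrow> 'f weyl" where
  "weyl_map w = (THE w'. intertwines w w')"

lemma weyl_map: "w \<in> W \<Longrightarrow> intertwines w (weyl_map w)"
  unfolding weyl_map_def using intertwines_exists intertwines_unique by (metis theI)

lemma weyl_map_eqI: "intertwines w w' \<Longrightarrow> weyl_map w = w'"
  unfolding weyl_map_def using intertwines_unique by blast

interpretation inv_pair: weyl_iso_data_pair l1 l2 \<Gamma>' \<Gamma> \<tau>' \<tau> \<phi>' \<phi>
  by (rule inv_pair)

text \<open>Conjugating back: \<open>w\<close> itself satisfies the relation that determines the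
  image of \<open>weyl_map w\<close> under the inverse construction.\<close>

lemma inv_weyl_map:
  assumes w: "w \<in> W"
  shows "inv_pair.weyl_map (weyl_map w) = w"
proof (rule inv_pair.weyl_map_eqI)
  have "wop w (inv.alg_map v) = inv.alg_map (wop (weyl_map w) v)" if v: "v \<in> A'" for v
  proof -
    have v': "inv.alg_map v \<in> A" using v by (rule inv.alg_map_in)
    then have "wop (weyl_map w) v = alg_map (wop w (inv.alg_map v))"
      using weyl_map[OF w] by (simp add: intertwines_def alg_map_inv[OF v] flip: Ball_def) (metis alg_map_inv v)
    then show ?thesis by (simp add: inv_alg_map wop_closed[OF \<Gamma> w v'])
  qed
  then show "inv_pair.intertwines (weyl_map w) w" using w by (simp add: inv_pair.intertwines_def)
qed

text \<open>Each algebraic identity holds because the right-hand side also intertwines with the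
  argument on the left; \<open>wop_mult\<close> turns products into compositions.\<close>

lemma weyl_map_assoc_iso: "assoc_iso W W' weyl_map"
  unfolding assoc_iso_def linear_iso_def
proof (intro conjI ballI allI)
  show "bij_betw weyl_map W W'"
  proof (rule bij_betw_byWitness[where f' = inv_pair.weyl_map])
    show "\<forall>w\<in>W. inv_pair.weyl_map (weyl_map w) = w" using inv_weyl_map by blast
    show "\<forall>w\<in>W'. weyl_map (inv_pair.weyl_map w) = w"
      using weyl_iso_data_pair.inv_weyl_map[OF inv_pair] by blast
    show "weyl_map ` W \<subseteq> W'"
      using weyl_map by (auto simp: intertwines_def)
    show "inv_pair.weyl_map ` W' \<subseteq> W"
      using inv_pair.weyl_map by (auto simp: inv_pair.intertwines_def)
  qed
next
  fix a b assume ab: "a \<in> W" "b \<in> W"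
  show "weyl_map (a + b) = weyl_map a + weyl_map b"
    using weyl_map[OF ab(1)] weyl_map[OF ab(2)]
    by (intro weyl_map_eqI) (simp add: intertwines_def weyl_carrier_add wop_add_left alg_map_add)
  show "weyl_map (weyl_mult a b) = weyl_mult (weyl_map a) (weyl_map b)"
    using weyl_map[OF ab(1)] weyl_map[OF ab(2)] ab
    by (intro weyl_map_eqI)
      (simp add: intertwines_def weyl_carrier_mult[OF \<Gamma>'] wop_mult wop_closed[OF \<Gamma>])
next
  fix a c assume "a \<in> W"
  from weyl_map[OF this] show "weyl_map (weyl_scale c a) = weyl_scale c (weyl_map a)"
    by (intro weyl_map_eqI) (simp add: intertwines_def weyl_carrier_scale wop_scale_left alg_map_scale)
qed

end

lemma assoc_iso_imp_lie_iso:
  assumes \<Gamma>: "nondegenerate_subgroup l \<Gamma>"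
    and \<sigma>: "assoc_iso (weyl_carrier l1 l2 \<Gamma>) W' \<sigma>"
  shows "lie_iso (weyl_carrier l1 l2 \<Gamma>) W' \<sigma>"
  unfolding lie_iso_def
proof (intro conjI ballI)
  show lin: "linear_iso (weyl_carrier l1 l2 \<Gamma>) W' \<sigma>" using \<sigma> by (simp add: assoc_iso_def)
  fix a b assume ab: "a \<in> weyl_carrier l1 l2 \<Gamma>" "b \<in> weyl_carrier l1 l2 \<Gamma>"
  note mult = weyl_carrier_mult[OF \<Gamma>]
  have diff: "\<sigma> (x - y) = \<sigma> x - \<sigma> y" if "x \<in> weyl_carrier l1 l2 \<Gamma>" "y \<in> weyl_carrier l1 l2 \<Gamma>" for x y
  proof -
    have "\<sigma> (x - y + y) = \<sigma> (x - y) + \<sigma> y"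
      using lin weyl_carrier_diff[OF that] that(2) unfolding linear_iso_def by blast
    then show ?thesis by simp
  qed
  show "\<sigma> (weyl_bracket a b) = weyl_bracket (\<sigma> a) (\<sigma> b)"
    using \<sigma> ab unfolding weyl_bracket_def diff[OF mult[OF ab] mult[OF ab(2,1)]]
    by (simp add: assoc_iso_def)
qed

theorem theorem2p1:
  fixes \<Gamma> \<Gamma>' :: "('f::field_char_0) vec set"
    and l1 l2 l1' l2' :: nat
  assumes "l1 + l2 > 0" and "l1' + l2' > 0"
    and "nondegenerate_subgroup (l1 + l2) \<Gamma>"
    and "nondegenerate_subgroup (l1' + l2') \<Gamma>'"
  shows "\<forall>iso\<in>{assoc_iso, lie_iso}.
    (\<exists>\<sigma>. iso (weyl_carrier l1 l2 \<Gamma>) (weyl_carrier l1' l2' \<Gamma>') \<sigma>) \<longleftrightarrow>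
    (\<exists>\<tau> \<phi>. group_iso \<Gamma> \<Gamma>' \<tau> \<and>
       linear_iso (D_space l1 l2) (D_space l1' l2') \<phi> \<and>
       \<phi> ` D2_space l1 l2 = D2_space l1' l2' \<and>
       (l1, l2) = (l1', l2') \<and>
       (\<forall>\<alpha>\<in>\<Gamma>. \<forall>d\<in>D_space l1 l2.
          pairing (l1 + l2) \<alpha> d = pairing (l1' + l2') (\<tau> \<alpha>) (\<phi> d)))"
proof -
  let ?W = "weyl_carrier l1 l2 \<Gamma>" and ?W' = "weyl_carrier l1' l2' \<Gamma>'"
  let ?R = "\<exists>\<tau> \<phi>. group_iso \<Gamma> \<Gamma>' \<tau> \<and>
       linear_iso (D_space l1 l2) (D_space l1' l2') \<phi> \<and>
       \<phi> ` D2_space l1 l2 = D2_space l1' l2' \<and>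
       (l1, l2) = (l1', l2') \<and>
       (\<forall>\<alpha>\<in>\<Gamma>. \<forall>d\<in>D_space l1 l2.
          pairing (l1 + l2) \<alpha> d = pairing (l1' + l2') (\<tau> \<alpha>) (\<phi> d))"
  \<comment> \<open>Both equivalences follow from one cycle: an associative isomorphism is a Lie
    isomorphism, which yields tau and phi, which yield an associative isomorphism.\<close>
  have invariants: ?R if "lie_iso ?W ?W' \<sigma>" for \<sigma>
  proof -
    interpret weyl_lie_iso_pair l1 l2 l1' l2' \<Gamma> \<Gamma>' \<sigma> "inv_into ?W \<sigma>"
      using lie_iso_imp_pair[OF assms(3,4) that] .
    have "l1 = l1'" "l2 = l2'"
      using weyl_lie_iso_pair_ranks[OF weyl_lie_iso_pair_axioms] weyl_lie_iso_pair_ranks[OF inv_pair] by auto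
    then show ?thesis
      using weight_map_group_iso D_map_linear_iso D_map_image_D2 weight_map(2)
      by (intro exI[of _ weight_map] exI[of _ D_map]) simp
  qed
  have construction: "\<exists>\<sigma>. assoc_iso ?W ?W' \<sigma>" if ?R
  proof -
    from that obtain \<tau> \<phi> where \<tau>: "group_iso \<Gamma> \<Gamma>' \<tau>"
      and \<phi>: "linear_iso (D_space l1 l2) (D_space l1' l2') \<phi>" "\<phi> ` D2_space l1 l2 = D2_space l1' l2'"
      and eq: "l1' = l1" "l2' = l2"
      and pair: "\<And>\<alpha> d. \<alpha> \<in> \<Gamma> \<Longrightarrow> d \<in> D_space l1 l2 \<Longrightarrow>
        pairing (l1 + l2) \<alpha> d = pairing (l1' + l2') (\<tau> \<alpha>) (\<phi> d)"
      by blast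
    let ?D = "D_space l1 l2 :: 'f weyl set"
    have bij\<tau>: "bij_betw \<tau> \<Gamma> \<Gamma>'" using \<tau> by (simp add: group_iso_def)
    have bij\<phi>: "bij_betw \<phi> ?D ?D" using \<phi>(1) by (simp add: linear_iso_def eq)
    have D2: "D2_space l1 l2 \<subseteq> ?D" by (auto simp: D2_space_iff)
    have image_D2: "\<phi> ` D2_space l1 l2 = D2_space l1 l2" using \<phi>(2) by (simp only: eq)
    have \<phi>'_D2: "inv_into ?D \<phi> d \<in> D2_space l1 l2" if "d \<in> D2_space l1 l2" for d
    proof -
      from that have "d \<in> \<phi> ` D2_space l1 l2" by (simp only: image_D2)
      then obtain e where "d = \<phi> e" "e \<in> D2_space l1 l2" by (rule imageE)
      then show ?thesis using bij_betw_inv_into_left[OF bij\<phi>] D2 by auto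
    qed
    interpret weyl_iso_data l1 l2 \<Gamma> \<Gamma>' \<tau> "inv_into \<Gamma> \<tau>" \<phi> "inv_into ?D \<phi>"
    proof
      show "\<phi> d \<in> D2_space l1 l2" if "d \<in> D2_space l1 l2" for d
        using imageI[OF that, of \<phi>] by (simp only: image_D2)
    qed (use assms(3,4) \<tau> \<phi>(1) pair \<phi>'_D2 bij_betw_inv_into_left[OF bij\<tau>] bij_betw_inv_into_right[OF bij\<tau>]
        bij_betw_inv_into_left[OF bij\<phi>] bij_betw_inv_into_right[OF bij\<phi>]
        bij_betwE[OF bij\<tau>] bij_betwE[OF bij\<phi>] bij_betwE[OF bij_betw_inv_into[OF bij\<tau>]]
        bij_betwE[OF bij_betw_inv_into[OF bij\<phi>]] in \<open>auto simp: eq group_iso_def linear_iso_def\<close>)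
    show ?thesis
      unfolding eq using weyl_iso_data_pair.weyl_map_assoc_iso[OF pair] by blast
  qed
  have "(\<exists>\<sigma>. assoc_iso ?W ?W' \<sigma>) \<longleftrightarrow> ?R"
  proof
    assume "\<exists>\<sigma>. assoc_iso ?W ?W' \<sigma>"
    then obtain \<sigma> where "assoc_iso ?W ?W' \<sigma>" ..
    from invariants[OF assoc_iso_imp_lie_iso[OF assms(3) this]] show ?R .
  qed (rule construction)
  moreover have "(\<exists>\<sigma>. lie_iso ?W ?W' \<sigma>) \<longleftrightarrow> ?R"
  proof
    assume "\<exists>\<sigma>. lie_iso ?W ?W' \<sigma>"
    then obtain \<sigma> where "lie_iso ?W ?W' \<sigma>" ..
    then show ?R by (rule invariants)
  next
    assume ?R
    from construction[OF this] obtain \<sigma> where "assoc_iso ?W ?W' \<sigma>" ..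
    from assoc_iso_imp_lie_iso[OF assms(3) this] show "\<exists>\<sigma>. lie_iso ?W ?W' \<sigma>" by blast
  qed
  ultimately show ?thesis by (simp only: ball_simps)
qed

end
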